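(* Let $M=\{M_i\}_{1\le i\le m}$ be a family of germs of real analytic totally real $n$-dimensional submanifolds of $\mathbb C^n$ passing through the origin, with anti-holomorphic involutions $\rho_i(z)=B_i\bar z+R_i(\bar z)$, $F_{i,j}=\rho_i\circ\rho_j$, and $G$ the group generated by the family $F=\{F_{i,j}\}_{1\le i,j\le m}$. Assume that $G$ is abelian and that the linear parts $D_{i,j}=\mathrm{diag}(\mu_{i,j,1},\dots,\mu_{i,j,n})$ of the $F_{i,j}$ at $0$ are diagonal; put $D=\{D_{i,j}\}$. Let $\mathcal I$ be a monomial ideal of $\mathcal O_n$ left invariant by the family $D$ and by the $B_i$'s. Assume that either $D$ is diophantine, or $\mathcal I$ is properly embedded and $D$ is diophantine on $\mathcal I$. Assume that $M$ is non-resonant on $\mathcal I$ and that $G$ is formally linearizable on $\mathcal I$. Then the family $F$ is holomorphically linearizable on $\mathcal I$. Moreover, in these (linearizing) coordinates, the $\rho_i$'s are anti-linearized on $\bar{\mathcal I}$, that is, $\rho_i(z)=B_i\bar z \mod \bar{\mathcal I}$ for all $i$.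
   Context: Each $M_i$ is locally the fixed point set of a germ of anti-holomorphic involution $\rho_i(z)=B_i\bar z+R_i(\bar z)$, with $R_i$ a germ of holomorphic map, $R_i(0)=0$, $DR_i(0)=0$, $B_i$ invertible, $B_i\bar B_i=\mathrm{Id}$. The tangent spaces $\{z=B_i\bar z\}$ at $0$ are pairwise distinct. $F_{i,j}$ is a germ of holomorphic diffeomorphism with linear part $D_{i,j}=B_i\bar B_j$. $\mathcal O_n$ (resp. $\widehat{\mathcal O}_n$): germs of holomorphic functions at $0\in\mathbb C^n$ (resp. formal power series). For $Q\in\mathbb N^n$: $|Q|=\sum q_k$, $x^Q=\prod x_k^{q_k}$, $\mu_{i,j}^Q=\prod_k\mu_{i,j,k}^{q_k}$. A monomial ideal $\mathcal I$ is generated by monomials $x^{R_1},\dots,x^{R_p}$; $\widehat{\mathcal I}$ is the ideal it generates in $\widehat{\mathcal O}_n$, and $\bar{\mathcal I}$ is the ideal generated by $\bar x^{R_1},\dots,\bar x^{R_p}$ among power series in $\bar x$; congruence mod $\bar{\mathcal I}$ is componentwise. $\mathcal I$ is left invariant by a matrix $B$ if $f(Bx)\in\mathcal I$ for all $f\in\mathcal I$. $\mathcal I$ is properly embedded if it has a set of monomial generators not involving some nonempty set of variables. $\omega_k(D)=\inf\{\max_{i,j}|\mu_{i,j}^Q-\mu_{i,j,k'}|\ne0: 2\le|Q|\le2^k,\ 1\le k'\le n\}$, and $\omega_k(D,\mathcal I)$ is the same with the additional restriction $x^Q\notin\mathcal I$ (only nonzero values of the maximum are considered). $D$ is diophantine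 (resp. on $\mathcal I$) if $-\sum_{k\ge1}2^{-k}\ln\omega_k(D)<+\infty$ (resp. $-\sum_{k\ge1}2^{-k}\ln\omega_k(D,\mathcal I)<+\infty$). $M$ is non-resonant on $\mathcal I$ if for every monomial $z^Q\notin\mathcal I$ with $|Q|\ge2$ and every pair $(i,k)$, $1\le i\le m$, $1\le k\le n$, there is $j$ with $\bar\mu_{i,j}^Q\ne\mu_{i,j,k}^{-1}$. $G$ (or $F$) is formally (resp. holomorphically) linearizable on $\mathcal I$ if there is a formal diffeomorphism (resp. a germ of holomorphic diffeomorphism) $\Phi$ of $(\mathbb C^n,0)$, tangent to the identity at $0$, such that $\Phi^{-1}\circ F_{i,j}\circ\Phi-D_{i,j}x$ has all components in $\widehat{\mathcal I}$ (resp. $\mathcal I$) for all $i,j$. *)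

theory Defs
  imports "HOL-Analysis.Analysis"
begin

section \<open>Multi-indices\<close>

definition mdeg :: "nat ^ 'n::finite \<Rightarrow> nat" where
  "mdeg Q = (\<Sum>k\<in>UNIV. Q $ k)"

text \<open>\<open>mpow x Q\<close> is \<open>x^Q\<close>. It is used for points of \<open>\<complex>\<^sup>n\<close>, for eigenvalue vectors, and, in formal
  composition, for tuples of power series.\<close>

definition mpow :: "'a::comm_monoid_mult ^ 'n::finite \<Rightarrow> nat ^ 'n \<Rightarrow> 'a" where
  "mpow x Q = (\<Prod>k\<in>UNIV. x $ k ^ (Q $ k))"

definition msplit :: "nat ^ 'n::finite \<Rightarrow> ((nat ^ 'n) \<times> (nat ^ 'n)) set" where
  "msplit Q = {p. fst p + snd p = Q}"

lemma finite_vec_nat_bounded: "finite {P :: nat ^ 'n::finite. \<forall>k. P $ k \<le> d}"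
proof -
  have "finite {f :: 'n \<Rightarrow> nat. \<forall>k. f k \<in> {..d}}"
    using finite_set_of_finite_funs[of "UNIV :: 'n set" "{..d}" 0] by simp
  hence "finite (vec_lambda ` {f :: 'n \<Rightarrow> nat. \<forall>k. f k \<in> {..d}})" by blast
  moreover have "{P :: nat ^ 'n. \<forall>k. P $ k \<le> d} \<subseteq> vec_lambda ` {f. \<forall>k. f k \<in> {..d}}"
  proof
    fix P :: "nat ^ 'n" assume "P \<in> {P. \<forall>k. P $ k \<le> d}"
    hence "P = vec_lambda (($) P)" "($) P \<in> {f. \<forall>k. f k \<in> {..d}}" by auto
    thus "P \<in> vec_lambda ` {f. \<forall>k. f k \<in> {..d}}" by blast
  qed
  ultimately show ?thesis by (rule finite_subset[rotated])
qed

lemma mdeg_ge_component: "Q $ k \<le> mdeg Q"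
  unfolding mdeg_def by (rule member_le_sum) auto

lemma finite_mdeg_le: "finite {P :: nat ^ 'n::finite. mdeg P \<le> d}"
  by (rule finite_subset[OF _ finite_vec_nat_bounded[of d]])
     (auto intro: order_trans[OF mdeg_ge_component])

lemma mdeg_add: "mdeg (P + Q) = mdeg P + mdeg Q"
  by (simp add: mdeg_def sum.distrib)

lemma finite_msplit [simp]: "finite (msplit Q)"
proof (rule finite_subset)
  show "msplit Q \<subseteq> {P. mdeg P \<le> mdeg Q} \<times> {P. mdeg P \<le> mdeg Q}"
    by (auto simp: msplit_def mdeg_add)
qed (simp add: finite_mdeg_le)


section \<open>Formal power series in \<open>n\<close> complex variables\<close>

typedef (overloaded) 'n mfps = "UNIV :: (nat ^ 'n::finite \<Rightarrow> complex) set"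
  morphisms mcoeff Abs_mfps by simp

lemma mcoeff_Abs [simp]: "mcoeff (Abs_mfps f) Q = f Q"
  by (simp add: Abs_mfps_inverse)

lemma mfps_eqI: "(\<And>Q. mcoeff f Q = mcoeff g Q) \<Longrightarrow> f = g"
  by (metis ext mcoeff_inject)

instantiation mfps :: (finite) comm_ring_1
begin

definition zero_mfps :: "'a mfps" where "0 = Abs_mfps (\<lambda>Q. 0)"
definition one_mfps :: "'a mfps" where "1 = Abs_mfps (\<lambda>Q. if Q = 0 then 1 else 0)"
definition plus_mfps :: "'a mfps \<Rightarrow> 'a mfps \<Rightarrow> 'a mfps" where
  "f + g = Abs_mfps (\<lambda>Q. mcoeff f Q + mcoeff g Q)"
definition minus_mfps :: "'a mfps \<Rightarrow> 'a mfps \<Rightarrow> 'a mfps" where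
  "f - g = Abs_mfps (\<lambda>Q. mcoeff f Q - mcoeff g Q)"
definition uminus_mfps :: "'a mfps \<Rightarrow> 'a mfps" where
  "- f = Abs_mfps (\<lambda>Q. - mcoeff f Q)"
definition times_mfps :: "'a mfps \<Rightarrow> 'a mfps \<Rightarrow> 'a mfps" where
  "f * g = Abs_mfps (\<lambda>Q. \<Sum>p\<in>msplit Q. mcoeff f (fst p) * mcoeff g (snd p))"

instance
proof
  fix a b c :: "'a mfps"
  show "a + b + c = a + (b + c)" "a + b = b + a" "0 + a = a" "- a + a = 0" "a - b = a + - b"
    by (auto intro!: mfps_eqI simp: plus_mfps_def zero_mfps_def uminus_mfps_def minus_mfps_def)
  show "(0 :: 'a mfps) \<noteq> 1"
  proof
    assume "(0 :: 'a mfps) = 1"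
    hence "mcoeff (0 :: 'a mfps) 0 = mcoeff 1 0" by simp
    thus False by (simp add: zero_mfps_def one_mfps_def)
  qed
  show "(a + b) * c = a * c + b * c"
    by (auto intro!: mfps_eqI simp: plus_mfps_def times_mfps_def algebra_simps sum.distrib)
  show "a * b = b * a"
  proof (rule mfps_eqI)
    fix Q
    show "mcoeff (a * b) Q = mcoeff (b * a) Q"
      unfolding times_mfps_def mcoeff_Abs
      by (rule sum.reindex_bij_witness[of _ prod.swap prod.swap])
         (auto simp: msplit_def add.commute)
  qed
  show "1 * a = a"
  proof (rule mfps_eqI)
    fix Q
    have "mcoeff (1 * a) Q
        = (\<Sum>p\<in>msplit Q. if p = (0, Q) then mcoeff a Q else 0)"
      unfolding times_mfps_def mcoeff_Abs
      by (rule sum.cong) (auto simp: one_mfps_def msplit_def split: if_splits)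
    also have "\<dots> = mcoeff a Q"
      by (subst sum.delta, simp, simp add: msplit_def)
    finally show "mcoeff (1 * a) Q = mcoeff a Q" .
  qed
  show "a * b * c = a * (b * c)"
  proof (rule mfps_eqI)
    fix Q
    have "mcoeff (a * b * c) Q
       = (\<Sum>x\<in>Sigma (msplit Q) (\<lambda>p. msplit (fst p)).
            mcoeff a (fst (snd x)) * mcoeff b (snd (snd x)) * mcoeff c (snd (fst x)))"
      by (simp add: times_mfps_def sum_distrib_right sum.Sigma case_prod_unfold)
    also have "\<dots> = (\<Sum>x\<in>Sigma (msplit Q) (\<lambda>p. msplit (snd p)).
            mcoeff a (fst (fst x)) * (mcoeff b (fst (snd x)) * mcoeff c (snd (snd x))))"
      by (rule sum.reindex_bij_witness
            [of _ "\<lambda>x. ((fst (fst x) + fst (snd x), snd (snd x)), (fst (fst x), fst (snd x)))"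
                  "\<lambda>x. ((fst (snd x), snd (snd x) + snd (fst x)), (snd (snd x), snd (fst x)))"])
         (auto simp: msplit_def add.assoc mult.assoc)
    also have "\<dots> = mcoeff (a * (b * c)) Q"
      by (simp add: times_mfps_def sum_distrib_left sum.Sigma case_prod_unfold)
    finally show "mcoeff (a * b * c) Q = mcoeff (a * (b * c)) Q" .
  qed
qed

end

definition mfps_monom :: "nat ^ 'n::finite \<Rightarrow> complex \<Rightarrow> 'n mfps" where
  "mfps_monom Q c = Abs_mfps (\<lambda>P. if P = Q then c else 0)"

text \<open>Substitution of \<open>G\<close> into \<open>f\<close>. It is meant for \<open>G\<close> without constant terms; then
  \<open>G^P\<close> has order at least \<open>|P|\<close>, so the truncated sum below is the full one.\<close>

definition mfps_compose :: "'n::finite mfps \<Rightarrow> 'n mfps ^ 'n \<Rightarrow> 'n mfps" where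
  "mfps_compose f G =
     Abs_mfps (\<lambda>Q. \<Sum>P | mdeg P \<le> mdeg Q. mcoeff f P * mcoeff (mpow G P) Q)"

definition fmap_compose :: "'n::finite mfps ^ 'n \<Rightarrow> 'n mfps ^ 'n \<Rightarrow> 'n mfps ^ 'n" where
  "fmap_compose F G = (\<chi> k. mfps_compose (F $ k) G)"

definition fmap_linear :: "complex ^ 'n ^ 'n::finite \<Rightarrow> 'n mfps ^ 'n" where
  "fmap_linear A = (\<chi> k. \<Sum>l\<in>UNIV. mfps_monom (axis l 1) (A $ k $ l))"


section \<open>Germs at the origin\<close>

text \<open>Germs are represented by functions, compared by \<open>eventually\<close> in \<open>nhds 0\<close>.
  A germ of holomorphic function is one that is the sum of a power series near \<open>0\<close>.\<close>

definition has_mfps_expansion :: "(complex ^ 'n::finite \<Rightarrow> complex) \<Rightarrow> 'n mfps \<Rightarrow> bool"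
    (infix "has'_mfps'_expansion" 50) where
  "f has_mfps_expansion a \<longleftrightarrow>
     (\<forall>\<^sub>F z in nhds 0. ((\<lambda>Q. mcoeff a Q * mpow z Q) has_sum f z) UNIV)"

definition map_has_expansion ::
    "(complex ^ 'n::finite \<Rightarrow> complex ^ 'n) \<Rightarrow> 'n mfps ^ 'n \<Rightarrow> bool" where
  "map_has_expansion f a \<longleftrightarrow> (\<forall>k. (\<lambda>z. f z $ k) has_mfps_expansion a $ k)"

definition holo_map :: "(complex ^ 'n::finite \<Rightarrow> complex ^ 'n) \<Rightarrow> bool" where
  "holo_map f \<longleftrightarrow> (\<exists>a. map_has_expansion f a)"

definition holo_diffeo ::
    "(complex ^ 'n::finite \<Rightarrow> complex ^ 'n) \<Rightarrow> (complex ^ 'n \<Rightarrow> complex ^ 'n) \<Rightarrow> bool" where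
  "holo_diffeo \<Phi> \<Psi> \<longleftrightarrow>
     holo_map \<Phi> \<and> holo_map \<Psi> \<and> \<Phi> 0 = 0 \<and> \<Psi> 0 = 0 \<and>
     (\<forall>\<^sub>F z in nhds 0. \<Psi> (\<Phi> z) = z) \<and> (\<forall>\<^sub>F z in nhds 0. \<Phi> (\<Psi> z) = z)"

inductive_set germ_group ::
    "(complex ^ 'n::finite \<Rightarrow> complex ^ 'n) set \<Rightarrow> (complex ^ 'n \<Rightarrow> complex ^ 'n) set"
  for S where
    one: "id \<in> germ_group S"
  | incl: "f \<in> S \<Longrightarrow> f \<in> germ_group S"
  | comp: "f \<in> germ_group S \<Longrightarrow> g \<in> germ_group S \<Longrightarrow> f \<circ> g \<in> germ_group S"
  | inv: "f \<in> germ_group S \<Longrightarrow> holo_diffeo f g \<Longrightarrow> g \<in> germ_group S"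

definition abelian_germs :: "(complex ^ 'n::finite \<Rightarrow> complex ^ 'n) set \<Rightarrow> bool" where
  "abelian_germs G \<longleftrightarrow> (\<forall>f\<in>G. \<forall>g\<in>G. \<forall>\<^sub>F z in nhds 0. f (g z) = g (f z))"


section \<open>Totally real submanifolds and involutions\<close>

definition vcnj :: "complex ^ 'n::finite \<Rightarrow> complex ^ 'n" where
  "vcnj z = (\<chi> k. cnj (z $ k))"

definition mcnj :: "complex ^ 'n ^ 'n::finite \<Rightarrow> complex ^ 'n ^ 'n" where
  "mcnj A = (\<chi> k l. cnj (A $ k $ l))"

definition diag_matrix :: "complex ^ 'n::finite \<Rightarrow> complex ^ 'n ^ 'n" where
  "diag_matrix v = (\<chi> k l. if k = l then v $ k else 0)"

definition real_analytic_at :: "(real ^ 'n::finite \<Rightarrow> complex ^ 'n) \<Rightarrow> real ^ 'n \<Rightarrow> bool" where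
  "real_analytic_at f p \<longleftrightarrow>
     (\<forall>k. \<exists>a :: 'n mfps. \<forall>\<^sub>F h in nhds 0.
        ((\<lambda>Q. mcoeff a Q * of_real (mpow h Q)) has_sum f (p + h) $ k) UNIV)"

text \<open>Near \<open>0\<close>, \<open>M\<close> is the image of a real analytic embedding of an open subset of \<open>\<real>\<^sup>n\<close>, whose
  tangent spaces \<open>T\<close> satisfy \<open>T \<inter> \<i>T = 0\<close>.\<close>

definition totally_real_germ :: "(complex ^ 'n::finite) set \<Rightarrow> bool" where
  "totally_real_germ M \<longleftrightarrow> 0 \<in> M \<and>
     (\<exists>U V \<phi> \<psi>. open (U :: (real ^ 'n) set) \<and> open V \<and> 0 \<in> V \<and>
        homeomorphism U (M \<inter> V) \<phi> \<psi> \<and>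
        (\<forall>x\<in>U. real_analytic_at \<phi> x \<and>
           (\<exists>T. (\<phi> has_derivative T) (at x) \<and> inj T \<and>
                range T \<inter> (\<lambda>v. \<i> *s v) ` range T = {0})))"

text \<open>\<open>\<rho>\<close> is the germ \<open>z \<mapsto> B z\<^sup>- + R(z\<^sup>-)\<close>, an involution with linear part \<open>z \<mapsto> B z\<^sup>-\<close>,
  where \<open>z\<^sup>-\<close> is the complex conjugate of \<open>z\<close>.\<close>

definition antiholo_involution ::
    "(complex ^ 'n::finite \<Rightarrow> complex ^ 'n) \<Rightarrow> complex ^ 'n ^ 'n \<Rightarrow>
     (complex ^ 'n \<Rightarrow> complex ^ 'n) \<Rightarrow> bool" where
  "antiholo_involution \<rho> B R \<longleftrightarrow>
     holo_map R \<and> R 0 = 0 \<and> (R has_derivative (\<lambda>h. 0)) (at 0) \<and>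
     invertible B \<and> B ** mcnj B = mat 1 \<and>
     (\<forall>\<^sub>F z in nhds 0. \<rho> z = B *v vcnj z + R (vcnj z)) \<and>
     (\<forall>\<^sub>F z in nhds 0. \<rho> (\<rho> z) = z)"


section \<open>Monomial ideals\<close>

text \<open>\<open>\<O>\<^sub>n\<close>, identified with the ring of convergent power series.\<close>

definition convergent_mfps :: "'n::finite mfps set" where
  "convergent_mfps = {a. \<exists>f. f has_mfps_expansion a}"

text \<open>The ideal generated by the \<open>x^P\<close>, \<open>P \<in> S\<close>, in the ring \<open>A\<close>; here \<open>A\<close> is
  \<open>convergent_mfps\<close> or, for formal power series, \<open>UNIV\<close>.\<close>

definition monomial_ideal :: "'n::finite mfps set \<Rightarrow> (nat ^ 'n) set \<Rightarrow> 'n mfps set" where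
  "monomial_ideal A S = {\<Sum>P\<in>S. g P * mfps_monom P 1 | g. \<forall>P\<in>S. g P \<in> A}"

definition left_invariant :: "'n::finite mfps set \<Rightarrow> complex ^ 'n ^ 'n \<Rightarrow> bool" where
  "left_invariant I B \<longleftrightarrow> (\<forall>f\<in>I. mfps_compose f (fmap_linear B) \<in> I)"

definition properly_embedded :: "'n::finite mfps set \<Rightarrow> bool" where
  "properly_embedded I \<longleftrightarrow>
     (\<exists>S V. finite S \<and> I = monomial_ideal convergent_mfps S \<and>
            V \<noteq> {} \<and> (\<forall>P\<in>S. \<forall>k\<in>V. P $ k = 0))"

definition cong_mod ::
    "'n::finite mfps set \<Rightarrow> (complex ^ 'n \<Rightarrow> complex ^ 'n) \<Rightarrow> (complex ^ 'n \<Rightarrow> complex ^ 'n) \<Rightarrow> bool"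
  where
  "cong_mod I f g \<longleftrightarrow> (\<forall>k. \<exists>a\<in>I. (\<lambda>z. f z $ k - g z $ k) has_mfps_expansion a)"

text \<open>Congruence modulo the conjugate ideal: the difference is a power series of \<open>I\<close> evaluated at
  the conjugate variables.\<close>

definition cong_mod_cnj ::
    "'n::finite mfps set \<Rightarrow> (complex ^ 'n \<Rightarrow> complex ^ 'n) \<Rightarrow> (complex ^ 'n \<Rightarrow> complex ^ 'n) \<Rightarrow> bool"
  where
  "cong_mod_cnj I f g \<longleftrightarrow>
     (\<forall>k. \<exists>a\<in>I. \<forall>\<^sub>F z in nhds 0.
        ((\<lambda>Q. mcoeff a Q * mpow (vcnj z) Q) has_sum (f z $ k - g z $ k)) UNIV)"


section \<open>Small divisors\<close>

text \<open>\<open>A\<close> is the set of exponents \<open>Q\<close> taken into account: all of them for \<open>\<omega>\<^sub>k(D)\<close>, those with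
  \<open>x^Q \<notin> I\<close> for \<open>\<omega>\<^sub>k(D,I)\<close>.\<close>

definition small_divisors ::
    "('m::finite \<Rightarrow> 'm \<Rightarrow> complex ^ 'n::finite) \<Rightarrow> (nat ^ 'n) set \<Rightarrow> nat \<Rightarrow> real set" where
  "small_divisors \<mu> A k =
     {\<delta>. \<delta> \<noteq> 0 \<and>
        (\<exists>Q\<in>A. \<exists>l. 2 \<le> mdeg Q \<and> mdeg Q \<le> 2 ^ k \<and>
           \<delta> = Max (range (\<lambda>(i, j). cmod (mpow (\<mu> i j) Q - \<mu> i j $ l))))}"

definition omega ::
    "('m::finite \<Rightarrow> 'm \<Rightarrow> complex ^ 'n::finite) \<Rightarrow> (nat ^ 'n) set \<Rightarrow> nat \<Rightarrow> real" where
  "omega \<mu> A k = Inf (small_divisors \<mu> A k)"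

text \<open>An infimum over the empty set is \<open>+\<infinity>\<close> and puts no constraint on the series, so its
  term is dropped. As \<open>omega\<close> is nonincreasing where it is finite, the terms are eventually
  nonnegative or dominated by a multiple of \<open>2^-k\<close>; the sum is \<open>< +\<infinity>\<close> iff it converges.\<close>

definition diophantine ::
    "('m::finite \<Rightarrow> 'm \<Rightarrow> complex ^ 'n::finite) \<Rightarrow> (nat ^ 'n) set \<Rightarrow> bool" where
  "diophantine \<mu> A \<longleftrightarrow>
     summable (\<lambda>k. if small_divisors \<mu> A (Suc k) = {} then 0
                   else - (ln (omega \<mu> A (Suc k)) / 2 ^ Suc k))"

definition exponents_outside :: "'n::finite mfps set \<Rightarrow> (nat ^ 'n) set" where
  "exponents_outside I = {Q. mfps_monom Q 1 \<notin> I}"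

definition nonresonant_on ::
    "('m::finite \<Rightarrow> 'm \<Rightarrow> complex ^ 'n::finite) \<Rightarrow> 'n mfps set \<Rightarrow> bool" where
  "nonresonant_on \<mu> I \<longleftrightarrow>
     (\<forall>Q\<in>exponents_outside I. 2 \<le> mdeg Q \<longrightarrow>
        (\<forall>i k. \<exists>j. cnj (mpow (\<mu> i j) Q) \<noteq> inverse (\<mu> i j $ k)))"


section \<open>Linearization\<close>

definition tangent_to_id :: "'n::finite mfps ^ 'n \<Rightarrow> bool" where
  "tangent_to_id \<Phi> \<longleftrightarrow>
     (\<forall>k. mcoeff (\<Phi> $ k) 0 = 0 \<and> (\<forall>l. mcoeff (\<Phi> $ k) (axis l 1) = (if k = l then 1 else 0)))"

text \<open>\<open>\<Psi>\<close> is the inverse of \<open>\<Phi>\<close>, and \<open>J\<close> is an ideal of formal power series.\<close>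

definition formal_linearization ::
    "'n::finite mfps set \<Rightarrow> ('m \<Rightarrow> 'm \<Rightarrow> complex ^ 'n \<Rightarrow> complex ^ 'n) \<Rightarrow>
     ('m \<Rightarrow> 'm \<Rightarrow> complex ^ 'n ^ 'n) \<Rightarrow> 'n mfps ^ 'n \<Rightarrow> 'n mfps ^ 'n \<Rightarrow> bool" where
  "formal_linearization J F D \<Phi> \<Psi> \<longleftrightarrow>
     tangent_to_id \<Phi> \<and> (\<forall>k. mcoeff (\<Psi> $ k) 0 = 0) \<and>
     fmap_compose \<Psi> \<Phi> = fmap_linear (mat 1) \<and> fmap_compose \<Phi> \<Psi> = fmap_linear (mat 1) \<and>
     (\<forall>i j. \<exists>f. map_has_expansion (F i j) f \<and>
        (\<forall>k. fmap_compose \<Psi> (fmap_compose f \<Phi>) $ k - fmap_linear (D i j) $ k \<in> J))"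

definition formally_linearizable_on ::
    "'n::finite mfps set \<Rightarrow> ('m \<Rightarrow> 'm \<Rightarrow> complex ^ 'n \<Rightarrow> complex ^ 'n) \<Rightarrow>
     ('m \<Rightarrow> 'm \<Rightarrow> complex ^ 'n ^ 'n) \<Rightarrow> bool" where
  "formally_linearizable_on J F D \<longleftrightarrow> (\<exists>\<Phi> \<Psi>. formal_linearization J F D \<Phi> \<Psi>)"

definition holo_linearization ::
    "'n::finite mfps set \<Rightarrow> ('m \<Rightarrow> 'm \<Rightarrow> complex ^ 'n \<Rightarrow> complex ^ 'n) \<Rightarrow>
     ('m \<Rightarrow> 'm \<Rightarrow> complex ^ 'n ^ 'n) \<Rightarrow>
     (complex ^ 'n \<Rightarrow> complex ^ 'n) \<Rightarrow> (complex ^ 'n \<Rightarrow> complex ^ 'n) \<Rightarrow> bool" where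
  "holo_linearization I F D \<Phi> \<Psi> \<longleftrightarrow>
     holo_diffeo \<Phi> \<Psi> \<and> (\<Phi> has_derivative id) (at 0) \<and>
     (\<forall>i j. cong_mod I (\<Psi> \<circ> F i j \<circ> \<Phi>) (\<lambda>z. D i j *v z))"

end

theory Submission
  imports Defs
begin

text \<open>Let \<open>N\<close> be the set of exponents outside \<open>\<I>\<close>. Since \<open>D\<^sub>i\<^sub>j B\<^sub>i\<close> is \<open>B\<^sub>i\<close> times the conjugate of
  \<open>D\<^sub>j\<^sub>i\<close>, nonresonance of \<open>M\<close> implies that no divisor \<open>max\<^sub>i\<^sub>j |\<mu>\<^sub>i\<^sub>j\<^sup>Q - \<mu>\<^sub>i\<^sub>j\<^sub>,\<^sub>k|\<close> with \<open>Q \<in> N\<close>,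
  \<open>|Q| \<ge> 2\<close> vanishes. The formal linearization may be truncated to \<open>N\<close>, and each of its coefficients is then
  a sum over trees divided by the divisor that is largest over the pairs \<open>(i, j)\<close>; so one formal solution
  for the whole family replaces a Newton iteration. Convergence is the Siegel--Brjuno argument: the
  divisors along a tree are counted separately for each component \<open>k\<close>. If two nodes \<open>P\<close> and \<open>P + R\<close> of the
  same component have small divisors, then \<open>\<mu>\<^sup>R - 1\<close> is small, and so is the divisor of \<open>R + e\<^sub>l\<close> for a
  variable \<open>l\<close> that occurs in \<open>P\<close>; this exponent divides \<open>P + R\<close>, hence lies in \<open>N\<close>.

  In the new coordinates, \<open>\<rho>\<^sub>i\<close> intertwines \<open>F\<^sub>i\<^sub>j\<close> and \<open>F\<^sub>j\<^sub>i\<close>, and nonresonance removes all its terms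
  outside \<open>\<I>\<close> but the linear ones, degree by degree.\<close>


section \<open>Formal power series\<close>

text \<open>Dividing by the divisors degree by degree defeats a direct geometric majorant. The
  remedy is to put the damage into the norm: \<open>wnorm\<close> weighs the coefficient at Q by
  t^|Q| / \<open>max_weight Q\<close>, where \<open>max_weight Q\<close> is the largest product of
  inverse divisors along a tree of total exponent Q. These weights are supermultiplicative, and
  remain so after one more division at the exponent of a product, since two trees under a new node
  form a tree again. The quadratic majorant estimate thus runs as if there were no divisors, and the
  arithmetic enters only through the exponential bound on \<open>max_weight\<close>. Binary trees
  suffice, because a power of degree at least two is a nonconstant power times one component.
  Counting by components makes \<mu>_k cancel when two small divisors are compared. What remains is
  that \<mu>^R is close to 1, and the arithmetic condition has to be applied to some R + e_l. The
  obvious choice l = k may lead into the ideal, where the divisor may vanish; a variable of P does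
  not.\<close>

lemma mdeg_0 [simp]: "mdeg 0 = 0"
  by (simp add: mdeg_def)

lemma mdeg_axis [simp]: "mdeg (axis k c) = c"
  by (simp add: mdeg_def axis_def sum.delta)

lemma mdeg_eq_0_iff [simp]: "mdeg Q = 0 \<longleftrightarrow> Q = 0"
  by (auto simp: mdeg_def vec_eq_iff)

lemma mdeg_pos: "Q \<noteq> 0 \<Longrightarrow> 0 < mdeg Q"
  using mdeg_eq_0_iff[of Q] by linarith

lemma minus_axis_add: "Q $ k \<noteq> 0 \<Longrightarrow> Q = (Q - axis k 1) + axis k (1::nat)"
  by (auto simp: vec_eq_iff axis_def)

lemma nonzero_index_cases:
  fixes Q :: "nat ^ 'n::finite"
  assumes "Q \<noteq> 0"
  obtains k P where "Q = P + axis k 1"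
proof -
  obtain k where "Q $ k \<noteq> 0" using assms by (auto simp: vec_eq_iff)
  thus thesis using that minus_axis_add by blast
qed

text \<open>Raising one exponent by one multiplies \<open>mpow\<close> by one component, so
  inductions on powers of tuples need the ring multiplication only.\<close>

lemma multi_index_induct [case_names zero add]:
  fixes Q :: "nat ^ 'n::finite"
  assumes "\<P> 0" and "\<And>Q k. \<P> Q \<Longrightarrow> \<P> (Q + axis k 1)"
  shows "\<P> Q"
proof (induction "mdeg Q" arbitrary: Q)
  case 0
  thus ?case using assms(1) by simp
next
  case (Suc d)
  hence "Q \<noteq> 0" by auto
  then obtain k P where Q: "Q = P + axis k 1" by (rule nonzero_index_cases)
  hence "mdeg P = d" using Suc(2) by (simp add: mdeg_add)
  thus ?case using Suc(1) assms(2) Q by blast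
qed

lemma mdeg_1_cases:
  fixes Q :: "nat ^ 'n::finite"
  assumes "mdeg Q = 1" obtains k where "Q = axis k 1"
proof -
  have "Q \<noteq> 0" using assms by auto
  then obtain k P where Q: "Q = P + axis k 1" by (rule nonzero_index_cases)
  hence "P = 0" using assms by (simp add: mdeg_add)
  thus thesis using Q that by simp
qed

lemma axis_eq_axis_nat [simp]:
  "axis k (1::nat) = axis l 1 \<longleftrightarrow> k = l" "axis k (Suc 0) = axis l (Suc 0) \<longleftrightarrow> k = l"
  by (simp_all add: axis_eq_axis)

lemma axis_nonzero_nat [simp]: "axis k (1::nat) \<noteq> 0" "0 \<noteq> axis k (1::nat)"
  using mdeg_axis[of k 1] by (auto simp del: mdeg_axis)

lemma add_eq_0_index: "P + Q = (0 :: nat ^ 'n::finite) \<longleftrightarrow> P = 0 \<and> Q = 0"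
  by (auto simp: vec_eq_iff)

lemma mpow_0 [simp]: "mpow x 0 = 1"
  by (simp add: mpow_def)

lemma mpow_add: "mpow x (P + Q) = mpow x P * mpow x Q"
  by (simp add: mpow_def power_add prod.distrib)

lemma mpow_axis [simp]: "mpow x (axis k 1) = x $ k"
proof -
  have "mpow x (axis k 1) = (\<Prod>l\<in>UNIV. if l = k then x $ l else 1)"
    unfolding mpow_def by (rule prod.cong) (auto simp: axis_def)
  thus ?thesis by (simp add: prod.delta)
qed

lemma mpow_axis_Suc [simp]: "mpow x (axis k (Suc 0)) = x $ k"
  using mpow_axis[of x k] by simp

lemma mpow_const: "mpow (\<chi> k. c) Q = c ^ mdeg Q"
  by (simp add: mpow_def mdeg_def power_sum)

lemma norm_mpow: "norm (mpow x Q) = mpow (\<chi> k. norm (x $ k)) Q"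
  for x :: "'a::{real_normed_field} ^ 'n::finite"
  by (simp add: mpow_def prod_norm[symmetric] norm_power)

lemma mcoeff_0 [simp]: "mcoeff 0 Q = 0"
  and mcoeff_1: "mcoeff 1 Q = (if Q = 0 then 1 else 0)"
  and mcoeff_add [simp]: "mcoeff (f + g) Q = mcoeff f Q + mcoeff g Q"
  and mcoeff_diff [simp]: "mcoeff (f - g) Q = mcoeff f Q - mcoeff g Q"
  and mcoeff_mult: "mcoeff (f * g) Q = (\<Sum>p\<in>msplit Q. mcoeff f (fst p) * mcoeff g (snd p))"
  and mcoeff_monom: "mcoeff (mfps_monom P c) Q = (if Q = P then c else 0)"
  by (simp_all add: zero_mfps_def one_mfps_def plus_mfps_def minus_mfps_def times_mfps_def
        mfps_monom_def)

lemma mcoeff_sum [simp]: "mcoeff (sum f A) Q = (\<Sum>x\<in>A. mcoeff (f x) Q)"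
  by (induction A rule: infinite_finite_induct) auto

lemma mcoeff_compose:
  "mcoeff (mfps_compose f G) Q = (\<Sum>P | mdeg P \<le> mdeg Q. mcoeff f P * mcoeff (mpow G P) Q)"
  by (simp add: mfps_compose_def)

lemma monom_mult: "mfps_monom P a * mfps_monom Q b = mfps_monom (P + Q) (a * b)"
proof (rule mfps_eqI)
  fix R
  have "mcoeff (mfps_monom P a * mfps_monom Q b) R
      = (\<Sum>p\<in>msplit R. if p = (P, Q) then a * b else 0)"
    unfolding mcoeff_mult by (rule sum.cong) (auto simp: mcoeff_monom prod_eq_iff)
  also have "\<dots> = mcoeff (mfps_monom (P + Q) (a * b)) R"
  proof -
    have "(P, Q) \<in> msplit R \<longleftrightarrow> R = P + Q" by (auto simp: msplit_def)
    thus ?thesis by (simp add: sum.delta mcoeff_monom)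
  qed
  finally show "mcoeff (mfps_monom P a * mfps_monom Q b) R
      = mcoeff (mfps_monom (P + Q) (a * b)) R" .
qed

lemma mcoeff_mult_monom:
  "mcoeff (f * mfps_monom P 1) Q = (\<Sum>R | R + P = Q. mcoeff f R)"
proof -
  have fin: "finite {R. R + P = Q}"
    by (rule finite_subset[OF _ finite_mdeg_le[of "mdeg Q"]]) (auto simp: mdeg_add)
  have "mcoeff (f * mfps_monom P 1) Q
      = (\<Sum>p\<in>msplit Q. if snd p = P then mcoeff f (fst p) else 0)"
    unfolding mcoeff_mult by (rule sum.cong) (auto simp: mcoeff_monom)
  also have "\<dots> = (\<Sum>p | p \<in> msplit Q \<and> snd p = P. mcoeff f (fst p))"
    by (simp add: sum.If_cases Int_def)
  also have "\<dots> = (\<Sum>R | R + P = Q. mcoeff f R)"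
    by (rule sum.reindex_bij_witness[of _ "\<lambda>R. (R, P)" fst]) (auto simp: msplit_def)
  finally show ?thesis .
qed


section \<open>Composition of formal power series\<close>

definition ord_pos :: "'n::finite mfps ^ 'n \<Rightarrow> bool" where
  "ord_pos G \<longleftrightarrow> (\<forall>k. mcoeff (G $ k) 0 = 0)"

lemma mcoeff_mpow_low:
  assumes "ord_pos G" "mdeg Q < mdeg P"
  shows "mcoeff (mpow G P) Q = 0"
  using assms(2)
proof (induction P arbitrary: Q rule: multi_index_induct)
  case zero
  thus ?case by simp
next
  case (add P k)
  show ?case unfolding mpow_add mcoeff_mult
  proof (rule sum.neutral, rule ballI)
    fix p assume p: "p \<in> msplit Q"
    show "mcoeff (mpow G P) (fst p) * mcoeff (mpow G (axis k 1)) (snd p) = 0"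
    proof (cases "snd p = 0")
      case True
      thus ?thesis using assms(1) by (simp add: ord_pos_def)
    next
      case False
      hence "mdeg (fst p) < mdeg P"
        using p add(2) mdeg_pos[OF False] by (auto simp: msplit_def mdeg_add)
      thus ?thesis using add(1) by simp
    qed
  qed
qed

lemma mcoeff_mpow_0:
  assumes "ord_pos G" "P \<noteq> 0" shows "mcoeff (mpow G P) 0 = 0"
  using mcoeff_mpow_low[OF assms(1), of 0 P] mdeg_pos[OF assms(2)] by simp

text \<open>Raising the truncation degree adds zeros only. Coefficients of different degrees can
  thus be computed over one common index set, which makes sums interchangeable.\<close>

lemma mcoeff_compose_large:
  assumes "ord_pos G" "mdeg Q \<le> d"
  shows "mcoeff (mfps_compose f G) Q = (\<Sum>P | mdeg P \<le> d. mcoeff f P * mcoeff (mpow G P) Q)"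
  unfolding mcoeff_compose
  by (rule sum.mono_neutral_left) (use assms in \<open>auto simp: finite_mdeg_le mcoeff_mpow_low not_le\<close>)

lemma compose_add: "mfps_compose (f + g) G = mfps_compose f G + mfps_compose g G"
  by (rule mfps_eqI) (simp add: mcoeff_compose sum.distrib algebra_simps)

lemma compose_0 [simp]: "mfps_compose 0 G = 0"
  by (rule mfps_eqI) (simp add: mcoeff_compose)

lemma compose_sum: "mfps_compose (sum f A) G = (\<Sum>x\<in>A. mfps_compose (f x) G)"
  by (induction A rule: infinite_finite_induct) (auto simp: compose_add)

lemma compose_monom:
  assumes "ord_pos G"
  shows "mcoeff (mfps_compose (mfps_monom P c) G) Q = c * mcoeff (mpow G P) Q"
proof -
  have "mcoeff (mfps_compose (mfps_monom P c) G) Q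
      = (\<Sum>R | mdeg R \<le> mdeg Q. if R = P then c * mcoeff (mpow G P) Q else 0)"
    unfolding mcoeff_compose by (rule sum.cong) (auto simp: mcoeff_monom)
  also have "\<dots> = c * mcoeff (mpow G P) Q"
    using mcoeff_mpow_low[OF assms, of Q P] by (auto simp: finite_mdeg_le sum.delta)
  finally show ?thesis .
qed

lemma compose_1:
  assumes "ord_pos G" shows "mfps_compose 1 G = 1"
proof -
  have "(1 :: 'a mfps) = mfps_monom 0 1"
    by (rule mfps_eqI) (simp add: mcoeff_1 mcoeff_monom)
  hence "mfps_compose 1 G = mfps_compose (mfps_monom 0 1) G" by simp
  also have "\<dots> = 1" by (rule mfps_eqI) (simp add: compose_monom[OF assms])
  finally show ?thesis .
qed

text \<open>The pairs (P, R) with |P + R| \<le> |Q| may be completed to a product of two balls, as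
  G^(P + R) has order at least |P + R|; over the product, the sum factors.\<close>

lemma compose_mult:
  assumes "ord_pos G"
  shows "mfps_compose (f * g) G = mfps_compose f G * mfps_compose g G"
proof (rule mfps_eqI)
  fix Q :: "nat ^ 'a"
  let ?B = "{P :: nat ^ 'a. mdeg P \<le> mdeg Q}"
  have "mcoeff (mfps_compose (f * g) G) Q
      = (\<Sum>P\<in>?B. \<Sum>p\<in>msplit P.
          mcoeff f (fst p) * mcoeff g (snd p) * mcoeff (mpow G (fst p + snd p)) Q)"
    unfolding mcoeff_compose mcoeff_mult sum_distrib_right
    by (intro sum.cong refl) (auto simp: msplit_def)
  also have "\<dots> = (\<Sum>x\<in>Sigma ?B msplit. mcoeff f (fst (snd x)) * mcoeff g (snd (snd x))
          * mcoeff (mpow G (fst (snd x) + snd (snd x))) Q)"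
    by (subst sum.Sigma) (auto simp: finite_mdeg_le case_prod_unfold)
  also have "\<dots> = (\<Sum>p | mdeg (fst p + snd p) \<le> mdeg Q. mcoeff f (fst p) * mcoeff g (snd p)
          * mcoeff (mpow G (fst p + snd p)) Q)"
    by (rule sum.reindex_bij_witness[of _ "\<lambda>p. (fst p + snd p, p)" snd]) (auto simp: msplit_def)
  also have "\<dots> = (\<Sum>p\<in>?B \<times> ?B. mcoeff f (fst p) * mcoeff g (snd p)
          * mcoeff (mpow G (fst p + snd p)) Q)"
    by (rule sum.mono_neutral_left)
      (auto simp: finite_mdeg_le mcoeff_mpow_low[OF assms] not_le, auto simp: mdeg_add)
  also have "\<dots> = (\<Sum>P\<in>?B. \<Sum>R\<in>?B. \<Sum>q\<in>msplit Q. (mcoeff f P * mcoeff (mpow G P) (fst q)) *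
      (mcoeff g R * mcoeff (mpow G R) (snd q)))"
    by (simp add: sum.cartesian_product' case_prod_unfold mpow_add mcoeff_mult sum_distrib_left
        mult_ac)
  also have "\<dots> = (\<Sum>q\<in>msplit Q. \<Sum>P\<in>?B. \<Sum>R\<in>?B. (mcoeff f P * mcoeff (mpow G P) (fst q)) *
      (mcoeff g R * mcoeff (mpow G R) (snd q)))"
    unfolding sum.swap[of _ "msplit Q" ?B] ..
  also have "\<dots> = (\<Sum>q\<in>msplit Q. mcoeff (mfps_compose f G) (fst q) * mcoeff (mfps_compose g G) (snd q))"
  proof (rule sum.cong, rule refl)
    fix q assume "q \<in> msplit Q"
    hence "mdeg (fst q) \<le> mdeg Q" "mdeg (snd q) \<le> mdeg Q"
      by (auto simp: msplit_def mdeg_add)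
    thus "(\<Sum>P\<in>?B. \<Sum>R\<in>?B. (mcoeff f P * mcoeff (mpow G P) (fst q)) *
      (mcoeff g R * mcoeff (mpow G R) (snd q)))
      = mcoeff (mfps_compose f G) (fst q) * mcoeff (mfps_compose g G) (snd q)"
      by (simp add: mcoeff_compose_large[OF assms] sum_product)
  qed
  finally show "mcoeff (mfps_compose (f * g) G) Q = mcoeff (mfps_compose f G * mfps_compose g G) Q"
    by (simp add: mcoeff_mult)
qed

lemma fmap_compose_nth [simp]: "fmap_compose F G $ k = mfps_compose (F $ k) G"
  by (simp add: fmap_compose_def)

lemma mpow_compose:
  assumes "ord_pos H"
  shows "mfps_compose (mpow G P) H = mpow (fmap_compose G H) P"
  by (induction P rule: multi_index_induct)
    (simp_all add: compose_1[OF assms] compose_mult[OF assms] mpow_add)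

lemma ord_pos_compose:
  assumes "ord_pos G" shows "ord_pos (fmap_compose G H)"
  using assms by (auto simp: ord_pos_def mcoeff_compose)

lemma compose_assoc:
  assumes "ord_pos G" "ord_pos H"
  shows "mfps_compose (mfps_compose f G) H = mfps_compose f (fmap_compose G H)"
proof (rule mfps_eqI)
  fix Q :: "nat ^ 'a"
  let ?B = "{P :: nat ^ 'a. mdeg P \<le> mdeg Q}"
  have "mcoeff (mfps_compose (mfps_compose f G) H) Q
      = (\<Sum>R\<in>?B. (\<Sum>P\<in>?B. mcoeff f P * mcoeff (mpow G P) R) * mcoeff (mpow H R) Q)"
    unfolding mcoeff_compose[of _ H]
    by (rule sum.cong) (auto simp: mcoeff_compose_large[OF assms(1)])
  also have "\<dots> = (\<Sum>P\<in>?B. mcoeff f P * (\<Sum>R\<in>?B. mcoeff (mpow G P) R * mcoeff (mpow H R) Q))"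
    unfolding sum_distrib_right sum_distrib_left mult.assoc by (rule sum.swap)
  also have "\<dots> = mcoeff (mfps_compose f (fmap_compose G H)) Q"
    by (simp add: mcoeff_compose[of f] mpow_compose[OF assms(2), symmetric] mcoeff_compose[of "mpow G _" H])
  finally show "mcoeff (mfps_compose (mfps_compose f G) H) Q
      = mcoeff (mfps_compose f (fmap_compose G H)) Q" .
qed

lemma fmap_compose_assoc:
  assumes "ord_pos G" "ord_pos H"
  shows "fmap_compose (fmap_compose F G) H = fmap_compose F (fmap_compose G H)"
  by (simp add: vec_eq_iff compose_assoc[OF assms])

lemma fmap_linear_nth [simp]:
  "fmap_linear A $ k = (\<Sum>l\<in>UNIV. mfps_monom (axis l 1) (A $ k $ l))"
  by (simp add: fmap_linear_def)

lemma mcoeff_linear_0: "mcoeff (fmap_linear A $ k) 0 = 0"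
  by (simp add: mcoeff_monom)

lemma ord_pos_linear [simp]: "ord_pos (fmap_linear A)"
  unfolding ord_pos_def using mcoeff_linear_0 by blast

lemma mcoeff_linear_axis: "mcoeff (fmap_linear A $ k) (axis l 1) = A $ k $ l"
  by (simp add: mcoeff_monom sum.delta')

lemma mcoeff_linear_high: "2 \<le> mdeg Q \<Longrightarrow> mcoeff (fmap_linear A $ k) Q = 0"
  by (auto simp: mcoeff_monom intro!: sum.neutral)

lemma linear_compose:
  assumes "ord_pos G"
  shows "mcoeff (fmap_compose (fmap_linear A) G $ k) Q = (\<Sum>l\<in>UNIV. A $ k $ l * mcoeff (G $ l) Q)"
  by (simp add: compose_sum compose_monom[OF assms])

lemma linear_diag_nth: "fmap_linear (diag_matrix v) $ k = mfps_monom (axis k 1) (v $ k)"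
proof -
  have "(\<Sum>l\<in>UNIV. mfps_monom (axis l 1) (diag_matrix v $ k $ l))
      = (\<Sum>l\<in>UNIV. if l = k then mfps_monom (axis k 1) (v $ k) else 0)"
    by (intro sum.cong refl) (auto simp: diag_matrix_def mfps_monom_def zero_mfps_def)
  thus ?thesis by (simp add: sum.delta)
qed

lemma mpow_linear_diag: "mpow (fmap_linear (diag_matrix v)) P = mfps_monom P (mpow v P)"
proof (induction P rule: multi_index_induct)
  case zero
  show ?case by (rule mfps_eqI) (simp add: mcoeff_1 mcoeff_monom)
next
  case (add P k)
  thus ?case unfolding mpow_add mpow_axis linear_diag_nth by (simp add: monom_mult)
qed

lemma compose_diag:
  "mcoeff (mfps_compose f (fmap_linear (diag_matrix v))) Q = mcoeff f Q * mpow v Q"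
proof -
  have "mcoeff (mfps_compose f (fmap_linear (diag_matrix v))) Q
      = (\<Sum>P | mdeg P \<le> mdeg Q. if P = Q then mcoeff f Q * mpow v Q else 0)"
    unfolding mcoeff_compose mpow_linear_diag by (rule sum.cong) (auto simp: mcoeff_monom)
  thus ?thesis by (simp add: finite_mdeg_le sum.delta)
qed

lemma diag_compose:
  assumes "ord_pos G"
  shows "mcoeff (fmap_compose (fmap_linear (diag_matrix v)) G $ k) Q = v $ k * mcoeff (G $ k) Q"
  unfolding linear_compose[OF assms]
proof -
  have "(\<Sum>l\<in>UNIV. diag_matrix v $ k $ l * mcoeff (G $ l) Q)
      = (\<Sum>l\<in>UNIV. if l = k then v $ k * mcoeff (G $ k) Q else 0)"
    by (intro sum.cong refl) (auto simp: diag_matrix_def)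
  thus "(\<Sum>l\<in>UNIV. diag_matrix v $ k $ l * mcoeff (G $ l) Q) = v $ k * mcoeff (G $ k) Q"
    by (simp add: sum.delta)
qed

lemma mat_1_diag: "mat 1 = diag_matrix (\<chi> k. 1)"
  by (simp add: mat_def diag_matrix_def vec_eq_iff)

lemma compose_id: "mfps_compose f (fmap_linear (mat 1)) = f"
  unfolding mat_1_diag by (rule mfps_eqI) (simp add: compose_diag mpow_const)

lemma fmap_compose_id: "fmap_compose F (fmap_linear (mat 1)) = F"
  by (simp add: vec_eq_iff compose_id)

lemma fmap_id_compose: "ord_pos G \<Longrightarrow> fmap_compose (fmap_linear (mat 1)) G = G"
  unfolding mat_1_diag vec_eq_iff by (auto intro!: mfps_eqI simp: diag_compose simp del: fmap_linear_nth fmap_compose_nth)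

text \<open>The linear terms of f will form the homological operator. In the remaining sum, if G has
  no constant terms, only coefficients of G of degree below |Q| occur, so that the identity becomes
  a recursion.\<close>

lemma compose_split:
  assumes "mcoeff f 0 = 0"
  shows "mcoeff (mfps_compose f G) Q = (if Q = 0 then 0 else
    (\<Sum>l\<in>UNIV. mcoeff f (axis l 1) * mcoeff (G $ l) Q) +
    (\<Sum>P | 2 \<le> mdeg P \<and> mdeg P \<le> mdeg Q. mcoeff f P * mcoeff (mpow G P) Q))"
proof (cases "Q = 0")
  case True
  thus ?thesis using assms by (simp add: mcoeff_compose)
next
  case False
  have eq: "{P :: nat ^ 'a. mdeg P \<le> mdeg Q}
      = {0} \<union> range (\<lambda>l. axis l 1) \<union> {P. 2 \<le> mdeg P \<and> mdeg P \<le> mdeg Q}" (is "_ = ?A \<union> ?B \<union> ?C")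
  proof (intro equalityI subsetI)
    fix P :: "nat ^ 'a" assume "P \<in> {P. mdeg P \<le> mdeg Q}"
    moreover have "P \<in> ?B" if "mdeg P = 1" using mdeg_1_cases[OF that] by (metis rangeI)
    moreover have "mdeg P = 0 \<or> mdeg P = 1 \<or> 2 \<le> mdeg P" by linarith
    ultimately show "P \<in> ?A \<union> ?B \<union> ?C" by auto
  next
    fix P :: "nat ^ 'a" assume "P \<in> ?A \<union> ?B \<union> ?C"
    thus "P \<in> {P. mdeg P \<le> mdeg Q}" using mdeg_pos[OF False] by auto
  qed
  have finC: "finite ?C" by (rule finite_subset[OF _ finite_mdeg_le[of "mdeg Q"]]) auto
  have "mcoeff (mfps_compose f G) Q = (\<Sum>P\<in>?A \<union> ?B. mcoeff f P * mcoeff (mpow G P) Q)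
     + (\<Sum>P\<in>?C. mcoeff f P * mcoeff (mpow G P) Q)"
    unfolding mcoeff_compose eq by (rule sum.union_disjoint) (use finC in auto)
  also have "(\<Sum>P\<in>?A \<union> ?B. mcoeff f P * mcoeff (mpow G P) Q)
      = (\<Sum>P\<in>?B. mcoeff f P * mcoeff (mpow G P) Q)"
    by (rule sum.mono_neutral_right) (use assms in auto)
  also have "\<dots> = (\<Sum>l\<in>UNIV. mcoeff f (axis l 1) * mcoeff (G $ l) Q)"
    by (subst sum.reindex) (auto simp: inj_on_def)
  finally show ?thesis using False by simp
qed

lemma mcoeff_compose_axis:
  assumes "mcoeff f 0 = 0"
  shows "mcoeff (mfps_compose f G) (axis k 1) = (\<Sum>l\<in>UNIV. mcoeff f (axis l 1) * mcoeff (G $ l) (axis k 1))"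
proof -
  have "{P :: nat ^ 'a. 2 \<le> mdeg P \<and> mdeg P \<le> mdeg (axis k (1::nat) :: nat ^ 'a)} = {}" by auto
  thus ?thesis by (simp only: compose_split[OF assms] axis_nonzero_nat if_False sum.empty add_0_right)
qed


section \<open>Series supported off a hereditary set of exponents\<close>

text \<open>Sets closed under divisors: complements of monomial ideals, but also the exponents below
  a given degree. Congruences modulo an ideal, up to a degree, or both are thereby treated
  alike.\<close>

definition hereditary :: "(nat ^ 'n::finite) set \<Rightarrow> bool" where
  "hereditary N \<longleftrightarrow> (\<forall>P Q. P + Q \<in> N \<longrightarrow> P \<in> N)"

definition vanishing :: "(nat ^ 'n::finite) set \<Rightarrow> 'n mfps set" where
  "vanishing N = {a. \<forall>Q\<in>N. mcoeff a Q = 0}"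

lemma hereditaryD: "hereditary N \<Longrightarrow> P + Q \<in> N \<Longrightarrow> P \<in> N" "hereditary N \<Longrightarrow> P + Q \<in> N \<Longrightarrow> Q \<in> N"
  by (auto simp: hereditary_def) (metis add.commute)

lemma vanishing_add: "f \<in> vanishing N \<Longrightarrow> g \<in> vanishing N \<Longrightarrow> f + g \<in> vanishing N"
  and vanishing_mono: "f \<in> vanishing N \<Longrightarrow> N' \<subseteq> N \<Longrightarrow> f \<in> vanishing N'"
  by (auto simp: vanishing_def)

lemma vanishing_mult:
  assumes "hereditary N" "g \<in> vanishing N" shows "f * g \<in> vanishing N" "g * f \<in> vanishing N"
proof -
  show "f * g \<in> vanishing N"
    using assms by (auto simp: vanishing_def mcoeff_mult msplit_def intro!: sum.neutral)
      (metis hereditaryD(2))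
  thus "g * f \<in> vanishing N" by (simp add: mult.commute)
qed

text \<open>A factor without constant term uses up a nonzero exponent, so the other factor is only
  evaluated on N. In the applications N' reaches one degree further than N.\<close>

lemma vanishing_mult_shift:
  assumes "\<And>P Q. P \<noteq> 0 \<Longrightarrow> P + Q \<in> N' \<Longrightarrow> Q \<in> N" "mcoeff f 0 = 0" "g \<in> vanishing N"
  shows "f * g \<in> vanishing N'"
proof -
  have "mcoeff f (fst p) * mcoeff g (snd p) = 0" if "Q \<in> N'" "p \<in> msplit Q" for Q p
    using that assms(2,3) assms(1)[of "fst p" "snd p"]
    by (cases "fst p = 0") (auto simp: msplit_def vanishing_def)
  thus ?thesis by (auto simp: vanishing_def mcoeff_mult intro!: sum.neutral)
qed

lemma mpow_cong_vanishing:
  assumes "hereditary N" "\<And>k. G $ k - H $ k \<in> vanishing N"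
  shows "mpow G P - mpow H P \<in> vanishing N"
proof (induction P rule: multi_index_induct)
  case zero
  thus ?case by (simp add: vanishing_def)
next
  case (add P k)
  have "mpow G (P + axis k 1) - mpow H (P + axis k 1)
      = mpow G P * (G $ k - H $ k) + (mpow G P - mpow H P) * H $ k"
    by (simp add: mpow_add algebra_simps)
  thus ?case using vanishing_add vanishing_mult[OF assms(1)] assms(2) add by metis
qed

lemma compose_cong_vanishing:
  assumes "hereditary N" "\<And>k. G $ k - H $ k \<in> vanishing N"
  shows "mfps_compose f G - mfps_compose f H \<in> vanishing N"
  using mpow_cong_vanishing[OF assms]
  by (simp add: vanishing_def mcoeff_compose)

text \<open>Since \<open>G^P - H^P\<close> is a combination of the \<open>G\<^sub>k - H\<^sub>k\<close> with coefficients that vanish at \<open>0\<close>,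
  it vanishes to one order more than the \<open>G\<^sub>k - H\<^sub>k\<close> do.\<close>

lemma mpow_cong_shift:
  assumes N: "hereditary N" and N': "\<And>P Q. P \<noteq> 0 \<Longrightarrow> P + Q \<in> N' \<Longrightarrow> Q \<in> N"
    and GH: "\<And>k. G $ k - H $ k \<in> vanishing N" "ord_pos G" "ord_pos H" and P: "2 \<le> mdeg P"
  shows "mpow G P - mpow H P \<in> vanishing N'"
proof -
  have "P \<noteq> 0" using P by auto
  then obtain k R where PR: "P = R + axis k 1" by (rule nonzero_index_cases)
  hence R: "R \<noteq> 0" using P by auto
  have "mpow G P - mpow H P = mpow G R * (G $ k - H $ k) + H $ k * (mpow G R - mpow H R)"
    unfolding PR by (simp add: mpow_add algebra_simps)
  moreover have "mpow G R * (G $ k - H $ k) \<in> vanishing N'"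
    by (rule vanishing_mult_shift[OF N' mcoeff_mpow_0[OF GH(2) R] GH(1)])
  moreover have "H $ k * (mpow G R - mpow H R) \<in> vanishing N'"
    by (rule vanishing_mult_shift[OF N' _ mpow_cong_vanishing[OF N GH(1)]])
      (use GH(3) in \<open>auto simp: ord_pos_def\<close>)
  ultimately show ?thesis by (simp add: vanishing_add)
qed

section \<open>Convergent power series\<close>

abbreviation abs_sum_on :: "('a \<Rightarrow> 'b::real_normed_vector) \<Rightarrow> 'a set \<Rightarrow> bool" (infix "abs'_sum'_on" 46)
  where "f abs_sum_on A \<equiv> (\<lambda>x. norm (f x)) summable_on A"

definition summable_at :: "real \<Rightarrow> 'n::finite mfps \<Rightarrow> bool" where
  "summable_at r a \<longleftrightarrow> (\<lambda>Q. norm (mcoeff a Q) * r ^ mdeg Q) summable_on UNIV"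

text \<open>A weighted l1 norm, read off from the coefficients; it dominates the supremum over the
  polydisc of radius r and is submultiplicative.\<close>

definition mnorm :: "real \<Rightarrow> 'n::finite mfps \<Rightarrow> real" where
  "mnorm r a = (\<Sum>\<^sub>\<infinity>Q. norm (mcoeff a Q) * r ^ mdeg Q)"

definition meval :: "'n::finite mfps \<Rightarrow> complex ^ 'n \<Rightarrow> complex" where
  "meval a z = (\<Sum>\<^sub>\<infinity>Q. mcoeff a Q * mpow z Q)"

lemma norm_mpow_le:
  fixes z :: "complex ^ 'n::finite"
  assumes "\<And>k. norm (z $ k) \<le> r"
  shows "norm (mpow z Q) \<le> r ^ mdeg Q"
proof -
  have "norm (mpow z Q) \<le> (\<Prod>k\<in>UNIV. r ^ (Q $ k))"
    unfolding norm_mpow unfolding mpow_def by (rule prod_mono) (auto intro!: power_mono zero_le_power assms)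
  thus ?thesis by (simp add: mdeg_def power_sum)
qed

lemma mnorm_has_sum:
  "summable_at r a \<Longrightarrow> ((\<lambda>Q. norm (mcoeff a Q) * r ^ mdeg Q) has_sum mnorm r a) UNIV"
  unfolding summable_at_def mnorm_def by simp

lemma mnorm_nonneg: "0 \<le> r \<Longrightarrow> 0 \<le> mnorm r a"
  unfolding mnorm_def by (intro infsum_nonneg) auto

lemma summable_at_abs:
  assumes "summable_at r a" "\<And>k. norm (z $ k) \<le> r"
  shows "(\<lambda>Q. mcoeff a Q * mpow z Q) abs_sum_on UNIV"
    and "((\<lambda>Q. mcoeff a Q * mpow z Q) has_sum meval a z) UNIV"
    and "norm (meval a z) \<le> mnorm r a"
proof -
  have le: "norm (mcoeff a Q * mpow z Q) \<le> norm (mcoeff a Q) * r ^ mdeg Q" for Q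
    unfolding norm_mult by (intro mult_left_mono norm_mpow_le assms) auto
  show *: "(\<lambda>Q. mcoeff a Q * mpow z Q) abs_sum_on UNIV"
    by (rule summable_on_comparison_test[OF assms(1)[unfolded summable_at_def]]) (use le in auto)
  show "((\<lambda>Q. mcoeff a Q * mpow z Q) has_sum meval a z) UNIV"
    unfolding meval_def using abs_summable_summable[OF *] by simp
  show "norm (meval a z) \<le> mnorm r a"
    unfolding meval_def mnorm_def
    by (rule order_trans[OF norm_infsum_bound[OF *]], rule infsum_mono)
      (use * assms(1) le in \<open>auto simp: summable_at_def\<close>)
qed

lemma summable_at_mono:
  assumes "summable_at r a" "0 \<le> s" "s \<le> r" shows "summable_at s a"
  unfolding summable_at_def
  by (rule summable_on_comparison_test[OF assms(1)[unfolded summable_at_def]])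
    (use assms in \<open>auto intro!: mult_left_mono power_mono\<close>)

lemma mnorm_mono:
  assumes "summable_at r a" "0 \<le> s" "s \<le> r" shows "mnorm s a \<le> mnorm r a"
  unfolding mnorm_def
  by (rule infsum_mono) (use assms summable_at_mono[OF assms] in
    \<open>auto simp: summable_at_def intro!: mult_left_mono power_mono\<close>)

text \<open>A Schwarz lemma: shrinking the radius by c gains c^d on a series of order at least d,
  term by term.\<close>

lemma mnorm_scale:
  assumes "summable_at r a" "0 \<le> r" "0 \<le> c" "c \<le> 1" "\<And>Q. mdeg Q < d \<Longrightarrow> mcoeff a Q = 0"
  shows "mnorm (c * r) a \<le> c ^ d * mnorm r a"
proof -
  have "mnorm (c * r) a \<le> (\<Sum>\<^sub>\<infinity>Q. c ^ d * (norm (mcoeff a Q) * r ^ mdeg Q))"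
    unfolding mnorm_def
  proof (rule infsum_mono)
    show "(\<lambda>Q. norm (mcoeff a Q) * (c * r) ^ mdeg Q) summable_on UNIV"
      using summable_at_mono[OF assms(1), of "c * r"] assms mult_right_mono[of c 1 r]
      by (simp add: summable_at_def)
    show "(\<lambda>Q. c ^ d * (norm (mcoeff a Q) * r ^ mdeg Q)) summable_on UNIV"
      using assms(1) unfolding summable_at_def by (rule summable_on_cmult_right)
    fix Q :: "nat ^ 'a"
    show "norm (mcoeff a Q) * (c * r) ^ mdeg Q \<le> c ^ d * (norm (mcoeff a Q) * r ^ mdeg Q)"
    proof (cases "mdeg Q < d")
      case True thus ?thesis using assms by simp
    next
      case False
      hence "c ^ mdeg Q \<le> c ^ d"
        by (intro power_decreasing) (use assms in auto)
      hence "c ^ mdeg Q * (norm (mcoeff a Q) * r ^ mdeg Q)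
          \<le> c ^ d * (norm (mcoeff a Q) * r ^ mdeg Q)"
        by (intro mult_right_mono) (use assms in auto)
      thus ?thesis by (simp add: power_mult_distrib mult_ac)
    qed
  qed
  also have "\<dots> = c ^ d * mnorm r a" unfolding mnorm_def
    by (subst infsum_cmult_right) (use assms(1) in \<open>auto simp: summable_at_def\<close>)
  finally show ?thesis .
qed

lemma eventually_nhds_0_polydisc:
  assumes "0 < r" shows "\<forall>\<^sub>F z::complex ^ 'n::finite in nhds 0. \<forall>k. norm (z $ k) \<le> r"
  unfolding eventually_nhds_metric
proof (intro exI[of _ r] conjI allI impI assms)
  fix z :: "complex ^ 'n" and k assume "dist z 0 < r"
  thus "norm (z $ k) \<le> r" using Finite_Cartesian_Product.norm_nth_le[of z k] by simp
qed

lemma exists_small_radius: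
  assumes "\<And>k::'i::finite. \<exists>r>0. \<forall>s. 0 < s \<longrightarrow> s \<le> r \<longrightarrow> Q k s"
  shows "\<exists>r>0::real. \<forall>k. Q k r"
proof -
  obtain r where r: "\<And>k. 0 < r k" "\<And>k s. 0 < s \<Longrightarrow> s \<le> r k \<Longrightarrow> Q k s"
    using assms by metis
  have "0 < Min (range r)" "\<And>k. Min (range r) \<le> r k"
    using r(1) by auto
  thus ?thesis using r(2) by blast
qed

text \<open>At a diagonal point (r, ..., r) the modulus of x^Q is r^|Q|, so that absolute
  summability at this single point is \<open>summable_at r\<close>.\<close>

lemma vec_of_small_real:
  assumes "\<forall>\<^sub>F z::complex ^ 'n::finite in nhds 0. Q z"
  shows "\<exists>r>0. Q (\<chi> k. of_real r)"
proof -
  have "((\<lambda>r. (\<chi> k. of_real r) :: complex ^ 'n) \<longlongrightarrow> (\<chi> k. of_real 0)) (at_right (0::real))"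
    by (intro tendsto_intros)
  moreover have "((\<chi> k. of_real 0) :: complex ^ 'n) = 0" by (simp add: vec_eq_iff)
  ultimately have "\<forall>\<^sub>F r in at_right (0::real). Q (\<chi> k. of_real r)"
    using assms by (simp add: filterlim_iff)
  hence "\<forall>\<^sub>F r in at_right (0::real). 0 < r \<and> Q (\<chi> k. of_real r)"
    by (auto intro: eventually_conj eventually_at_right_less)
  thus ?thesis using eventually_happens[of _ "at_right (0::real)"] by auto
qed

lemma summable_at_iff_mpow_const:
  assumes "0 \<le> r"
  shows "summable_at r a \<longleftrightarrow> (\<lambda>Q. mcoeff a Q * mpow (\<chi> k. of_real r) Q) abs_sum_on UNIV"
  using assms by (simp add: summable_at_def mpow_const norm_mult norm_power)

lemma has_mfps_expansion_iff:
  "f has_mfps_expansion a \<longleftrightarrow>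
    (\<exists>r>0. summable_at r a) \<and> (\<forall>\<^sub>F z in nhds 0. f z = meval a z)"
proof
  assume *: "f has_mfps_expansion a"
  then obtain r where r: "0 < r"
    "((\<lambda>Q. mcoeff a Q * mpow (\<chi> k. of_real r) Q) has_sum f (\<chi> k. of_real r)) UNIV"
    using vec_of_small_real unfolding has_mfps_expansion_def by blast
  \<comment> \<open>Unordered sums of complex numbers converge absolutely.\<close>
  hence "summable_at r a"
    using iffD1[OF summable_on_iff_abs_summable_on_complex has_sum_imp_summable[OF r(2)]]
    by (subst summable_at_iff_mpow_const) auto
  moreover have "\<forall>\<^sub>F z in nhds 0. f z = meval a z"
    using * unfolding has_mfps_expansion_def
    by (rule eventually_mono) (auto simp: meval_def infsumI)
  ultimately show "(\<exists>r>0. summable_at r a) \<and> (\<forall>\<^sub>F z in nhds 0. f z = meval a z)"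
    using r(1) by blast
next
  assume *: "(\<exists>r>0. summable_at r a) \<and> (\<forall>\<^sub>F z in nhds 0. f z = meval a z)"
  then obtain r where r: "0 < r" "summable_at r a" by blast
  from conjunct2[OF *] eventually_nhds_0_polydisc[OF r(1)]
  show "f has_mfps_expansion a" unfolding has_mfps_expansion_def
    by eventually_elim (use summable_at_abs[OF r(2)] in auto)
qed

lemma convergent_mfps_iff: "a \<in> convergent_mfps \<longleftrightarrow> (\<exists>r>0. summable_at r a)"
  unfolding convergent_mfps_def has_mfps_expansion_iff mem_Collect_eq
  by (metis (mono_tags, lifting) eventually_mono eventually_True)

lemma meval_has_expansion: "a \<in> convergent_mfps \<Longrightarrow> meval a has_mfps_expansion a"
  by (simp add: has_mfps_expansion_iff convergent_mfps_iff)

lemma has_expansion_convergent: "f has_mfps_expansion a \<Longrightarrow> a \<in> convergent_mfps"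
  by (auto simp: convergent_mfps_def)

lemma has_expansion_cong:
  assumes "\<forall>\<^sub>F z in nhds 0. f z = g z" "f has_mfps_expansion a"
  shows "g has_mfps_expansion a"
  using assms(1) conjunct2[OF assms(2)[unfolded has_mfps_expansion_iff]] assms(2)
  unfolding has_mfps_expansion_iff by (auto elim: eventually_elim2)

lemma has_expansion_add:
  assumes "f has_mfps_expansion a" "g has_mfps_expansion b"
  shows "(\<lambda>z. f z + g z) has_mfps_expansion (a + b)"
  using assms unfolding has_mfps_expansion_def
  by eventually_elim (auto simp: ring_distribs intro: has_sum_add)

lemma has_expansion_diff:
  assumes "f has_mfps_expansion a" "g has_mfps_expansion b"
  shows "(\<lambda>z. f z - g z) has_mfps_expansion (a - b)"
  using assms unfolding has_mfps_expansion_def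
proof eventually_elim
  case (elim z)
  from has_sum_add[OF elim(1) has_sum_uminusI[OF elim(2)]] show ?case
    by (simp add: ring_distribs)
qed

lemma has_expansion_monom: "(\<lambda>z. c * mpow z P) has_mfps_expansion mfps_monom P c"
  unfolding has_mfps_expansion_def
proof (intro always_eventually allI)
  fix z :: "complex ^ 'a"
  show "((\<lambda>Q. mcoeff (mfps_monom P c) Q * mpow z Q) has_sum c * mpow z P) UNIV"
    by (rule has_sum_finite_neutralI[of "{P}"]) (auto simp: mcoeff_monom)
qed

lemma has_expansion_sum:
  assumes "finite A" "\<And>x. x \<in> A \<Longrightarrow> f x has_mfps_expansion a x"
  shows "(\<lambda>z. \<Sum>x\<in>A. f x z) has_mfps_expansion (\<Sum>x\<in>A. a x)"
  using assms
proof (induction A rule: finite_induct)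
  case empty
  thus ?case by (simp add: has_mfps_expansion_def)
qed (simp add: has_expansion_add)

lemma has_expansion_linear: "map_has_expansion (\<lambda>z. A *v z) (fmap_linear A)"
  unfolding map_has_expansion_def
proof
  fix k
  have "(\<lambda>z. \<Sum>l\<in>UNIV. A $ k $ l * mpow z (axis l 1)) has_mfps_expansion fmap_linear A $ k"
    unfolding fmap_linear_nth by (intro has_expansion_sum has_expansion_monom) auto
  thus "(\<lambda>z. (A *v z) $ k) has_mfps_expansion fmap_linear A $ k"
    by (simp add: matrix_vector_mult_def)
qed


text \<open>The double family is absolutely summable, so its pairs may be regrouped by their sum;
  every group is finite.\<close>

lemma has_sum_cauchy_product:
  fixes f g :: "nat ^ 'n::finite \<Rightarrow> 'a::{real_normed_field, banach}"
  assumes "f abs_sum_on UNIV" "g abs_sum_on UNIV"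
    and f: "(f has_sum a) UNIV" and g: "(g has_sum b) UNIV"
  shows "((\<lambda>Q. \<Sum>p\<in>msplit Q. f (fst p) * g (snd p)) has_sum a * b) UNIV"
proof -
  let ?h = "\<lambda>p. f (fst p) * g (snd p)"
  have "?h abs_sum_on (UNIV \<times> UNIV)"
    unfolding Infinite_Sum.abs_summable_on_Sigma_iff
    using assms(1,2)
    by (auto simp: norm_mult infsum_cmult_right' abs_mult abs_of_nonneg infsum_nonneg
        intro!: summable_on_cmult_right summable_on_cmult_left)
  hence "?h summable_on (UNIV \<times> UNIV)" by (rule abs_summable_summable)
  hence "(?h has_sum a * b) (UNIV \<times> UNIV)"
    by (intro has_sum_SigmaI[where g = "\<lambda>P. f P * b"])
      (use f g in \<open>auto intro: has_sum_cmult_right has_sum_cmult_left\<close>)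
  moreover have "bij_betw (\<lambda>p. (fst p + snd p, p)) (UNIV \<times> UNIV)
      (Sigma UNIV (msplit :: nat ^ 'n \<Rightarrow> _))"
    by (rule bij_betwI[of _ _ _ snd]) (auto simp: msplit_def)
  ultimately have "((\<lambda>x. ?h (snd x)) has_sum a * b) (Sigma UNIV msplit)"
    using has_sum_reindex_bij_betw[of "\<lambda>p. (fst p + snd p, p)" "UNIV \<times> UNIV" "Sigma UNIV msplit"
        "\<lambda>x. ?h (snd x)" "a * b"] by simp
  thus ?thesis
    by (rule has_sum_SigmaD) (auto intro: has_sum_finiteI)
qed

lemma mpow_msplit: "p \<in> msplit Q \<Longrightarrow> mpow z Q = mpow z (fst p) * mpow z (snd p)"
  by (auto simp: msplit_def mpow_add)

lemma summable_at_mult: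
  assumes "summable_at r a" "summable_at r b" "0 \<le> r"
  shows "summable_at r (a * b)" and "mnorm r (a * b) \<le> mnorm r a * mnorm r b"
    and "(\<And>k. norm (z $ k) \<le> r) \<Longrightarrow> meval (a * b) z = meval a z * meval b z"
proof -
  let ?f = "\<lambda>c Q. norm (mcoeff c Q) * r ^ mdeg Q"
  have *: "((\<lambda>Q. \<Sum>p\<in>msplit Q. ?f a (fst p) * ?f b (snd p)) has_sum mnorm r a * mnorm r b) UNIV"
    by (rule has_sum_cauchy_product)
      (use assms mnorm_has_sum in \<open>auto simp: summable_at_def abs_mult\<close>)
  have le: "?f (a * b) Q \<le> (\<Sum>p\<in>msplit Q. ?f a (fst p) * ?f b (snd p))" for Q
  proof -
    have "?f (a * b) Q \<le> (\<Sum>p\<in>msplit Q. norm (mcoeff a (fst p) * mcoeff b (snd p))) * r ^ mdeg Q"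
      unfolding mcoeff_mult by (intro mult_right_mono norm_sum) (use assms in auto)
    also have "\<dots> = (\<Sum>p\<in>msplit Q. ?f a (fst p) * ?f b (snd p))"
      unfolding sum_distrib_right
      by (rule sum.cong) (auto simp: msplit_def mdeg_add power_add norm_mult)
    finally show ?thesis .
  qed
  show s: "summable_at r (a * b)" unfolding summable_at_def
    by (rule summable_on_comparison_test[OF has_sum_imp_summable[OF *]]) (use le assms in auto)
  show "mnorm r (a * b) \<le> mnorm r a * mnorm r b"
    by (rule has_sum_mono[OF mnorm_has_sum[OF s] *]) (use le in auto)
  show "meval (a * b) z = meval a z * meval b z" if z: "\<And>k. norm (z $ k) \<le> r"
  proof -
    have "((\<lambda>Q. \<Sum>p\<in>msplit Q. (mcoeff a (fst p) * mpow z (fst p)) * (mcoeff b (snd p) * mpow z (snd p)))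
        has_sum meval a z * meval b z) UNIV"
      by (rule has_sum_cauchy_product) (use summable_at_abs[OF assms(1) z] summable_at_abs[OF assms(2) z] in auto)
    also have "(\<lambda>Q. \<Sum>p\<in>msplit Q. (mcoeff a (fst p) * mpow z (fst p)) * (mcoeff b (snd p) * mpow z (snd p)))
        = (\<lambda>Q. mcoeff (a * b) Q * mpow z Q)"
      unfolding mcoeff_mult sum_distrib_right
      by (intro ext sum.cong) (auto simp: mpow_msplit)
    finally show ?thesis unfolding meval_def[of "a * b"] by (rule infsumI)
  qed
qed

lemma summable_at_1: "summable_at r (1 :: 'a::finite mfps)"
  and mnorm_1: "mnorm r (1 :: 'a::finite mfps) = 1"
  and meval_1: "meval 1 (z :: complex ^ 'a::finite) = 1"
proof -
  have "((\<lambda>Q::nat ^ 'a. norm (mcoeff 1 Q) * r ^ mdeg Q) has_sum 1) UNIV"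
    by (rule has_sum_finite_neutralI[of "{0}"]) (auto simp: mcoeff_1)
  thus "summable_at r (1 :: 'a mfps)" "mnorm r (1 :: 'a mfps) = 1"
    unfolding summable_at_def mnorm_def by (auto simp: has_sum_iff)
  have "((\<lambda>Q. mcoeff 1 Q * mpow z Q) has_sum 1) UNIV"
    by (rule has_sum_finite_neutralI[of "{0}"]) (auto simp: mcoeff_1)
  thus "meval 1 z = 1" unfolding meval_def by (rule infsumI)
qed

lemma summable_at_mpow:
  assumes "\<And>k. summable_at r (G $ k)" "0 \<le> r"
  shows "summable_at r (mpow G P)" and "mnorm r (mpow G P) \<le> mpow (\<chi> k. mnorm r (G $ k)) P"
    and "(\<And>k. norm (z $ k) \<le> r) \<Longrightarrow> meval (mpow G P) z = mpow (\<chi> k. meval (G $ k) z) P"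
proof -
  have *: "summable_at r (mpow G P) \<and> mnorm r (mpow G P) \<le> mpow (\<chi> k. mnorm r (G $ k)) P
      \<and> ((\<forall>k. norm (z $ k) \<le> r) \<longrightarrow> meval (mpow G P) z = mpow (\<chi> k. meval (G $ k) z) P)"
  proof (induction P rule: multi_index_induct)
    case zero
    show ?case by (simp add: summable_at_1 mnorm_1 meval_1)
  next
    case (add P k)
    note m = summable_at_mult[OF conjunct1[OF add] assms(1)[of k] assms(2)]
    have "mnorm r (mpow G P * G $ k) \<le> mnorm r (mpow G P) * mnorm r (G $ k)" by (rule m)
    also have "\<dots> \<le> mpow (\<chi> k. mnorm r (G $ k)) P * mnorm r (G $ k)"
      using add mnorm_nonneg[OF assms(2)] by (intro mult_right_mono) auto
    finally show ?case using m(1) m(3)[of z] add by (simp add: mpow_add)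
  qed
  show "summable_at r (mpow G P)" "mnorm r (mpow G P) \<le> mpow (\<chi> k. mnorm r (G $ k)) P"
    "(\<And>k. norm (z $ k) \<le> r) \<Longrightarrow> meval (mpow G P) z = mpow (\<chi> k. meval (G $ k) z) P"
    using * by auto
qed

lemma mpow_le_power:
  fixes x :: "real ^ 'n::finite"
  assumes "\<And>k. 0 \<le> x $ k" "\<And>k. x $ k \<le> s"
  shows "mpow x P \<le> s ^ mdeg P" and "0 \<le> mpow x P"
proof -
  have "mpow x P \<le> (\<Prod>k\<in>UNIV. s ^ (P $ k))"
    unfolding mpow_def by (rule prod_mono) (auto intro!: power_mono zero_le_power assms)
  thus "mpow x P \<le> s ^ mdeg P" by (simp add: mdeg_def power_sum)
  show "0 \<le> mpow x P" unfolding mpow_def by (intro prod_nonneg ballI zero_le_power assms)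
qed

text \<open>The family f_P (G^P)_Q z^Q is absolutely summable, because
  \<open>mnorm r (mpow G P)\<close> is at most s^|P|. Summed over Q first it gives f(G(z)); summed
  over P first, where each sum is finite, it gives the composed series.\<close>

lemma summable_at_compose:
  assumes G: "\<And>k. summable_at r (G $ k)" "0 \<le> r" "\<And>k. mnorm r (G $ k) \<le> s" "ord_pos G"
    and f: "summable_at s f"
  shows "summable_at r (mfps_compose f G)"
    and "(\<And>k. norm (z $ k) \<le> r) \<Longrightarrow>
      meval (mfps_compose f G) z = meval f (\<chi> k. meval (G $ k) z)"
proof -
  have mP: "mnorm r (mpow G P) \<le> s ^ mdeg P" for P
    by (rule order_trans[OF summable_at_mpow(2)[OF G(1,2)] mpow_le_power(1)])
      (simp_all add: mnorm_nonneg G)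
  define h where "h z x = mcoeff f (fst x) * mcoeff (mpow G (fst x)) (snd x) * mpow z (snd x)" for z x
  have abs: "h z abs_sum_on (UNIV \<times> UNIV)" if z: "\<And>k. norm (z $ k) \<le> r" for z
    unfolding Infinite_Sum.abs_summable_on_Sigma_iff
  proof safe
    fix P :: "nat ^ 'a"
    have row: "(\<lambda>Q. norm (h z (P, Q))) = (\<lambda>Q. norm (mcoeff f P) * norm (mcoeff (mpow G P) Q * mpow z Q))"
      by (simp add: h_def norm_mult mult_ac)
    show "(\<lambda>Q. h z (P, Q)) abs_sum_on UNIV"
      unfolding row
      by (intro summable_on_cmult_right summable_at_abs(1)[OF summable_at_mpow(1)[OF G(1,2)]] z)
  next
    show "(\<lambda>P. \<Sum>\<^sub>\<infinity>Q. norm (h z (P, Q))) abs_sum_on UNIV"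
    proof (rule summable_on_comparison_test[OF f[unfolded summable_at_def]])
      fix P :: "nat ^ 'a"
      have "(\<Sum>\<^sub>\<infinity>Q. norm (h z (P, Q))) = norm (mcoeff f P) * (\<Sum>\<^sub>\<infinity>Q. norm (mcoeff (mpow G P) Q * mpow z Q))"
        by (simp add: h_def norm_mult mult_ac infsum_cmult_right')
      also have "\<dots> \<le> norm (mcoeff f P) * mnorm r (mpow G P)"
        unfolding mnorm_def
        by (intro mult_left_mono infsum_mono)
          (use summable_at_abs(1)[OF summable_at_mpow(1)[OF G(1,2)]] summable_at_mpow(1)[OF G(1,2)] z
            norm_mpow_le[OF z] in \<open>auto simp: summable_at_def norm_mult intro: mult_left_mono\<close>)
      also have "\<dots> \<le> norm (mcoeff f P) * s ^ mdeg P"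
        by (intro mult_left_mono mP) auto
      finally show "norm (\<Sum>\<^sub>\<infinity>Q. norm (h z (P, Q))) \<le> norm (mcoeff f P) * s ^ mdeg P"
        by (simp add: infsum_nonneg)
    qed auto
  qed
  have col: "((\<lambda>P. h z (P, Q)) has_sum mcoeff (mfps_compose f G) Q * mpow z Q) UNIV" for z Q
    by (rule has_sum_finite_neutralI[of "{P. mdeg P \<le> mdeg Q}"])
      (auto simp: h_def finite_mdeg_le mcoeff_mpow_low[OF G(4)] not_le mcoeff_compose sum_distrib_right)
  have swap: "((\<lambda>x. norm (h z (snd x, fst x))) summable_on (UNIV \<times> UNIV))" if "\<And>k. norm (z $ k) \<le> r" for z
    using abs[OF that] by (subst (asm) summable_on_swap) (simp add: case_prod_unfold)
  show "summable_at r (mfps_compose f G)"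
  proof -
    let ?z = "(\<chi> k. of_real r) :: complex ^ 'a"
    have "\<And>k. norm (?z $ k) \<le> r" using G(2) by simp
    note sw = swap[OF this]
    have sw': "(\<lambda>(Q, P). norm (h ?z (P, Q))) summable_on (UNIV \<times> UNIV)"
      using sw by (simp add: case_prod_unfold)
    show ?thesis unfolding summable_at_def
    proof (rule summable_on_comparison_test[OF summable_on_Sigma_banach[OF sw']])
      fix Q :: "nat ^ 'a"
      have "(\<lambda>P. norm (h ?z (P, Q))) summable_on UNIV"
        using summable_on_SigmaD1[OF sw', of Q] by simp
      hence "norm (mcoeff (mfps_compose f G) Q * mpow ?z Q) \<le> (\<Sum>\<^sub>\<infinity>P. norm (h ?z (P, Q)))"
        using norm_infsum_bound infsumI[OF col[of ?z Q]] by metis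
      thus "norm (mcoeff (mfps_compose f G) Q) * r ^ mdeg Q \<le> (\<Sum>\<^sub>\<infinity>P. norm (h ?z (P, Q)))"
        using G(2) by (simp add: norm_mult mpow_const norm_power)
    qed (use G(2) in auto)
  qed
  show "meval (mfps_compose f G) z = meval f (\<chi> k. meval (G $ k) z)" if z: "\<And>k. norm (z $ k) \<le> r"
  proof -
    obtain S where S: "(h z has_sum S) (UNIV \<times> UNIV)"
      using abs_summable_summable[OF abs[OF z]] by (auto simp: summable_on_def)
    have "((\<lambda>P. mcoeff f P * mpow (\<chi> k. meval (G $ k) z) P) has_sum S) UNIV"
    proof (rule has_sum_SigmaD[OF S])
      fix P :: "nat ^ 'a"
      have "((\<lambda>Q. mcoeff f P * (mcoeff (mpow G P) Q * mpow z Q))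
          has_sum mcoeff f P * meval (mpow G P) z) UNIV"
        by (intro has_sum_cmult_right summable_at_abs(2)[OF summable_at_mpow(1)[OF G(1,2)]] z)
      thus "((\<lambda>Q. h z (P, Q)) has_sum mcoeff f P * mpow (\<chi> k. meval (G $ k) z) P) UNIV"
        by (simp add: h_def mult.assoc summable_at_mpow(3)[OF G(1,2) z])
    qed
    moreover have "((\<lambda>Q. mcoeff (mfps_compose f G) Q * mpow z Q) has_sum S) UNIV"
    proof (rule has_sum_SigmaD)
      show "((\<lambda>(x, y). h z (y, x)) has_sum S) (UNIV \<times> UNIV)"
        using S by (subst (asm) has_sum_swap)
    qed (use col in simp)
    ultimately show ?thesis unfolding meval_def by (simp add: infsumI)
  qed
qed

lemma small_mnorm_radius:
  fixes G :: "'n::finite mfps ^ 'n"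
  assumes "\<And>k. G $ k \<in> convergent_mfps" "ord_pos G" "0 < s"
  shows "\<exists>r>0. \<forall>k. summable_at r (G $ k) \<and> mnorm r (G $ k) \<le> s"
proof (rule exists_small_radius)
  fix k
  obtain r where r: "0 < r" "summable_at r (G $ k)"
    using assms(1)[of k] by (auto simp: convergent_mfps_iff)
  \<comment> \<open>\<open>G $ k\<close> has no constant term, so its norm shrinks at least linearly
    with the radius; the + 1 keeps the denominator positive.\<close>
  define c where "c = min 1 (s / (mnorm r (G $ k) + 1))"
  have m: "0 \<le> mnorm r (G $ k)" using r(1) by (intro mnorm_nonneg) auto
  have c: "0 < c" "c \<le> 1" "c * mnorm r (G $ k) \<le> s"
  proof -
    show "0 < c" "c \<le> 1" using assms(3) m by (auto simp: c_def)
    have "c * mnorm r (G $ k) \<le> s / (mnorm r (G $ k) + 1) * (mnorm r (G $ k) + 1)"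
      using assms(3) m by (intro mult_mono) (auto simp: c_def)
    thus "c * mnorm r (G $ k) \<le> s" using m by simp
  qed
  have "summable_at t (G $ k) \<and> mnorm t (G $ k) \<le> s" if t: "0 < t" "t \<le> c * r" for t
  proof -
    have cr: "c * r \<le> r" using c r mult_right_mono[of c 1 r] by simp
    have sc: "summable_at (c * r) (G $ k)"
      using summable_at_mono[OF r(2) _ cr] c r by simp
    have "mnorm t (G $ k) \<le> mnorm (c * r) (G $ k)"
      using mnorm_mono[OF sc] t by simp
    also have "\<dots> \<le> c ^ 1 * mnorm r (G $ k)"
      by (rule mnorm_scale[OF r(2)]) (use c r assms(2) in \<open>auto simp: ord_pos_def\<close>)
    also have "\<dots> = c * mnorm r (G $ k)" by simp
    finally show ?thesis using c(3) summable_at_mono[OF sc] t by simp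
  qed
  thus "\<exists>r>0. \<forall>t. 0 < t \<longrightarrow> t \<le> r \<longrightarrow> summable_at t (G $ k) \<and> mnorm t (G $ k) \<le> s"
    using c(1) r(1) by (intro exI[of _ "c * r"]) auto
qed

lemma eventually_all_iff:
  "(\<forall>\<^sub>F z in F. \<forall>k::'k::finite. P k z) \<longleftrightarrow> (\<forall>k. \<forall>\<^sub>F z in F. P k z)"
  using eventually_ball_finite_distrib[of "UNIV :: 'k set" "\<lambda>z k. P k z" F] by simp

lemma map_has_expansion_iff:
  "map_has_expansion g b \<longleftrightarrow> (\<forall>k. b $ k \<in> convergent_mfps) \<and>
    (\<forall>\<^sub>F z in nhds 0. g z = (\<chi> k. meval (b $ k) z))"
  by (simp add: map_has_expansion_def has_mfps_expansion_iff convergent_mfps_iff vec_eq_iff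
      all_conj_distrib eventually_all_iff)

lemma map_expansion_cong:
  "\<forall>\<^sub>F z in nhds 0. f z = g z \<Longrightarrow> map_has_expansion f a \<Longrightarrow> map_has_expansion g a"
  unfolding map_has_expansion_def
proof
  fix k
  assume eq: "\<forall>\<^sub>F z in nhds 0. f z = g z" and f: "\<forall>k. (\<lambda>z. f z $ k) has_mfps_expansion a $ k"
  have "\<forall>\<^sub>F z in nhds 0. f z $ k = g z $ k" using eq by (rule eventually_mono) simp
  thus "(\<lambda>z. g z $ k) has_mfps_expansion a $ k" by (rule has_expansion_cong[OF _ f[rule_format, of k]])
qed

lemma map_expansion_tendsto_0:
  assumes "map_has_expansion g b" "ord_pos b"
  shows "filterlim g (nhds 0) (nhds 0)"
  unfolding filterlim_iff
proof (intro allI impI)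
  fix P :: "complex ^ 'a \<Rightarrow> bool" assume "eventually P (nhds 0)"
  then obtain e where e: "0 < e" "\<And>w. norm w < e \<Longrightarrow> P w"
    unfolding eventually_nhds_metric by auto
  \<comment> \<open>The norm is at most the sum of the \<open>CARD('a)\<close> moduli of the
    components, hence at most e / 2.\<close>
  define s where "s = e / (2 * real CARD('a))"
  have s: "0 < s" using e by (simp add: s_def)
  have b: "\<And>k. b $ k \<in> convergent_mfps" using assms(1) by (auto simp: map_has_expansion_iff)
  obtain r where r: "0 < r" "\<And>k. summable_at r (b $ k)" "\<And>k. mnorm r (b $ k) \<le> s"
    using small_mnorm_radius[OF b assms(2) s] by blast
  from assms(1) have "\<forall>\<^sub>F z in nhds 0. g z = (\<chi> k. meval (b $ k) z)"
    by (auto simp: map_has_expansion_iff)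
  with eventually_nhds_0_polydisc[OF r(1)] show "\<forall>\<^sub>F z in nhds 0. P (g z)"
  proof eventually_elim
    case (elim z)
    have "norm (g z $ k) \<le> s" for k
      using elim summable_at_abs(3)[OF r(2), of z k] r(3)[of k] by fastforce
    hence "norm (g z) \<le> (\<Sum>k\<in>(UNIV::'a set). s)"
      unfolding norm_vec_def by (intro order_trans[OF L2_set_le_sum] sum_mono) auto
    also have "\<dots> < e" using e by (simp add: s_def)
    finally show ?case by (rule e(2))
  qed
qed

lemma convergent_compose:
  assumes "f \<in> convergent_mfps" "\<And>k. G $ k \<in> convergent_mfps" "ord_pos G"
  shows "\<exists>r>0. summable_at r (mfps_compose f G) \<and> (\<forall>z. (\<forall>k. norm (z $ k) \<le> r) \<longrightarrow>
    meval (mfps_compose f G) z = meval f (\<chi> k. meval (G $ k) z))"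
proof -
  obtain s where s: "0 < s" "summable_at s f"
    using assms(1) by (auto simp: convergent_mfps_iff)
  obtain r where r: "0 < r" "\<And>k. summable_at r (G $ k)" "\<And>k. mnorm r (G $ k) \<le> s"
    using small_mnorm_radius[OF assms(2,3) s(1)] by blast
  show ?thesis
    using summable_at_compose[OF r(2) less_imp_le[OF r(1)] r(3) assms(3) s(2)] r(1) by blast
qed

lemma has_expansion_compose:
  assumes "f has_mfps_expansion a" "map_has_expansion g b" "ord_pos b"
  shows "(\<lambda>z. f (g z)) has_mfps_expansion mfps_compose a b"
proof -
  have b: "\<And>k. b $ k \<in> convergent_mfps" using assms(2) by (auto simp: map_has_expansion_iff)
  obtain r where r: "0 < r" "summable_at r (mfps_compose a b)" "\<And>z. (\<forall>k. norm (z $ k) \<le> r) \<Longrightarrow>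
    meval (mfps_compose a b) z = meval a (\<chi> k. meval (b $ k) z)"
    using convergent_compose[OF has_expansion_convergent[OF assms(1)] b assms(3)] by blast
  have 1: "\<forall>\<^sub>F z in nhds 0. f (g z) = meval a (g z)"
    using map_expansion_tendsto_0[OF assms(2,3)] assms(1)
    by (auto simp: has_mfps_expansion_iff filterlim_iff)
  have 2: "\<forall>\<^sub>F z in nhds 0. g z = (\<chi> k. meval (b $ k) z)"
    using assms(2) by (auto simp: map_has_expansion_iff)
  from 1 2 eventually_nhds_0_polydisc[OF r(1)]
  have "\<forall>\<^sub>F z in nhds 0. f (g z) = meval (mfps_compose a b) z"
    by eventually_elim (simp add: r(3))
  thus ?thesis using r(1,2) by (auto simp: has_mfps_expansion_iff)
qed

lemma map_expansion_compose:
  assumes "map_has_expansion f a" "map_has_expansion g b" "ord_pos b"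
  shows "map_has_expansion (f \<circ> g) (fmap_compose a b)"
  unfolding map_has_expansion_def
proof
  fix k
  have "(\<lambda>z. f z $ k) has_mfps_expansion a $ k" using assms(1) by (simp add: map_has_expansion_def)
  from has_expansion_compose[OF this assms(2,3)]
  show "(\<lambda>z. (f \<circ> g) z $ k) has_mfps_expansion fmap_compose a b $ k" by simp
qed


text \<open>Once the coefficients below n vanish, division by x^n leaves a series that is zero off
  the origin and tends to \<open>c n\<close> there.\<close>

lemma power_series_zero:
  fixes c :: "nat \<Rightarrow> complex"
  assumes "0 < s" and sums: "\<And>x. norm x < s \<Longrightarrow> (\<lambda>n. c n * x ^ n) sums 0"
  shows "c n = 0"
proof (induction n rule: less_induct)
  case (less n)
  have *: "(\<lambda>m. c (m + n) * x ^ m) sums 0" if x: "x \<noteq> 0" "norm x < s" for x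
  proof -
    have "(\<lambda>m. c (m + n) * x ^ (m + n)) sums 0"
      using sums_iff_shift[of "\<lambda>n. c n * x ^ n" n 0] sums[OF x(2)] less by simp
    hence "(\<lambda>m. inverse (x ^ n) * (c (m + n) * x ^ (m + n))) sums (inverse (x ^ n) * 0)"
      by (rule sums_mult)
    thus ?thesis using x(1) by (simp add: power_add field_simps)
  qed
  from powser_limit_0_strong[OF assms(1), of "\<lambda>m. c (m + n)" "\<lambda>_. 0", OF *]
  have lim: "((\<lambda>_. 0) \<longlongrightarrow> c (0 + n)) (at (0::complex))" by simp
  show ?case using tendsto_unique[OF _ lim tendsto_const] by simp
qed

text \<open>The variables are eliminated one after the other: for fixed values of the remaining ones, the
  series is a power series in a single variable.\<close>

lemma meval_zero_imp_zero:
  assumes a: "summable_at r a" "0 < r" and zero: "\<And>z. (\<And>k. norm (z $ k) < r) \<Longrightarrow> meval a z = 0"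
  shows "a = 0"
proof -
  \<comment> \<open>\<open>K\<close> holds the variables already eliminated, whose exponents are
    prescribed by P. For \<open>K = UNIV\<close> the index set is a single exponent.\<close>
  have "\<forall>P z. (\<forall>k. norm (z $ k) < r) \<longrightarrow>
    ((\<lambda>Q. mcoeff a Q * (\<Prod>l\<in>- K. z $ l ^ (Q $ l))) has_sum 0) {Q. \<forall>k\<in>K. Q $ k = P $ k}"
    if "finite K" for K :: "'a set"
    using that
  proof (induction K rule: finite_induct)
    case empty
    have "((\<lambda>Q. mcoeff a Q * mpow z Q) has_sum 0) UNIV" if "\<forall>k. norm (z $ k) < r" for z
      using summable_at_abs(2)[OF a(1), of z] zero[of z] that by (simp add: less_imp_le)
    thus ?case by (simp add: mpow_def)
  next
    case (insert k K)
    show ?case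
    proof (intro allI impI)
      fix P :: "nat ^ 'a" and z :: "complex ^ 'a" assume z: "\<forall>l. norm (z $ l) < r"
      let ?A = "\<lambda>j. {Q. (\<forall>l\<in>K. Q $ l = P $ l) \<and> Q $ k = j}"
      let ?f = "\<lambda>Q. mcoeff a Q * (\<Prod>l\<in>- insert k K. z $ l ^ (Q $ l))"
      define c where "c j = infsum ?f (?A j)" for j
      have KC: "- K = insert k (- insert k K)" "k \<notin> - insert k K" using insert.hyps by auto
      have split: "(\<Prod>l\<in>- K. w $ l ^ (Q $ l)) = w $ k ^ (Q $ k) * (\<Prod>l\<in>- insert k K. w $ l ^ (Q $ l))"
        for w :: "complex ^ 'a" and Q :: "nat ^ 'a"
        by (subst KC(1), subst prod.insert) (use KC(2) in auto)
      have subst_eq: "mcoeff a Q * (\<Prod>l\<in>- K. (\<chi> l. if l = k then x else z $ l) $ l ^ (Q $ l))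
          = x ^ (Q $ k) * ?f Q" for x Q
      proof -
        have "(\<Prod>l\<in>- insert k K. (\<chi> l. if l = k then x else z $ l) $ l ^ (Q $ l))
            = (\<Prod>l\<in>- insert k K. z $ l ^ (Q $ l))"
          by (rule prod.cong) auto
        thus ?thesis unfolding split by simp
      qed
      have x: "(\<lambda>j. c j * x ^ j) sums 0" if "norm x < r" for x
      proof -
        define w where "w = (\<chi> l. if l = k then x else z $ l)"
        have w: "\<forall>l. norm (w $ l) < r" using that z by (simp add: w_def)
        have eq: "mcoeff a Q * (\<Prod>l\<in>- K. w $ l ^ (Q $ l)) = x ^ (Q $ k) * ?f Q" for Q
          unfolding w_def by (rule subst_eq)
        have *: "((\<lambda>Q. x ^ (Q $ k) * ?f Q) has_sum 0) {Q. \<forall>l\<in>K. Q $ l = P $ l}"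
          using insert.IH[rule_format, OF w[rule_format], of P] by (simp only: eq)
        have "bij_betw snd (Sigma UNIV ?A) {Q. \<forall>l\<in>K. Q $ l = P $ l}"
          by (rule bij_betwI[of _ _ _ "\<lambda>Q. (Q $ k, Q)"]) auto
        from has_sum_reindex_bij_betw[OF this, THEN iffD2, OF *]
        have S: "((\<lambda>p. x ^ (snd p $ k) * ?f (snd p)) has_sum 0) (Sigma UNIV ?A)" .
        have "((\<lambda>j. x ^ j * c j) has_sum 0) UNIV"
        proof (rule has_sum_SigmaD[OF S])
          fix j
          show "((\<lambda>Q. x ^ (snd (j, Q) $ k) * ?f (snd (j, Q))) has_sum x ^ j * c j) (?A j)"
          \<comment> \<open>For x^j = 0 the slice cannot be recovered from the family by division,
            but both sides are zero.\<close>
          proof (cases "x ^ j = 0")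
            case True
            hence xc: "x ^ j * c j = 0" by (simp only: mult_zero_left)
            show ?thesis unfolding xc
            proof (rule has_sum_0)
              fix Q assume "Q \<in> ?A j"
              hence "x ^ (Q $ k) = 0" using True by simp
              thus "x ^ (snd (j, Q) $ k) * ?f (snd (j, Q)) = 0" by (simp only: snd_conv mult_zero_left)
            qed
          next
            case False
            have "(\<lambda>(j, Q). x ^ (Q $ k) * ?f Q) summable_on (Sigma UNIV ?A)"
              using has_sum_imp_summable[OF S] by (simp add: case_prod_unfold)
            from summable_on_SigmaD1[OF this, of j]
            have "(\<lambda>Q. x ^ (Q $ k) * ?f Q) summable_on (?A j)" by simp
            also have "?this \<longleftrightarrow> (\<lambda>Q. x ^ j * ?f Q) summable_on (?A j)"
              by (intro summable_on_cong) auto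
            finally have "?f summable_on (?A j)"
              by (subst (asm) summable_on_cmult_right'[OF False])
            hence "((\<lambda>Q. x ^ j * ?f Q) has_sum x ^ j * c j) (?A j)"
              unfolding c_def by (intro has_sum_cmult_right has_sum_infsum)
            also have "?this \<longleftrightarrow> ?thesis" by (intro has_sum_cong) auto
            finally show ?thesis .
          qed
        qed
        hence "(\<lambda>j. x ^ j * c j) sums 0" by (rule has_sum_imp_sums)
        moreover have "(\<lambda>j. x ^ j * c j) = (\<lambda>j. c j * x ^ j)" by (intro ext mult.commute)
        ultimately show ?thesis by (simp only:)
      qed
      have c0: "c j = 0" for j by (rule power_series_zero[OF a(2) x])
      have "?f summable_on ?A (P $ k)"
      proof -
        text \<open>The value \<open>r / 2\<close> of the eliminated variable gives the convergence of its coefficients.\<close>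
        define w where "w = (\<chi> l. if l = k then of_real (r / 2) else z $ l)"
        have w: "\<forall>l. norm (w $ l) < r" using a(2) z by (simp add: w_def)
        have eq: "mcoeff a Q * (\<Prod>l\<in>- K. w $ l ^ (Q $ l)) = of_real (r / 2) ^ (Q $ k) * ?f Q" for Q
          unfolding w_def by (rule subst_eq)
        have "((\<lambda>Q. of_real (r / 2) ^ (Q $ k) * ?f Q) has_sum 0) {Q. \<forall>l\<in>K. Q $ l = P $ l}"
          using insert.IH[rule_format, OF w[rule_format], of P] by (simp only: eq)
        hence "(\<lambda>Q. of_real (r / 2) ^ (Q $ k) * ?f Q) summable_on {Q. \<forall>l\<in>K. Q $ l = P $ l}"
          by (rule has_sum_imp_summable)
        hence "(\<lambda>Q. of_real (r / 2) ^ (Q $ k) * ?f Q) summable_on ?A (P $ k)"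
          by (rule summable_on_subset_banach) auto
        also have "?this \<longleftrightarrow> (\<lambda>Q. of_real (r / 2) ^ (P $ k) * ?f Q) summable_on ?A (P $ k)"
          by (intro summable_on_cong) auto
        finally show ?thesis
          by (subst (asm) summable_on_cmult_right') (use a(2) in auto)
      qed
      hence "(?f has_sum c (P $ k)) (?A (P $ k))" unfolding c_def by (rule has_sum_infsum)
      hence "(?f has_sum 0) (?A (P $ k))" unfolding c0 .
      also have "?A (P $ k) = {Q. \<forall>l\<in>insert k K. Q $ l = P $ l}" by auto
      finally show "(?f has_sum 0) {Q. \<forall>l\<in>insert k K. Q $ l = P $ l}" .
    qed
  qed
  from this[of UNIV] have U: "\<forall>P (z :: complex ^ 'a). (\<forall>k. norm (z $ k) < r) \<longrightarrow>
    ((\<lambda>Q. mcoeff a Q) has_sum 0) {Q :: nat ^ 'a. \<forall>k. Q $ k = P $ k}" by simp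
  have "((\<lambda>Q. mcoeff a Q) has_sum 0) {P}" for P
  proof -
    have "{Q. \<forall>k. Q $ k = P $ k} = {P}" by (auto simp: vec_eq_iff)
    thus ?thesis using U[rule_format, of "0 :: complex ^ 'a" P] a(2) by simp
  qed
  hence "mcoeff a P = 0" for P by (auto simp: has_sum_finite_iff)
  thus ?thesis by (intro mfps_eqI) simp
qed

lemma expansion_unique:
  assumes "f has_mfps_expansion a" "f has_mfps_expansion b" shows "a = b"
proof -
  from has_expansion_diff[OF assms] have d: "(\<lambda>z. 0) has_mfps_expansion (a - b)" by simp
  then obtain r where r: "0 < r" "summable_at r (a - b)" and
    "\<forall>\<^sub>F z in nhds 0. 0 = meval (a - b) z" by (auto simp: has_mfps_expansion_iff)
  then obtain e where e: "0 < e" "\<And>z. norm z < e \<Longrightarrow> meval (a - b) z = 0"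
    by (auto simp: eventually_nhds_metric)
  \<comment> \<open>The polydisc of radius s lies in the ball of radius e.\<close>
  define s where "s = min r (e / real CARD('a))"
  have s: "0 < s" "s \<le> r" "s * real CARD('a) \<le> e" using r e by (auto simp: s_def min_def field_simps)
  have "a - b = 0"
  proof (rule meval_zero_imp_zero[OF summable_at_mono[OF r(2) _ s(2)] s(1)])
    show "0 \<le> s" using s by simp
    fix z :: "complex ^ 'a" assume z: "\<And>k. norm (z $ k) < s"
    have "norm z < (\<Sum>k\<in>(UNIV::'a set). s)"
      unfolding norm_vec_def by (rule le_less_trans[OF L2_set_le_sum sum_strict_mono]) (use z in auto)
    thus "meval (a - b) z = 0" using s by (intro e(2)) (simp add: mult.commute)
  qed
  thus ?thesis by simp
qed

lemma map_expansion_unique: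
  "map_has_expansion f a \<Longrightarrow> map_has_expansion f b \<Longrightarrow> a = b"
  by (auto simp: map_has_expansion_def vec_eq_iff intro: expansion_unique)

section \<open>Majorants with weights\<close>

text \<open>Truncation at degree D keeps the sum finite before any convergence is known. The
  exponent 0 is left out because the weights are controlled only off 0.\<close>

definition wnorm :: "real \<Rightarrow> (nat ^ 'n::finite \<Rightarrow> real) \<Rightarrow> nat \<Rightarrow> 'n mfps \<Rightarrow> real" where
  "wnorm t \<Delta> D f = (\<Sum>Q | Q \<noteq> 0 \<and> mdeg Q \<le> D. norm (mcoeff f Q) * t ^ mdeg Q / \<Delta> Q)"

lemma finite_mdeg_conj: "finite {P :: nat ^ 'n::finite. R P \<and> mdeg P \<le> d}"
  by (rule finite_subset[OF _ finite_mdeg_le[of d]]) auto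

text \<open>Terms with a factor of exponent \<open>0\<close> drop out, so degree \<open>D + 1\<close> of a product only involves
  degree \<open>D\<close> of the factors.\<close>

lemma wnorm_mult:
  fixes f g :: "'n::finite mfps"
  assumes \<Delta>: "\<And>Q. Q \<noteq> 0 \<Longrightarrow> 0 < \<Delta> Q" and t: "0 < t"
    and V: "\<And>Q. 0 \<le> V Q" "\<And>P Q. P \<noteq> 0 \<Longrightarrow> Q \<noteq> 0 \<Longrightarrow> V (P + Q) * (\<Delta> P * \<Delta> Q) \<le> \<Delta> (P + Q)"
    and fg: "mcoeff f 0 = 0" "mcoeff g 0 = 0"
  shows "(\<Sum>Q | Q \<noteq> 0 \<and> mdeg Q \<le> Suc D. V Q * (norm (mcoeff (f * g) Q) * t ^ mdeg Q / \<Delta> Q))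
    \<le> wnorm t \<Delta> D f * wnorm t \<Delta> D g"
proof -
  let ?A = "{Q :: nat ^ 'n. Q \<noteq> 0 \<and> mdeg Q \<le> D}" and ?B = "{Q :: nat ^ 'n. Q \<noteq> 0 \<and> mdeg Q \<le> Suc D}"
  let ?F = "\<lambda>f Q. norm (mcoeff f Q) * t ^ mdeg Q / \<Delta> Q"
  let ?m = "\<lambda>Q. {p \<in> msplit Q. fst p \<noteq> 0 \<and> snd p \<noteq> 0}"
  have F0: "0 \<le> ?F f Q" if "Q \<noteq> 0" for Q f using \<Delta>[OF that] t by simp
  have "V Q * ?F (f * g) Q \<le> (\<Sum>p\<in>?m Q. ?F f (fst p) * ?F g (snd p))" if Q: "Q \<in> ?B" for Q
  proof -
    have "norm (mcoeff (f * g) Q) = norm (\<Sum>p\<in>?m Q. mcoeff f (fst p) * mcoeff g (snd p))"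
      unfolding mcoeff_mult
      by (rule arg_cong[where f = norm], rule sum.mono_neutral_right) (use fg in auto)
    also have "\<dots> \<le> (\<Sum>p\<in>?m Q. norm (mcoeff f (fst p)) * norm (mcoeff g (snd p)))"
      by (rule order_trans[OF norm_sum]) (simp add: norm_mult)
    finally have "V Q * ?F (f * g) Q
        \<le> V Q * ((\<Sum>p\<in>?m Q. norm (mcoeff f (fst p)) * norm (mcoeff g (snd p))) * t ^ mdeg Q / \<Delta> Q)"
      using V(1) \<Delta>[of Q] Q t by (intro mult_left_mono divide_right_mono mult_right_mono) auto
    also have "\<dots> = (\<Sum>p\<in>?m Q. V Q / \<Delta> Q * (norm (mcoeff f (fst p)) * norm (mcoeff g (snd p)) * t ^ mdeg Q))"
      by (simp add: sum_distrib_left sum_distrib_right sum_divide_distrib)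
    also have "\<dots> \<le> (\<Sum>p\<in>?m Q. ?F f (fst p) * ?F g (snd p))"
    proof (rule sum_mono)
      fix p assume p: "p \<in> ?m Q"
      have pos: "0 < \<Delta> (fst p)" "0 < \<Delta> (snd p)" "0 < \<Delta> Q" and Qp: "Q = fst p + snd p"
        using p \<Delta> Q by (auto simp: msplit_def)
      \<comment> \<open>The weight of the total exponent pays for the factor
        \<open>V Q\<close>.\<close>
      have "V Q / \<Delta> Q \<le> 1 / (\<Delta> (fst p) * \<Delta> (snd p))"
        using V(2)[of "fst p" "snd p"] p pos unfolding Qp by (simp add: field_simps)
      hence "V Q / \<Delta> Q * (norm (mcoeff f (fst p)) * norm (mcoeff g (snd p)) * t ^ mdeg Q)
          \<le> 1 / (\<Delta> (fst p) * \<Delta> (snd p)) * (norm (mcoeff f (fst p)) * norm (mcoeff g (snd p)) * t ^ mdeg Q)"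
        using t by (intro mult_right_mono) auto
      also have "\<dots> = ?F f (fst p) * ?F g (snd p)"
        unfolding Qp by (simp add: mdeg_add power_add)
      finally show "V Q / \<Delta> Q * (norm (mcoeff f (fst p)) * norm (mcoeff g (snd p)) * t ^ mdeg Q)
          \<le> ?F f (fst p) * ?F g (snd p)" .
    qed
    finally show ?thesis .
  qed
  hence "(\<Sum>Q\<in>?B. V Q * ?F (f * g) Q) \<le> (\<Sum>Q\<in>?B. \<Sum>p\<in>?m Q. ?F f (fst p) * ?F g (snd p))"
    by (rule sum_mono)
  also have "\<dots> = (\<Sum>x\<in>Sigma ?B ?m. ?F f (fst (snd x)) * ?F g (snd (snd x)))"
    by (subst sum.Sigma) (auto simp: finite_mdeg_conj case_prod_unfold)
  also have "\<dots> = (\<Sum>p\<in>snd ` Sigma ?B ?m. ?F f (fst p) * ?F g (snd p))"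
    by (subst sum.reindex) (auto simp: inj_on_def msplit_def)
  also have "\<dots> \<le> (\<Sum>p\<in>?A \<times> ?A. ?F f (fst p) * ?F g (snd p))"
  proof (rule sum_mono2)
    show "snd ` Sigma ?B ?m \<subseteq> ?A \<times> ?A"
    proof
      fix p assume "p \<in> snd ` Sigma ?B ?m"
      hence p: "fst p \<noteq> 0" "snd p \<noteq> 0" "mdeg (fst p) + mdeg (snd p) \<le> Suc D"
        by (auto simp: msplit_def mdeg_add)
      thus "p \<in> ?A \<times> ?A" using mdeg_pos[OF p(1)] mdeg_pos[OF p(2)] by (cases p) auto
    qed
  next
    fix p assume "p \<in> ?A \<times> ?A - snd ` Sigma ?B ?m"
    hence "fst p \<noteq> 0" "snd p \<noteq> 0" by auto
    thus "0 \<le> ?F f (fst p) * ?F g (snd p)" using F0 by (intro mult_nonneg_nonneg) auto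
  qed (auto simp: finite_mdeg_conj)
  also have "\<dots> = wnorm t \<Delta> D f * wnorm t \<Delta> D g"
    by (simp add: wnorm_def sum_product sum.cartesian_product case_prod_unfold)
  finally show ?thesis .
qed

lemma wnorm_mono:
  assumes "\<And>Q. Q \<noteq> 0 \<Longrightarrow> 0 < \<Delta> Q" "0 < t" "D \<le> E"
  shows "wnorm t \<Delta> D f \<le> wnorm t \<Delta> E f"
  unfolding wnorm_def
  by (rule sum_mono2) (use assms in \<open>auto simp: finite_mdeg_conj intro!: divide_nonneg_pos mult_nonneg_nonneg\<close>)

lemma wnorm_nonneg:
  assumes "\<And>Q. Q \<noteq> 0 \<Longrightarrow> 0 < \<Delta> Q" "0 < t"
  shows "0 \<le> wnorm t \<Delta> D f"
  unfolding wnorm_def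
  by (rule sum_nonneg) (use assms in \<open>auto intro!: divide_nonneg_pos mult_nonneg_nonneg\<close>)

text \<open>\<open>V k Q\<close> stands for the inverse divisor at Q in component k, and \<Delta>
  for products of such factors. \<open>V_add\<close> lets \<Delta> absorb one factor V at every
  product; with both equal to 1 this is the classical majorant method, which serves for inverse
  maps.\<close>

locale weights =
  fixes \<Delta> :: "nat ^ 'n::finite \<Rightarrow> real" and V :: "'n \<Rightarrow> nat ^ 'n \<Rightarrow> real"
  assumes \<Delta>_pos: "\<And>Q. Q \<noteq> 0 \<Longrightarrow> 0 < \<Delta> Q"
    and \<Delta>_axis: "\<And>k. 1 \<le> \<Delta> (axis k 1)"
    and \<Delta>_add: "\<And>P Q. P \<noteq> 0 \<Longrightarrow> Q \<noteq> 0 \<Longrightarrow> \<Delta> P * \<Delta> Q \<le> \<Delta> (P + Q)"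
    and V_nonneg: "\<And>k Q. 0 \<le> V k Q"
    and V_add: "\<And>k P Q. P \<noteq> 0 \<Longrightarrow> Q \<noteq> 0 \<Longrightarrow> V k (P + Q) * (\<Delta> P * \<Delta> Q) \<le> \<Delta> (P + Q)"
begin

lemma wnorm_mpow:
  assumes "0 < t" "ord_pos \<psi>" "\<And>k. wnorm t \<Delta> D (\<psi> $ k) \<le> y" "P \<noteq> 0"
  shows "wnorm t \<Delta> D (mpow \<psi> P) \<le> y ^ mdeg P"
  using assms(4)
proof (induction P rule: multi_index_induct)
  case zero
  thus ?case by simp
next
  case (add P k)
  have y: "0 \<le> y"
    using order_trans[OF wnorm_nonneg assms(3)] \<Delta>_pos assms(1) by blast
  show ?case
  proof (cases "P = 0")
    case True
    thus ?thesis using assms(3) by simp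
  next
    case False
    have "wnorm t \<Delta> D (mpow \<psi> P * \<psi> $ k) \<le> wnorm t \<Delta> (Suc D) (mpow \<psi> P * \<psi> $ k)"
      by (rule wnorm_mono) (use \<Delta>_pos assms(1) in auto)
    also have "\<dots> \<le> wnorm t \<Delta> D (mpow \<psi> P) * wnorm t \<Delta> D (\<psi> $ k)"
      using wnorm_mult[of \<Delta> t "\<lambda>_. 1" "mpow \<psi> P" "\<psi> $ k" D] \<Delta>_pos \<Delta>_add assms(1)
        mcoeff_mpow_0[OF assms(2) False] assms(2)
      by (simp add: wnorm_def[of _ _ "Suc D"] ord_pos_def)
    also have "\<dots> \<le> y ^ mdeg P * y"
      using add(1)[OF False] assms(3)[of k] y wnorm_nonneg[of \<Delta> t] \<Delta>_pos assms(1)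
      by (intro mult_mono) auto
    finally show ?thesis by (simp add: mpow_add mdeg_add mult.commute)
  qed
qed

text \<open>The bound \<open>y = 2 t\<close> is chosen so that \<open>t + M (y / r)\<^sup>2 \<le> y\<close>.\<close>

lemma wnorm_majorant:
  assumes \<psi>: "ord_pos \<psi>" "\<And>k l. mcoeff (\<psi> $ k) (axis l 1) = (if k = l then 1 else 0)"
    and rec: "\<And>k Q. 2 \<le> mdeg Q \<Longrightarrow> norm (mcoeff (\<psi> $ k) Q) \<le>
      V k Q * (\<Sum>P | 2 \<le> mdeg P \<and> mdeg P \<le> mdeg Q. b k P * norm (mcoeff (mpow \<psi> P) Q))"
    and b: "\<And>k P. 0 \<le> b k P" "\<And>k D. (\<Sum>P | 2 \<le> mdeg P \<and> mdeg P \<le> D. b k P * r ^ mdeg P) \<le> M"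
    and t: "0 < t" "2 * t \<le> r" "4 * t * M \<le> r\<^sup>2"
  shows "wnorm t \<Delta> D (\<psi> $ k) \<le> 2 * t"
proof (induction D arbitrary: k)
  case 0
  have "{Q :: nat ^ 'n. Q \<noteq> 0 \<and> mdeg Q \<le> 0} = {}" by auto
  thus ?case using t by (simp only: wnorm_def sum.empty)
next
  case (Suc D)
  let ?C = "\<lambda>d. {Q :: nat ^ 'n. 2 \<le> mdeg Q \<and> mdeg Q \<le> d}"
  let ?F = "\<lambda>f Q. norm (mcoeff f Q) * t ^ mdeg Q / \<Delta> Q"
  have F0: "0 \<le> ?F f Q" if "Q \<noteq> 0" for Q f using \<Delta>_pos[OF that] t by simp
  have "{Q :: nat ^ 'n. Q \<noteq> 0 \<and> mdeg Q \<le> Suc D} \<subseteq> range (\<lambda>l. axis l 1) \<union> ?C (Suc D)"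
  proof
    fix Q :: "nat ^ 'n" assume Q: "Q \<in> {Q. Q \<noteq> 0 \<and> mdeg Q \<le> Suc D}"
    hence "mdeg Q = 1 \<or> 2 \<le> mdeg Q" using mdeg_pos[of Q] by auto
    thus "Q \<in> range (\<lambda>l. axis l 1) \<union> ?C (Suc D)" using Q mdeg_1_cases[of Q] by blast
  qed
  hence "wnorm t \<Delta> (Suc D) (\<psi> $ k) \<le> (\<Sum>Q\<in>range (\<lambda>l. axis l 1) \<union> ?C (Suc D). ?F (\<psi> $ k) Q)"
    unfolding wnorm_def by (intro sum_mono2) (auto simp: finite_mdeg_conj intro!: F0)
  also have "\<dots> = (\<Sum>Q\<in>range (\<lambda>l. axis l 1). ?F (\<psi> $ k) Q) + (\<Sum>Q\<in>?C (Suc D). ?F (\<psi> $ k) Q)"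
    by (rule sum.union_disjoint) (auto simp: finite_mdeg_conj)
  also have "(\<Sum>Q\<in>range (\<lambda>l. axis l 1). ?F (\<psi> $ k) Q) \<le> t"
  proof -
    have "(\<Sum>Q\<in>range (\<lambda>l. axis l 1). ?F (\<psi> $ k) Q)
        = (\<Sum>l\<in>UNIV. if k = l then t / \<Delta> (axis k 1) else 0)"
      by (subst sum.reindex, force simp: inj_on_def, intro sum.cong)
        (auto simp: \<psi>(2)[unfolded One_nat_def])
    also have "\<dots> = t / \<Delta> (axis k 1)" by simp
    also have "\<dots> \<le> t" using \<Delta>_axis[of k] t(1) mult_left_mono[of 1 "\<Delta> (axis k 1)" t]
      by (simp add: field_simps)
    finally show ?thesis .
  qed
  also have "(\<Sum>Q\<in>?C (Suc D). ?F (\<psi> $ k) Q) \<le> t"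
  proof -
    have "(\<Sum>Q\<in>?C (Suc D). ?F (\<psi> $ k) Q)
        \<le> (\<Sum>Q\<in>?C (Suc D). \<Sum>P\<in>?C (Suc D). b k P * (V k Q * ?F (mpow \<psi> P) Q))"
    proof (rule sum_mono)
      fix Q assume Q: "Q \<in> ?C (Suc D)"
      hence "Q \<noteq> 0" by auto
      have "?F (\<psi> $ k) Q \<le> V k Q * (\<Sum>P\<in>?C (mdeg Q). b k P * norm (mcoeff (mpow \<psi> P) Q))
          * t ^ mdeg Q / \<Delta> Q"
        using rec[of Q k] Q t \<Delta>_pos[OF \<open>Q \<noteq> 0\<close>] by (intro divide_right_mono mult_right_mono) auto
      also have "\<dots> = (\<Sum>P\<in>?C (mdeg Q). b k P * (V k Q * ?F (mpow \<psi> P) Q))"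
        by (simp add: sum_distrib_left sum_distrib_right sum_divide_distrib mult_ac)
      also have "\<dots> \<le> (\<Sum>P\<in>?C (Suc D). b k P * (V k Q * ?F (mpow \<psi> P) Q))"
      proof (rule sum_mono2)
        show "?C (mdeg Q) \<subseteq> ?C (Suc D)" using Q by auto
      qed (auto simp: finite_mdeg_conj intro: mult_nonneg_nonneg[OF b(1) mult_nonneg_nonneg[OF V_nonneg F0[OF \<open>Q \<noteq> 0\<close>]], simplified])
      finally show "?F (\<psi> $ k) Q \<le> (\<Sum>P\<in>?C (Suc D). b k P * (V k Q * ?F (mpow \<psi> P) Q))" .
    qed
    also have "\<dots> = (\<Sum>P\<in>?C (Suc D). b k P * (\<Sum>Q\<in>?C (Suc D). V k Q * ?F (mpow \<psi> P) Q))"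
      by (subst sum.swap) (simp add: sum_distrib_left)
    also have "\<dots> \<le> (\<Sum>P\<in>?C (Suc D). b k P * ((2 * t / r)\<^sup>2 * r ^ mdeg P))"
    proof (intro sum_mono mult_left_mono b(1))
      fix P assume P: "P \<in> ?C (Suc D)"
      hence "P \<noteq> 0" by auto
      \<comment> \<open>The factor V can be charged to one product only. It is the outermost one,
        \<open>mpow \<psi> R\<close> times \<open>\<psi> $ l\<close>; both of these are estimated
        without V, in degrees at most D.\<close>
      then obtain l R where PR: "P = R + axis l 1" by (rule nonzero_index_cases)
      hence R: "R \<noteq> 0" using P by auto
      have "(\<Sum>Q\<in>?C (Suc D). V k Q * ?F (mpow \<psi> P) Q)
          \<le> (\<Sum>Q | Q \<noteq> 0 \<and> mdeg Q \<le> Suc D. V k Q * ?F (mpow \<psi> R * \<psi> $ l) Q)"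
        unfolding PR mpow_add mpow_axis
      proof (rule sum_mono2)
        fix Q assume "Q \<in> {Q. Q \<noteq> 0 \<and> mdeg Q \<le> Suc D} - ?C (Suc D)"
        thus "0 \<le> V k Q * ?F (mpow \<psi> R * \<psi> $ l) Q" by (intro mult_nonneg_nonneg V_nonneg F0) auto
      qed (auto simp: finite_mdeg_conj)
      also have "\<dots> \<le> wnorm t \<Delta> D (mpow \<psi> R) * wnorm t \<Delta> D (\<psi> $ l)"
        by (rule wnorm_mult) (use \<Delta>_pos V_nonneg V_add t mcoeff_mpow_0[OF \<psi>(1) R] \<psi>(1) in
            \<open>auto simp: ord_pos_def\<close>)
      also have "\<dots> \<le> (2 * t) ^ mdeg R * (2 * t)"
        using wnorm_mpow[OF t(1) \<psi>(1) Suc R] Suc[of l] t \<Delta>_pos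
        by (intro mult_mono wnorm_nonneg) auto
      also have "\<dots> = (2 * t / r) ^ mdeg P * r ^ mdeg P"
        using t by (simp add: PR mdeg_add power_divide)
      \<comment> \<open>As |P| \<ge> 2 and 2 t \<le> r, two of the factors 2 t / r are kept; they
        make the nonlinear part quadratic in t.\<close>
      also have "\<dots> \<le> (2 * t / r)\<^sup>2 * r ^ mdeg P"
        using t P by (intro mult_right_mono power_decreasing) auto
      finally show "(\<Sum>Q\<in>?C (Suc D). V k Q * ?F (mpow \<psi> P) Q) \<le> (2 * t / r)\<^sup>2 * r ^ mdeg P" .
    qed
    also have "\<dots> = (2 * t / r)\<^sup>2 * (\<Sum>P\<in>?C (Suc D). b k P * r ^ mdeg P)"
      by (simp add: sum_distrib_left mult_ac)
    also have "\<dots> \<le> (2 * t / r)\<^sup>2 * M" by (intro mult_left_mono b(2)) auto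
    also have "\<dots> \<le> t"
      using t mult_left_mono[OF t(3), of t] by (simp add: field_simps power2_eq_square)
    finally show ?thesis .
  qed
  finally show ?case by simp
qed

text \<open>The bound on \<open>wnorm\<close> is uniform in the degree, and the weights grow at most
  like K^|Q|; dividing the radius t by K therefore removes them.\<close>

lemma convergent_majorant:
  assumes \<psi>: "ord_pos \<psi>" "\<And>k l. mcoeff (\<psi> $ k) (axis l 1) = (if k = l then 1 else 0)"
    and rec: "\<And>k Q. 2 \<le> mdeg Q \<Longrightarrow> norm (mcoeff (\<psi> $ k) Q) \<le>
      V k Q * (\<Sum>P | 2 \<le> mdeg P \<and> mdeg P \<le> mdeg Q. b k P * norm (mcoeff (mpow \<psi> P) Q))"
    and b: "\<And>k P. 0 \<le> b k P" "\<And>k. \<exists>r>0. (\<lambda>P. b k P * r ^ mdeg P) summable_on UNIV"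
    and K: "0 < K" "\<And>Q. Q \<noteq> 0 \<Longrightarrow> \<Delta> Q \<le> K ^ mdeg Q"
  shows "\<psi> $ k \<in> convergent_mfps"
proof -
  have "\<exists>r>0. \<forall>k. (\<lambda>P. b k P * r ^ mdeg P) summable_on UNIV"
  proof (rule exists_small_radius)
    fix k
    obtain r where r: "0 < r" "(\<lambda>P. b k P * r ^ mdeg P) summable_on UNIV" using b(2) by blast
    have "(\<lambda>P. b k P * s ^ mdeg P) summable_on UNIV" if "0 < s" "s \<le> r" for s
      by (rule summable_on_comparison_test[OF r(2)])
        (use that b(1) in \<open>auto intro!: mult_left_mono power_mono\<close>)
    thus "\<exists>r>0. \<forall>s. 0 < s \<longrightarrow> s \<le> r \<longrightarrow> (\<lambda>P. b k P * s ^ mdeg P) summable_on UNIV"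
      using r(1) by blast
  qed
  then obtain r where r: "0 < r" "\<And>k. (\<lambda>P. b k P * r ^ mdeg P) summable_on UNIV" by blast
  define M where "M = (\<Sum>k\<in>UNIV. \<Sum>\<^sub>\<infinity>P. b k P * r ^ mdeg P)"
  have M: "(\<Sum>P | 2 \<le> mdeg P \<and> mdeg P \<le> D. b k P * r ^ mdeg P) \<le> M" for k D
  proof -
    have "(\<Sum>P | 2 \<le> mdeg P \<and> mdeg P \<le> D. b k P * r ^ mdeg P) \<le> (\<Sum>\<^sub>\<infinity>P. b k P * r ^ mdeg P)"
      by (rule finite_sum_le_infsum[OF r(2)]) (use b(1) r(1) in \<open>auto simp: finite_mdeg_conj\<close>)
    also have "\<dots> \<le> M" unfolding M_def
      by (rule member_le_sum) (use b(1) r(1) in \<open>auto intro!: infsum_nonneg\<close>)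
    finally show ?thesis .
  qed
  have M0: "0 \<le> M" unfolding M_def using b(1) r(1) by (intro sum_nonneg infsum_nonneg) auto
  \<comment> \<open>The first entry gives 2 t \<le> r, the second 4 t M \<le> r^2; M + 1 replaces M
    because M may be 0.\<close>
  define t where "t = min (r / 2) (r\<^sup>2 / (4 * (M + 1)))"
  have t: "0 < t" "2 * t \<le> r" "4 * t * M \<le> r\<^sup>2"
  proof -
    show "0 < t" "2 * t \<le> r" using r(1) M0 by (auto simp: t_def)
    have "t * (4 * M) \<le> r\<^sup>2 / (4 * (M + 1)) * (4 * (M + 1))"
      by (rule mult_mono) (use M0 in \<open>auto simp: t_def\<close>)
    thus "4 * t * M \<le> r\<^sup>2" using M0 by (simp add: mult_ac)
  qed
  have "(\<lambda>Q. norm (mcoeff (\<psi> $ k) Q) * (t / K) ^ mdeg Q) summable_on UNIV"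
  proof (rule nonneg_bdd_above_summable_on)
    show "bdd_above (sum (\<lambda>Q. norm (mcoeff (\<psi> $ k) Q) * (t / K) ^ mdeg Q) ` {F. F \<subseteq> UNIV \<and> finite F})"
    proof (rule bdd_aboveI2)
      fix F :: "(nat ^ 'n) set" assume "F \<in> {F. F \<subseteq> UNIV \<and> finite F}"
      hence F: "finite F" by simp
      have "(\<Sum>Q\<in>F. norm (mcoeff (\<psi> $ k) Q) * (t / K) ^ mdeg Q)
          = (\<Sum>Q\<in>F - {0}. norm (mcoeff (\<psi> $ k) Q) * (t / K) ^ mdeg Q)"
        by (rule sum.mono_neutral_right) (use F \<psi>(1) in \<open>auto simp: ord_pos_def\<close>)
      also have "\<dots> \<le> (\<Sum>Q\<in>F - {0}. norm (mcoeff (\<psi> $ k) Q) * t ^ mdeg Q / \<Delta> Q)"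
      proof (rule sum_mono)
        fix Q assume "Q \<in> F - {0}"
        hence "0 < \<Delta> Q" "\<Delta> Q \<le> K ^ mdeg Q" using K(2) \<Delta>_pos by auto
        hence "norm (mcoeff (\<psi> $ k) Q) * t ^ mdeg Q / K ^ mdeg Q
            \<le> norm (mcoeff (\<psi> $ k) Q) * t ^ mdeg Q / \<Delta> Q"
          using t(1) by (intro divide_left_mono) auto
        thus "norm (mcoeff (\<psi> $ k) Q) * (t / K) ^ mdeg Q
            \<le> norm (mcoeff (\<psi> $ k) Q) * t ^ mdeg Q / \<Delta> Q" by (simp add: power_divide)
      qed
      also have "\<dots> \<le> wnorm t \<Delta> (\<Sum>Q\<in>F. mdeg Q) (\<psi> $ k)"
        unfolding wnorm_def
      proof (rule sum_mono2)
        show "F - {0} \<subseteq> {Q. Q \<noteq> 0 \<and> mdeg Q \<le> (\<Sum>Q\<in>F. mdeg Q)}"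
          using F by (auto intro: member_le_sum)
      qed (use t(1) \<Delta>_pos in \<open>auto simp: finite_mdeg_conj intro!: divide_nonneg_pos mult_nonneg_nonneg\<close>)
      also have "\<dots> \<le> 2 * t" by (rule wnorm_majorant[OF \<psi> rec b(1) M t])
      finally show "(\<Sum>Q\<in>F. norm (mcoeff (\<psi> $ k) Q) * (t / K) ^ mdeg Q) \<le> 2 * t" .
    qed
  qed (use t(1) K(1) in auto)
  thus ?thesis unfolding convergent_mfps_iff summable_at_def using t(1) K(1)
    by (intro exI[of _ "t / K"]) auto
qed

end

section \<open>Products of small divisors\<close>

text \<open>The coefficients of the linearization are sums over trees, whose nodes carry a label and an
  exponent; \<open>divisor_tree N Q w\<close> says that \<open>w\<close> lists the nodes that contribute a divisor in a tree
  (or a forest) with total exponent \<open>Q\<close>.\<close>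

inductive divisor_tree :: "(nat ^ 'n::finite) set \<Rightarrow> nat ^ 'n \<Rightarrow> ('n \<times> (nat ^ 'n)) list \<Rightarrow> bool"
  for N where
    leaf: "divisor_tree N (axis k 1) []"
  | join: "divisor_tree N P v \<Longrightarrow> divisor_tree N Q w \<Longrightarrow> divisor_tree N (P + Q) (v @ w)"
  | node: "divisor_tree N P v \<Longrightarrow> divisor_tree N Q w \<Longrightarrow> P + Q \<in> N \<Longrightarrow>
      divisor_tree N (P + Q) ((k, P + Q) # v @ w)"

lemma divisor_tree_nonzero: "divisor_tree N Q w \<Longrightarrow> Q \<noteq> 0"
  by (induction rule: divisor_tree.induct) (auto simp: add_eq_0_index)

text \<open>A tree of total exponent Q has |Q| leaves, and a binary tree has fewer inner nodes than
  leaves.\<close>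

lemma divisor_tree_length: "divisor_tree N Q w \<Longrightarrow> length w < mdeg Q"
  by (induction rule: divisor_tree.induct) (auto simp: mdeg_add)

lemma divisor_tree_nodes:
  "divisor_tree N Q w \<Longrightarrow> set w \<subseteq> UNIV \<times> {P \<in> N. 2 \<le> mdeg P \<and> mdeg P \<le> mdeg Q}"
proof (induction rule: divisor_tree.induct)
  case (join P v Q w)
  thus ?case by (fastforce simp: mdeg_add)
next
  case (node P v Q w k)
  have "0 < mdeg P" "0 < mdeg Q" using node(1,2) by (auto dest!: divisor_tree_nonzero intro: mdeg_pos)
  thus ?case using node by (fastforce simp: mdeg_add)
qed simp

lemma ex_divisor_tree: "Q \<noteq> 0 \<Longrightarrow> \<exists>w. divisor_tree N Q w"
proof (induction Q rule: multi_index_induct)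
  case (add Q k)
  thus ?case using leaf[of N k] join by (cases "Q = 0") fastforce+
qed simp

lemma finite_divisor_trees: "finite {w. divisor_tree N Q w}"
proof (rule finite_subset)
  show "{w. divisor_tree N Q w} \<subseteq> {w. set w \<subseteq> UNIV \<times> {P. mdeg P \<le> mdeg Q} \<and> length w \<le> mdeg Q}"
    using divisor_tree_nodes divisor_tree_length by fastforce
qed (intro finite_lists_length_le finite_cartesian_product finite_mdeg_le finite)

text \<open>If both counts are positive, their bounds lose 1 each, which leaves room for a further
  node above. If one count is 0, the bound for the other subtree suffices: the exponent of the first
  becomes part of the remainder R.\<close>

lemma count_join:
  fixes q :: real
  assumes q: "0 < q"
    and P: "(a = 0 \<or> a \<le> 2 * real (mdeg P) / q - 1) \<and>
      (\<forall>R. R \<noteq> 0 \<longrightarrow> P + R \<in> N \<longrightarrow> bad (P + R) \<longrightarrow> a + 1 \<le> 2 * real (mdeg (P + R)) / q - 1)"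
    and Q: "(b = 0 \<or> b \<le> 2 * real (mdeg Q) / q - 1) \<and>
      (\<forall>R. R \<noteq> 0 \<longrightarrow> Q + R \<in> N \<longrightarrow> bad (Q + R) \<longrightarrow> b + 1 \<le> 2 * real (mdeg (Q + R)) / q - 1)"
    and nz: "P \<noteq> 0" "Q \<noteq> 0"
  shows "a + b = 0 \<or> a + b \<le> 2 * real (mdeg (P + Q)) / q - 1"
    and "P + Q + R \<in> N \<Longrightarrow> bad (P + Q + R) \<Longrightarrow> a + b + 1 \<le> 2 * real (mdeg (P + Q + R)) / q - 1"
proof -
  have d: "2 * real (mdeg (X + Y)) / q = 2 * real (mdeg X) / q + 2 * real (mdeg Y) / q" for X Y :: "nat ^ 'a"
    by (simp add: mdeg_add add_divide_distrib ring_distribs)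
  have ge: "0 \<le> 2 * real (mdeg X) / q" for X :: "nat ^ 'a" using q by simp
  show "a + b = 0 \<or> a + b \<le> 2 * real (mdeg (P + Q)) / q - 1"
    using P Q ge[of P] ge[of Q] unfolding d by linarith
  assume R: "P + Q + R \<in> N" "bad (P + Q + R)"
  show "a + b + 1 \<le> 2 * real (mdeg (P + Q + R)) / q - 1"
  proof (cases "a = 0 \<or> b = 0")
    case True
    have "P + (Q + R) = P + Q + R" "Q + (P + R) = P + Q + R" by (simp_all add: add_ac)
    moreover have "Q + R \<noteq> 0" "P + R \<noteq> 0" using nz by (auto simp: add_eq_0_index)
    ultimately have "a + 1 \<le> 2 * real (mdeg (P + Q + R)) / q - 1" "b + 1 \<le> 2 * real (mdeg (P + Q + R)) / q - 1"
      using P Q R by metis+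
    thus ?thesis using True by auto
  next
    case False
    thus ?thesis using P Q ge[of R] unfolding d by linarith
  qed
qed

text \<open>Two comparable nodes with the same label and a small divisor are far apart (hypothesis
  \<open>gap\<close>), hence there are few of them. The second half of the claim makes the induction work: it
  accounts for a further such node above the tree.\<close>

lemma divisor_tree_count:
  fixes q :: real and bad :: "nat ^ 'n::finite \<Rightarrow> bool" and l :: 'n
  assumes q: "0 < q"
    and large: "\<And>Q. Q \<in> N \<Longrightarrow> 2 \<le> mdeg Q \<Longrightarrow> bad Q \<Longrightarrow> q < mdeg Q"
    and gap: "\<And>P R. P + R \<in> N \<Longrightarrow> 2 \<le> mdeg P \<Longrightarrow> R \<noteq> 0 \<Longrightarrow> bad P \<Longrightarrow> bad (P + R) \<Longrightarrow> q \<le> mdeg R"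
    and tree: "divisor_tree N Q w"
  defines "c \<equiv> \<lambda>w :: ('n \<times> (nat ^ 'n)) list. real (length (filter (\<lambda>(k, Q). k = l \<and> bad Q) w))"
  shows "(c w = 0 \<or> c w \<le> 2 * real (mdeg Q) / q - 1) \<and>
    (\<forall>R. R \<noteq> 0 \<longrightarrow> Q + R \<in> N \<longrightarrow> bad (Q + R) \<longrightarrow> c w + 1 \<le> 2 * real (mdeg (Q + R)) / q - 1)"
    (is "?A Q (c w) \<and> ?B Q (c w)")
  using tree
proof (induction rule: divisor_tree.induct)
  case (leaf k)
  have "0 + 1 \<le> 2 * real (mdeg (axis k 1 + R)) / q - 1"
    if "R \<noteq> 0" "axis k 1 + R \<in> N" "bad (axis k 1 + R)" for R
  proof -
    \<comment> \<open>A single bad node has degree d above q, so that 2 d / q - 1 exceeds 1; this is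
      the reason for the factor 2.\<close>
    have "q < mdeg (axis k 1 + R)"
      by (rule large) (use that mdeg_pos[OF that(1)] in \<open>auto simp: mdeg_add\<close>)
    thus ?thesis using q by (simp add: field_simps)
  qed
  thus ?case by (simp add: c_def)
next
  case (join P v Q w)
  have "?A (P + Q) (c v + c w)" and "\<And>R. P + Q + R \<in> N \<Longrightarrow> bad (P + Q + R) \<Longrightarrow>
      c v + c w + 1 \<le> 2 * real (mdeg (P + Q + R)) / q - 1"
    using count_join[OF q join(3,4)] divisor_tree_nonzero[OF join(1)] divisor_tree_nonzero[OF join(2)]
    by blast+
  moreover have "c (v @ w) = c v + c w" by (simp add: c_def)
  ultimately show ?case by simp
next
  case (node P v Q w k)
  have A: "?A (P + Q) (c v + c w)" and B: "\<And>R. P + Q + R \<in> N \<Longrightarrow> bad (P + Q + R) \<Longrightarrow>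
      c v + c w + 1 \<le> 2 * real (mdeg (P + Q + R)) / q - 1"
    using count_join[OF q node(4,5)] divisor_tree_nonzero[OF node(1)] divisor_tree_nonzero[OF node(2)]
    by blast+
  show ?case
  proof (cases "k = l \<and> bad (P + Q)")
    case False
    hence "c ((k, P + Q) # v @ w) = c v + c w" by (auto simp: c_def)
    thus ?thesis using A B by simp
  next
    case True
    hence c: "c ((k, P + Q) # v @ w) = c v + c w + 1" by (simp add: c_def)
    have deg: "2 \<le> mdeg (P + Q)"
      using mdeg_pos[OF divisor_tree_nonzero[OF node(1)]] mdeg_pos[OF divisor_tree_nonzero[OF node(2)]]
      by (simp add: mdeg_add)
    \<comment> \<open>The node lies above the two joined subtrees. R = 0 is admissible in
      \<open>B\<close> because, seen from either subtree, the other one is a nonzero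
      remainder.\<close>
    have A': "c v + c w + 1 \<le> 2 * real (mdeg (P + Q)) / q - 1"
      using B[of 0] True node(3) by simp
    have "c v + c w + 1 + 1 \<le> 2 * real (mdeg (P + Q + R)) / q - 1"
      if R: "R \<noteq> 0" "P + Q + R \<in> N" "bad (P + Q + R)" for R
    proof -
      \<comment> \<open>The next bad node above is larger by at least q, which raises the bound by
        at least 2.\<close>
      have "q \<le> mdeg R" by (rule gap[OF R(2) deg R(1)]) (use True R(3) in auto)
      hence "2 \<le> 2 * real (mdeg R) / q" using q by (simp add: field_simps)
      thus ?thesis using A' by (simp add: mdeg_add add_divide_distrib ring_distribs)
    qed
    thus ?thesis unfolding c using A' by blast
  qed
qed


lemma sum_list_sum_swap:
  "(\<Sum>x\<leftarrow>w. \<Sum>m\<in>A. h m x) = (\<Sum>m\<in>A. \<Sum>x\<leftarrow>w. h m x :: 'a::comm_monoid_add)"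
  by (induction w) (auto simp: sum.distrib)

lemma sum_list_indicator:
  "(\<Sum>x\<leftarrow>w. if P x then a else 0) = real (length (filter P w)) * a"
  by (induction w) (auto simp: algebra_simps)

lemma length_filter_labels:
  fixes w :: "('n::finite \<times> 'b) list"
  shows "length (filter (\<lambda>(k, Q). P k Q) w) = (\<Sum>l\<in>UNIV. length (filter (\<lambda>(k, Q). k = l \<and> P l Q) w))"
proof (induction w)
  case (Cons x w)
  obtain k Q where x: "x = (k, Q)" by (cases x)
  have "(\<Sum>l\<in>UNIV. length (filter (\<lambda>(k, Q). k = l \<and> P l Q) (x # w)))
      = (\<Sum>l\<in>UNIV. (if l = k then if P k Q then 1 else 0 else 0)
          + length (filter (\<lambda>(k, Q). k = l \<and> P l Q) w))"
    unfolding x by (rule sum.cong) auto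
  thus ?case using Cons by (simp add: sum.distrib x)
qed simp

text \<open>\<open>\<theta> m\<close> is the threshold for the dyadic degree 2^m. A divisor below
  \<open>\<theta> m\<close> but not below \<open>\<theta> (Suc m)\<close> costs at most
  \<open>- ln (\<theta> (Suc m))\<close>, and the nodes below \<open>\<theta> m\<close> number at
  most a multiple of |Q| / 2^m: hence the shift of the index in
  \<open>summable_\<theta>\<close>.\<close>

locale small_divisor_bounds =
  fixes N :: "(nat ^ 'n::finite) set" and \<delta> :: "'n \<Rightarrow> nat ^ 'n \<Rightarrow> real" and \<theta> :: "nat \<Rightarrow> real"
  assumes \<delta>_pos: "\<And>k Q. Q \<in> N \<Longrightarrow> 2 \<le> mdeg Q \<Longrightarrow> 0 < \<delta> k Q"
    and \<theta>_pos: "\<And>m. 0 < \<theta> m" and \<theta>_le_1: "\<And>m. \<theta> m \<le> 1"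
    and large: "\<And>k Q m. Q \<in> N \<Longrightarrow> 2 \<le> mdeg Q \<Longrightarrow> \<delta> k Q < \<theta> m \<Longrightarrow> 2 ^ m < mdeg Q"
    and gap: "\<And>k P R m. P + R \<in> N \<Longrightarrow> 2 \<le> mdeg P \<Longrightarrow> R \<noteq> 0 \<Longrightarrow> \<delta> k P < \<theta> m \<Longrightarrow>
      \<delta> k (P + R) < \<theta> m \<Longrightarrow> 2 ^ m \<le> mdeg R"
    and summable_\<theta>: "summable (\<lambda>m. - ln (\<theta> (Suc m)) / 2 ^ m)"
begin

text \<open>Divisors above 1 count as 1, so that no node lowers the weight of a tree.\<close>

definition node_weight :: "'n \<times> (nat ^ 'n) \<Rightarrow> real" where
  "node_weight = (\<lambda>(k, Q). max 1 (1 / \<delta> k Q))"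

definition tree_weight :: "('n \<times> (nat ^ 'n)) list \<Rightarrow> real" where
  "tree_weight w = prod_list (map node_weight w)"

text \<open>Only the worst tree is recorded; the number of trees is accounted for by the majorant
  series.\<close>

definition max_weight :: "nat ^ 'n \<Rightarrow> real" where
  "max_weight Q = Max (tree_weight ` {w. divisor_tree N Q w})"

lemma node_weight_ge_1: "1 \<le> node_weight x"
  by (simp add: node_weight_def split: prod.split)

lemma tree_weight_ge_1: "1 \<le> tree_weight w"
proof (induction w)
  case (Cons x w)
  have "1 * 1 \<le> node_weight x * tree_weight w"
    using node_weight_ge_1[of x] Cons by (intro mult_mono) linarith+
  thus ?case by (simp add: tree_weight_def)
qed (simp add: tree_weight_def)

lemma max_weight_attained:
  assumes "Q \<noteq> 0" obtains w where "divisor_tree N Q w" "max_weight Q = tree_weight w"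
proof -
  have "max_weight Q \<in> tree_weight ` {w. divisor_tree N Q w}"
    unfolding max_weight_def
    by (rule Max_in) (use finite_divisor_trees ex_divisor_tree[OF assms] in auto)
  thus thesis using that by auto
qed

lemma tree_weight_le_max: "divisor_tree N Q w \<Longrightarrow> tree_weight w \<le> max_weight Q"
  unfolding max_weight_def by (rule Max_ge) (auto simp: finite_divisor_trees)

lemma max_weight_ge_1: "Q \<noteq> 0 \<Longrightarrow> 1 \<le> max_weight Q"
  using tree_weight_ge_1 max_weight_attained by metis

text \<open>Optimal trees for P and Q, joined or put under a new node, are trees for P + Q. This is
  how the weight absorbs a divisor.\<close>

lemma max_weight_add:
  assumes "P \<noteq> 0" "Q \<noteq> 0"
  shows "max_weight P * max_weight Q \<le> max_weight (P + Q)"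
    and "P + Q \<in> N \<Longrightarrow> node_weight (k, P + Q) * (max_weight P * max_weight Q) \<le> max_weight (P + Q)"
proof -
  obtain v w where v: "divisor_tree N P v" "max_weight P = tree_weight v"
    and w: "divisor_tree N Q w" "max_weight Q = tree_weight w"
    using max_weight_attained assms by metis
  show "max_weight P * max_weight Q \<le> max_weight (P + Q)"
    using tree_weight_le_max[OF divisor_tree.join[OF v(1) w(1)]] by (simp add: v(2) w(2) tree_weight_def)
  show "node_weight (k, P + Q) * (max_weight P * max_weight Q) \<le> max_weight (P + Q)" if "P + Q \<in> N"
    using tree_weight_le_max[OF divisor_tree.node[OF v(1) w(1) that, of k]]
    by (simp add: v(2) w(2) tree_weight_def)
qed

lemma ln_\<theta>: "0 \<le> - ln (\<theta> m)"
  using ln_le_zero_iff[OF \<theta>_pos] \<theta>_le_1[of m] by simp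

text \<open>Let m be the first index whose threshold the divisor reaches; it is at most L by
  \<open>large\<close>. The weight is then at most 1 / \<open>\<theta> m\<close>. If m is positive,
  the term of the previous index, where the divisor is still below the threshold, pays for it; the
  leading term covers m = 0. All other terms are nonnegative.\<close>

lemma ln_node_weight:
  assumes "P \<in> N" "2 \<le> mdeg P" "mdeg P \<le> 2 ^ L"
  shows "ln (node_weight (k, P)) \<le> - ln (\<theta> 0) + (\<Sum>m<L. if \<delta> k P < \<theta> m then - ln (\<theta> (Suc m)) else 0)"
proof -
  have le: "ln (node_weight (k, P)) \<le> - ln (\<theta> m)" if "\<theta> m \<le> \<delta> k P" for m
  proof -
    have "node_weight (k, P) \<le> 1 / \<theta> m"
      using that \<theta>_pos[of m] \<theta>_le_1[of m] by (auto simp: node_weight_def field_simps)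
    moreover have "0 < node_weight (k, P)" using node_weight_ge_1[of "(k, P)"] by linarith
    ultimately have "ln (node_weight (k, P)) \<le> ln (1 / \<theta> m)" by (simp add: \<theta>_pos)
    thus ?thesis using \<theta>_pos[of m] by (simp add: ln_div)
  qed
  have nn: "0 \<le> (if \<delta> k P < \<theta> m then - ln (\<theta> (Suc m)) else 0)" for m using ln_\<theta> by simp
  have ex: "\<theta> L \<le> \<delta> k P" using large[OF assms(1,2), of k L] assms(3) by linarith
  define m where "m = (LEAST m. \<theta> m \<le> \<delta> k P)"
  have m1: "\<theta> m \<le> \<delta> k P" unfolding m_def by (rule LeastI[where P = "\<lambda>m. \<theta> m \<le> \<delta> k P", OF ex])
  have m2: "m \<le> L" unfolding m_def by (rule Least_le[where P = "\<lambda>m. \<theta> m \<le> \<delta> k P", OF ex])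
  have m3: "\<delta> k P < \<theta> i" if "i < m" for i
    using not_less_Least[of i "\<lambda>m. \<theta> m \<le> \<delta> k P"] that unfolding m_def by linarith
  show ?thesis
  proof (cases m)
    case 0
    have "0 \<le> (\<Sum>m<L. if \<delta> k P < \<theta> m then - ln (\<theta> (Suc m)) else 0)"
      by (rule sum_nonneg) (rule nn)
    thus ?thesis using le[OF m1] unfolding 0 by linarith
  next
    case (Suc i)
    have "ln (node_weight (k, P)) \<le> (if \<delta> k P < \<theta> i then - ln (\<theta> (Suc i)) else 0)"
      using le[OF m1] m3[of i] Suc by simp
    also have "\<dots> \<le> (\<Sum>m<L. if \<delta> k P < \<theta> m then - ln (\<theta> (Suc m)) else 0)"
    proof (rule member_le_sum)
      show "i \<in> {..<L}" using Suc m2 by simp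
    qed (use nn in auto)
    finally show ?thesis using ln_\<theta>[of 0] by linarith
  qed
qed

text \<open>The logarithm of the weight is summed scale by scale. \<open>divisor_tree_count\<close>
  with q = 2^m leaves at most 2 |Q| / 2^m nodes of each label below \<open>\<theta> m\<close>, and
  there are \<open>CARD('n)\<close> labels; the first term of \<open>?\<beta>\<close> comes from the
  fewer than |Q| nodes in all.\<close>

lemma max_weight_exponential:
  "\<exists>K>0. \<forall>Q. Q \<noteq> 0 \<longrightarrow> max_weight Q \<le> K ^ mdeg Q"
proof (intro exI conjI allI impI)
  let ?\<beta> = "- ln (\<theta> 0) + 2 * real CARD('n) * (\<Sum>m. - ln (\<theta> (Suc m)) / 2 ^ m)"
  fix Q :: "nat ^ 'n" assume "Q \<noteq> 0"
  then obtain w where w: "divisor_tree N Q w" "max_weight Q = tree_weight w"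
    using max_weight_attained by blast
  \<comment> \<open>Any L with |Q| \<le> 2^L serves, as only partial sums of a convergent series are
    used.\<close>
  define L where "L = mdeg Q"
  have L: "mdeg Q \<le> 2 ^ L" unfolding L_def by (rule less_imp_le) (rule less_exp)
  have nodes: "P \<in> N" "2 \<le> mdeg P" "mdeg P \<le> 2 ^ L" if "(k, P) \<in> set w" for k P
    using divisor_tree_nodes[OF w(1)] that L by auto
  have count: "real (length (filter (\<lambda>(k, P). \<delta> k P < \<theta> m) w)) \<le> 2 * real CARD('n) * mdeg Q / 2 ^ m" for m
  proof -
    have "real (length (filter (\<lambda>(k, P). k = l \<and> \<delta> l P < \<theta> m) w)) \<le> 2 * real (mdeg Q) / 2 ^ m" for l
    proof -
      have "real (length (filter (\<lambda>(k, P). k = l \<and> \<delta> l P < \<theta> m) w)) = 0 \<or>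
        real (length (filter (\<lambda>(k, P). k = l \<and> \<delta> l P < \<theta> m) w)) \<le> 2 * real (mdeg Q) / 2 ^ m - 1"
      proof (rule conjunct1[OF divisor_tree_count[OF _ _ _ w(1)]])
        show "2 ^ m < real (mdeg Q)" if "Q \<in> N" "2 \<le> mdeg Q" "\<delta> l Q < \<theta> m" for Q
          using large[OF that] by (metis of_nat_less_iff of_nat_numeral of_nat_power)
        show "2 ^ m \<le> real (mdeg R)"
          if "P + R \<in> N" "2 \<le> mdeg P" "R \<noteq> 0" "\<delta> l P < \<theta> m" "\<delta> l (P + R) < \<theta> m" for P R
          using gap[OF that] by (metis of_nat_le_iff of_nat_numeral of_nat_power)
      qed simp
      moreover have "0 \<le> 2 * real (mdeg Q) / 2 ^ m" by simp
      ultimately show ?thesis by linarith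
    qed
    hence "(\<Sum>l\<in>(UNIV :: 'n set). real (length (filter (\<lambda>(k, P). k = l \<and> \<delta> l P < \<theta> m) w)))
        \<le> (\<Sum>l\<in>(UNIV :: 'n set). 2 * real (mdeg Q) / 2 ^ m)" by (rule sum_mono)
    thus ?thesis unfolding length_filter_labels[of "\<lambda>k P. \<delta> k P < \<theta> m"] by (simp add: mult_ac)
  qed
  have "ln (tree_weight w) = (\<Sum>x\<leftarrow>w. ln (node_weight x))"
  proof (induction w)
    case (Cons x w)
    have "0 < node_weight x" "0 < tree_weight w"
      using node_weight_ge_1[of x] tree_weight_ge_1[of w] by linarith+
    thus ?case using Cons by (simp add: tree_weight_def ln_mult)
  qed (simp add: tree_weight_def)
  also have "\<dots> \<le> (\<Sum>x\<leftarrow>w. - ln (\<theta> 0)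
      + (\<Sum>m<L. if (\<lambda>(k, P). \<delta> k P < \<theta> m) x then - ln (\<theta> (Suc m)) else 0))"
    by (rule sum_list_mono) (use ln_node_weight nodes in auto)
  also have "\<dots> = real (length w) * - ln (\<theta> 0)
      + (\<Sum>m<L. real (length (filter (\<lambda>(k, P). \<delta> k P < \<theta> m) w)) * - ln (\<theta> (Suc m)))"
    by (simp only: sum_list_addf sum_list_sum_swap sum_list_indicator sum_list_triv)
  also have "\<dots> \<le> mdeg Q * - ln (\<theta> 0)
      + (\<Sum>m<L. 2 * real CARD('n) * mdeg Q / 2 ^ m * - ln (\<theta> (Suc m)))"
    using divisor_tree_length[OF w(1)] ln_\<theta> count
    by (intro add_mono mult_right_mono sum_mono) auto
  also have "(\<Sum>m<L. 2 * real CARD('n) * mdeg Q / 2 ^ m * - ln (\<theta> (Suc m)))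
      = 2 * real CARD('n) * mdeg Q * (\<Sum>m<L. - ln (\<theta> (Suc m)) / 2 ^ m)"
    by (simp add: sum_distrib_left)
  also have "\<dots> \<le> 2 * real CARD('n) * mdeg Q * (\<Sum>m. - ln (\<theta> (Suc m)) / 2 ^ m)"
    by (intro mult_left_mono sum_le_suminf summable_\<theta>) (use ln_\<theta> in \<open>auto intro: divide_nonpos_pos\<close>)
  finally have "ln (tree_weight w) \<le> mdeg Q * ?\<beta>" by (simp add: algebra_simps)
  moreover have "0 < tree_weight w" using tree_weight_ge_1[of w] by linarith
  ultimately have "tree_weight w \<le> exp (mdeg Q * ?\<beta>)" by (simp add: ln_le_cancel_iff[symmetric] del: ln_le_cancel_iff)
  thus "max_weight Q \<le> exp ?\<beta> ^ mdeg Q" by (simp add: w(2) exp_of_nat_mult)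
qed simp

end

section \<open>Inverse series\<close>

definition tangent_id :: "'n::finite mfps ^ 'n \<Rightarrow> bool" where
  "tangent_id \<Phi> \<longleftrightarrow> ord_pos \<Phi> \<and> (\<forall>k l. mcoeff (\<Phi> $ k) (axis l 1) = (if k = l then 1 else 0))"

lemma low_degree_cases:
  fixes Q :: "nat ^ 'n::finite"
  obtains "Q = 0" | l where "Q = axis l 1" | "2 \<le> mdeg Q"
proof -
  have "Q = 0 \<or> mdeg Q = 1 \<or> 2 \<le> mdeg Q" using mdeg_pos[of Q] by (cases "Q = 0") linarith+
  thus thesis using that mdeg_1_cases[of Q] by blast
qed

text \<open>Powers of degree at least two gain one degree of agreement; substitution into h is thus
  a contraction for the degree filtration.\<close>

lemma compose_cong_shift:
  assumes h: "\<And>P. mdeg P < 2 \<Longrightarrow> mcoeff h P = 0"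
    and GH: "\<And>k. G $ k - H $ k \<in> vanishing {Q. mdeg Q < n}" "ord_pos G" "ord_pos H"
  shows "mfps_compose h G - mfps_compose h H \<in> vanishing {Q. mdeg Q < Suc n}"
  unfolding vanishing_def
proof (intro CollectI ballI)
  fix Q :: "nat ^ 'a" assume Q: "Q \<in> {Q. mdeg Q < Suc n}"
  have "mcoeff h P * (mcoeff (mpow G P) Q - mcoeff (mpow H P) Q) = 0" for P
  proof (cases "mdeg P < 2")
    case False
    have "mpow G P - mpow H P \<in> vanishing {Q. mdeg Q < Suc n}"
    proof (rule mpow_cong_shift[OF _ _ GH])
      show "hereditary {Q :: nat ^ 'a. mdeg Q < n}" by (auto simp: hereditary_def mdeg_add)
      show "P + Q \<in> {Q. mdeg Q < Suc n} \<Longrightarrow> Q \<in> {Q. mdeg Q < n}" if "P \<noteq> 0" for P Q :: "nat ^ 'a"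
        using mdeg_pos[OF that] by (simp add: mdeg_add)
    qed (use False in auto)
    thus ?thesis using Q by (auto simp: vanishing_def)
  qed (simp add: h)
  hence "(\<Sum>P | mdeg P \<le> mdeg Q. mcoeff h P * (mcoeff (mpow G P) Q - mcoeff (mpow H P) Q)) = 0"
    by (intro sum.neutral) blast
  thus "mcoeff (mfps_compose h G - mfps_compose h H) Q = 0"
    by (simp add: mcoeff_compose sum_subtractf right_diff_distrib)
qed

text \<open>The right inverse is the fixed point of \<open>\<psi> \<mapsto> x - h(\<psi>)\<close> for \<open>\<Phi> = x + h\<close>, a map that determines
  degree \<open>n\<close> from the degrees below \<open>n\<close>.\<close>

lemma formal_right_inverse:
  fixes \<Phi> :: "'n::finite mfps ^ 'n"
  assumes \<Phi>: "tangent_id \<Phi>"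
  shows "\<exists>\<psi>. tangent_id \<psi> \<and> fmap_compose \<Phi> \<psi> = fmap_linear (mat 1) \<and>
    (\<forall>k Q. 2 \<le> mdeg Q \<longrightarrow> mcoeff (\<psi> $ k) Q =
      - (\<Sum>P | 2 \<le> mdeg P \<and> mdeg P \<le> mdeg Q. mcoeff (\<Phi> $ k) P * mcoeff (mpow \<psi> P) Q))"
proof -
  let ?x = "fmap_linear (mat 1) :: 'n mfps ^ 'n"
  define h where "h = \<Phi> - ?x"
  have h: "mcoeff (h $ k) P = 0" if "mdeg P < 2" for k P
  proof -
    have "mcoeff (h $ k) 0 = 0"
      using \<Phi> mcoeff_linear_0[of "mat 1" k] by (simp add: h_def tangent_id_def ord_pos_def)
    moreover have "mcoeff (h $ k) (axis l 1) = 0" for l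
      using \<Phi> mcoeff_linear_axis[of "mat 1" k l]
      by (simp add: h_def tangent_id_def mat_def del: fmap_linear_nth)
    ultimately show ?thesis using that by (cases P rule: low_degree_cases) auto
  qed
  define T where "T \<psi> = (\<chi> k. ?x $ k - mfps_compose (h $ k) \<psi>)" for \<psi>
  have T_ord: "ord_pos (T \<psi>)" for \<psi>
    using h[of 0] mcoeff_linear_0[of "mat 1 :: complex ^ 'n ^ 'n"]
    by (simp add: ord_pos_def T_def mcoeff_compose del: fmap_linear_nth)
  have T_cong: "T G $ k - T H $ k \<in> vanishing {Q. mdeg Q < Suc n}"
    if "\<And>k. G $ k - H $ k \<in> vanishing {Q. mdeg Q < n}" "ord_pos G" "ord_pos H" for G H n k
    using compose_cong_shift[OF h that, of k] by (simp add: T_def vanishing_def)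
  define \<psi>n where "\<psi>n n = (T ^^ n) 0" for n
  have ord: "ord_pos (\<psi>n n)" for n
    by (cases n) (auto simp: \<psi>n_def T_ord, simp add: ord_pos_def)
  have \<psi>n_step: "\<psi>n (Suc n) $ k - \<psi>n n $ k \<in> vanishing {Q. mdeg Q < n}" for n k
  proof (induction n arbitrary: k)
    case (Suc n)
    from T_cong[OF Suc ord ord, of k] show ?case by (simp add: \<psi>n_def)
  qed (simp add: vanishing_def)
  have \<psi>n_le: "\<psi>n (n + m) $ k - \<psi>n n $ k \<in> vanishing {Q. mdeg Q < n}" for n m k
  proof (induction m)
    case (Suc m)
    have "\<psi>n (Suc (n + m)) $ k - \<psi>n (n + m) $ k \<in> vanishing {Q. mdeg Q < n}"
      by (rule vanishing_mono[OF \<psi>n_step]) auto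
    from vanishing_add[OF this Suc] show ?case by simp
  qed (simp add: vanishing_def)
  \<comment> \<open>The coefficients of degree d no longer change from iterate d + 1 on.\<close>
  define \<psi> where "\<psi> = (\<chi> k. Abs_mfps (\<lambda>Q. mcoeff (\<psi>n (Suc (mdeg Q)) $ k) Q))"
  have \<psi>: "\<psi> $ k - \<psi>n n $ k \<in> vanishing {Q. mdeg Q < n}" for n k
  proof -
    have "mcoeff (\<psi> $ k - \<psi>n n $ k) Q = 0" if "mdeg Q < n" for Q
      using \<psi>n_le[of "Suc (mdeg Q)" "n - Suc (mdeg Q)" k] that by (simp add: vanishing_def \<psi>_def)
    thus ?thesis by (auto simp: vanishing_def)
  qed
  have ord_\<psi>: "ord_pos \<psi>"
    using ord[of "Suc 0"] by (simp add: ord_pos_def \<psi>_def)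
  have fp: "\<psi> = T \<psi>"
  proof -
    have "mcoeff (\<psi> $ k) Q = mcoeff (T \<psi> $ k) Q" for k Q
    proof -
      have "T \<psi> $ k - \<psi>n (Suc (mdeg Q)) $ k \<in> vanishing {R. mdeg R < Suc (mdeg Q)}"
        using T_cong[where n = "mdeg Q" and k = k, OF \<psi> ord_\<psi> ord] by (simp add: \<psi>n_def)
      thus ?thesis using \<psi>[of k "Suc (mdeg Q)"] by (auto simp: vanishing_def)
    qed
    thus ?thesis by (simp add: vec_eq_iff mfps_eqI)
  qed
  have comp: "fmap_compose \<Phi> \<psi> = ?x"
  proof -
    have "mfps_compose (\<Phi> $ k) \<psi> = ?x $ k" for k
    proof -
      have "\<Phi> $ k = h $ k + ?x $ k" by (simp add: h_def)
      hence "mfps_compose (\<Phi> $ k) \<psi> = mfps_compose (h $ k) \<psi> + fmap_compose ?x \<psi> $ k"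
        by (simp add: compose_add)
      also have "fmap_compose ?x \<psi> $ k = T \<psi> $ k" using fmap_id_compose[OF ord_\<psi>] fp by simp
      finally show ?thesis by (simp add: T_def)
    qed
    thus ?thesis by (simp add: vec_eq_iff)
  qed
  have h_compose: "mcoeff (mfps_compose (h $ k) \<psi>) Q
      = (\<Sum>P | 2 \<le> mdeg P \<and> mdeg P \<le> mdeg Q. mcoeff (h $ k) P * mcoeff (mpow \<psi> P) Q)" for k Q
    unfolding mcoeff_compose
    by (rule sum.mono_neutral_right) (auto simp: finite_mdeg_le, meson h not_le)
  have tan: "tangent_id \<psi>"
  proof -
    have "mcoeff (\<psi> $ k) (axis l 1) = (if k = l then 1 else 0)" for k l
    proof -
      have "{P :: nat ^ 'n. 2 \<le> mdeg P \<and> mdeg P \<le> mdeg (axis l (1::nat) :: nat ^ 'n)} = {}" by auto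
      hence "mcoeff (mfps_compose (h $ k) \<psi>) (axis l 1) = 0" by (simp only: h_compose sum.empty)
      thus ?thesis using mcoeff_linear_axis[of "mat 1" k l]
        by (subst fp) (simp add: T_def mat_def del: fmap_linear_nth)
    qed
    thus ?thesis using ord_\<psi> by (simp add: tangent_id_def)
  qed
  have "mcoeff (\<psi> $ k) Q =
      - (\<Sum>P | 2 \<le> mdeg P \<and> mdeg P \<le> mdeg Q. mcoeff (\<Phi> $ k) P * mcoeff (mpow \<psi> P) Q)"
    if Q: "2 \<le> mdeg Q" for k Q
  proof -
    have "mcoeff (\<psi> $ k) Q = mcoeff (T \<psi> $ k) Q" using fp by simp
    also have "\<dots> = - mcoeff (mfps_compose (h $ k) \<psi>) Q"
      using mcoeff_linear_high[OF Q] by (simp add: T_def del: fmap_linear_nth)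
    also have "mcoeff (mfps_compose (h $ k) \<psi>) Q
        = (\<Sum>P | 2 \<le> mdeg P \<and> mdeg P \<le> mdeg Q. mcoeff (\<Phi> $ k) P * mcoeff (mpow \<psi> P) Q)"
      unfolding h_compose
      by (rule sum.cong) (simp_all add: h_def mcoeff_linear_high del: fmap_linear_nth)
    finally show ?thesis .
  qed
  thus ?thesis using tan comp by blast
qed

lemma convergent_inverse:
  fixes \<Phi> :: "'n::finite mfps ^ 'n"
  assumes \<Phi>: "tangent_id \<Phi>" and conv: "\<And>k. \<Phi> $ k \<in> convergent_mfps"
  obtains \<Psi> where "tangent_id \<Psi>" "\<And>k. \<Psi> $ k \<in> convergent_mfps"
    "fmap_compose \<Phi> \<Psi> = fmap_linear (mat 1)" "fmap_compose \<Psi> \<Phi> = fmap_linear (mat 1)"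
proof -
  obtain \<Psi> where \<Psi>: "tangent_id \<Psi>" "fmap_compose \<Phi> \<Psi> = fmap_linear (mat 1)"
    and rec: "\<And>k Q. 2 \<le> mdeg Q \<Longrightarrow> mcoeff (\<Psi> $ k) Q =
      - (\<Sum>P | 2 \<le> mdeg P \<and> mdeg P \<le> mdeg Q. mcoeff (\<Phi> $ k) P * mcoeff (mpow \<Psi> P) Q)"
    using formal_right_inverse[OF \<Phi>] by blast
  \<comment> \<open>The right inverse \<Psi> has a right inverse itself, which by associativity is
    \<Phi>; so \<Psi> is a left inverse too.\<close>
  obtain \<Phi>' where \<Phi>': "tangent_id \<Phi>'" "fmap_compose \<Psi> \<Phi>' = fmap_linear (mat 1)"
    using formal_right_inverse[OF \<Psi>(1)] by blast
  have o: "ord_pos \<Psi>" "ord_pos \<Phi>'" using \<Psi>(1) \<Phi>'(1) by (auto simp: tangent_id_def)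
  have "\<Phi> = fmap_compose \<Phi> (fmap_compose \<Psi> \<Phi>')" by (simp add: \<Phi>'(2) fmap_compose_id)
  also have "\<dots> = fmap_compose (fmap_linear (mat 1)) \<Phi>'"
    by (simp add: fmap_compose_assoc[OF o, symmetric] \<Psi>(2))
  also have "\<dots> = \<Phi>'" by (rule fmap_id_compose[OF o(2)])
  finally have left: "fmap_compose \<Psi> \<Phi> = fmap_linear (mat 1)" using \<Phi>'(2) by simp
  \<comment> \<open>Inversion involves no divisors, so constant weights suffice.\<close>
  interpret weights "\<lambda>_ :: nat ^ 'n. 1" "\<lambda>_ _. 1" by unfold_locales auto
  have "\<Psi> $ k \<in> convergent_mfps" for k
  proof (rule convergent_majorant[where b = "\<lambda>k P. norm (mcoeff (\<Phi> $ k) P)" and K = 1])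
    show "norm (mcoeff (\<Psi> $ k) Q) \<le> 1 * (\<Sum>P | 2 \<le> mdeg P \<and> mdeg P \<le> mdeg Q.
        norm (mcoeff (\<Phi> $ k) P) * norm (mcoeff (mpow \<Psi> P) Q))" if "2 \<le> mdeg Q" for k Q
      unfolding rec[OF that] norm_minus_cancel norm_mult[symmetric] mult_1 by (rule norm_sum)
    show "\<exists>r>0. (\<lambda>P. norm (mcoeff (\<Phi> $ k) P) * r ^ mdeg P) summable_on UNIV" for k
      using conv[of k] by (simp add: convergent_mfps_iff summable_at_def)
  qed (use \<Psi>(1) in \<open>auto simp: tangent_id_def\<close>)
  thus thesis using that \<Psi> left by blast
qed


section \<open>Monomial ideals\<close>

definition outside :: "(nat ^ 'n::finite) set \<Rightarrow> (nat ^ 'n) set" where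
  "outside S = {Q. \<forall>P\<in>S. \<forall>R. Q \<noteq> R + P}"

lemma hereditary_outside: "hereditary (outside S)"
  unfolding hereditary_def outside_def by (auto simp: add_ac)

lemma convergent_mult:
  assumes "a \<in> convergent_mfps" "b \<in> convergent_mfps" shows "a * b \<in> convergent_mfps"
proof -
  obtain r s where r: "0 < r" "summable_at r a" and s: "0 < s" "summable_at s b"
    using assms by (auto simp: convergent_mfps_iff)
  have "summable_at (min r s) a" "summable_at (min r s) b"
    using summable_at_mono[OF r(2), of "min r s"] summable_at_mono[OF s(2), of "min r s"] r(1) s(1)
    by auto
  from summable_at_mult(1)[OF this] show ?thesis
    using r(1) s(1) unfolding convergent_mfps_iff by (intro exI[of _ "min r s"]) auto
qed

lemma convergent_monom: "mfps_monom P c \<in> convergent_mfps"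
  using has_expansion_monom by (auto simp: convergent_mfps_def)

lemma convergent_sum:
  "(\<And>x. x \<in> A \<Longrightarrow> f x \<in> convergent_mfps) \<Longrightarrow> finite A \<Longrightarrow> sum f A \<in> convergent_mfps"
  using has_expansion_sum[of A "\<lambda>x. meval (f x)" f] meval_has_expansion by (auto simp: convergent_mfps_def)

text \<open>The hypothesis is a domination by a shift of a rather than an equality, because g will
  collect only a part of the multiples of x^P.\<close>

lemma monomial_quotient_convergent:
  assumes "a \<in> convergent_mfps" "\<And>R. norm (mcoeff g R) \<le> norm (mcoeff a (R + P))"
  shows "g \<in> convergent_mfps"
proof -
  obtain r where r: "0 < r" "summable_at r a" using assms(1) by (auto simp: convergent_mfps_iff)
  let ?f = "\<lambda>Q. norm (mcoeff a Q) * r ^ mdeg Q"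
  have "?f summable_on (\<lambda>R. R + P) ` UNIV"
    using summable_on_subset_banach[OF r(2)[unfolded summable_at_def]] by blast
  hence "(?f \<circ> (\<lambda>R. R + P)) summable_on UNIV"
    by (subst (asm) summable_on_reindex) (auto simp: inj_on_def)
  hence "(\<lambda>R. ?f (R + P) * inverse (r ^ mdeg P)) summable_on UNIV"
    by (intro summable_on_cmult_left) (simp add: o_def)
  hence "(\<lambda>R. norm (mcoeff g R) * r ^ mdeg R) summable_on UNIV"
    by (rule summable_on_comparison_test)
      (use r(1) assms(2) in \<open>auto simp: mdeg_add power_add intro!: mult_right_mono\<close>)
  thus ?thesis using r(1) by (auto simp: convergent_mfps_iff summable_at_def)
qed

lemma monomial_ideal_vanishing:
  assumes "a \<in> monomial_ideal A S" shows "a \<in> vanishing (outside S)"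
proof -
  obtain g where a: "a = (\<Sum>P\<in>S. g P * mfps_monom P 1)" using assms by (auto simp: monomial_ideal_def)
  have "mcoeff (g P * mfps_monom P 1) Q = 0" if "P \<in> S" "Q \<in> outside S" for P Q
  proof -
    have "{R. R + P = Q} = {}" using that by (auto simp: outside_def)
    thus ?thesis by (simp only: mcoeff_mult_monom sum.empty)
  qed
  thus ?thesis by (auto simp: vanishing_def a)
qed

text \<open>Each monomial of a is assigned to one chosen generator that divides it, so that none is
  counted twice; the coefficient of a generator collects the quotients. The condition on A covers
  formal and convergent series at once.\<close>

lemma vanishing_in_monomial_ideal:
  assumes S: "finite S" and a: "a \<in> vanishing (outside S)"
    and A: "\<And>g P. (\<And>R. norm (mcoeff g R) \<le> norm (mcoeff a (R + P))) \<Longrightarrow> g \<in> A"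
  shows "a \<in> monomial_ideal A S"
proof -
  define p where "p Q = (SOME P. P \<in> S \<and> (\<exists>R. Q = R + P))" for Q
  have p: "p Q \<in> S \<and> (\<exists>R. Q = R + p Q)" if "Q \<notin> outside S" for Q
    unfolding p_def by (rule someI_ex) (use that in \<open>auto simp: outside_def\<close>)
  define g where "g P = Abs_mfps (\<lambda>R. if R + P \<notin> outside S \<and> p (R + P) = P then mcoeff a (R + P) else 0)" for P
  have "a = (\<Sum>P\<in>S. g P * mfps_monom P 1)"
  proof (rule mfps_eqI)
    fix Q
    have one: "mcoeff (g P * mfps_monom P 1) Q = (if Q \<notin> outside S \<and> P = p Q then mcoeff a Q else 0)" for P
    proof (cases "\<exists>R. Q = R + P")
      case True
      then obtain R where R: "Q = R + P" by blast
      hence "{R'. R' + P = Q} = {R}" by auto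
      hence "mcoeff (g P * mfps_monom P 1) Q = mcoeff (g P) R" by (simp only: mcoeff_mult_monom) simp
      thus ?thesis by (auto simp: g_def R)
    next
      case False
      hence "{R. R + P = Q} = {}" by auto
      hence "mcoeff (g P * mfps_monom P 1) Q = 0" by (simp only: mcoeff_mult_monom sum.empty)
      thus ?thesis using p[of Q] False by auto
    qed
    show "mcoeff a Q = mcoeff (\<Sum>P\<in>S. g P * mfps_monom P 1) Q"
    proof (cases "Q \<in> outside S")
      case True
      thus ?thesis using a by (simp add: one vanishing_def)
    next
      case False
      thus ?thesis using p[OF False] S by (simp add: one sum.delta)
    qed
  qed
  moreover have "g P \<in> A" for P by (rule A[of _ P]) (simp add: g_def)
  ultimately show ?thesis by (auto simp: monomial_ideal_def)
qed

lemma formal_monomial_ideal_iff: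
  "finite S \<Longrightarrow> a \<in> monomial_ideal UNIV S \<longleftrightarrow> a \<in> vanishing (outside S)"
  using monomial_ideal_vanishing vanishing_in_monomial_ideal by (metis UNIV_I)

lemma monomial_ideal_iff:
  assumes "finite S"
  shows "a \<in> monomial_ideal convergent_mfps S \<longleftrightarrow> a \<in> convergent_mfps \<and> a \<in> vanishing (outside S)"
proof
  assume a: "a \<in> monomial_ideal convergent_mfps S"
  then obtain g where "a = (\<Sum>P\<in>S. g P * mfps_monom P 1)" "\<forall>P\<in>S. g P \<in> convergent_mfps"
    by (auto simp: monomial_ideal_def)
  hence "a \<in> convergent_mfps"
    using assms by (auto intro!: convergent_sum convergent_mult convergent_monom)
  thus "a \<in> convergent_mfps \<and> a \<in> vanishing (outside S)"
    using monomial_ideal_vanishing[OF a] by blast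
next
  assume "a \<in> convergent_mfps \<and> a \<in> vanishing (outside S)"
  thus "a \<in> monomial_ideal convergent_mfps S"
    using vanishing_in_monomial_ideal[OF assms] monomial_quotient_convergent by blast
qed

lemma exponents_outside_monomial_ideal:
  "finite S \<Longrightarrow> exponents_outside (monomial_ideal convergent_mfps S) = outside S"
  by (auto simp: exponents_outside_def monomial_ideal_iff convergent_monom vanishing_def mcoeff_monom)


section \<open>Derivatives at the origin\<close>

lemma norm_le_card_sup:
  fixes v :: "complex ^ 'n::finite"
  assumes "\<And>k. norm (v $ k) \<le> c" shows "norm v \<le> real CARD('n) * c"
proof -
  have "norm v \<le> (\<Sum>k\<in>(UNIV::'n set). norm (v $ k))" unfolding norm_vec_def by (rule L2_set_le_sum) auto
  also have "\<dots> \<le> (\<Sum>k\<in>(UNIV::'n set). c)" by (rule sum_mono) (rule assms)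
  finally show ?thesis by simp
qed

text \<open>This is \<open>mnorm_scale\<close> with d = 2 and c = |z| / r.\<close>

lemma expansion_quadratic_bound:
  assumes "f has_mfps_expansion a" "\<And>Q. mdeg Q < 2 \<Longrightarrow> mcoeff a Q = 0"
  shows "\<exists>C. 0 \<le> C \<and> (\<forall>\<^sub>F z in nhds 0. norm (f z) \<le> C * (norm z)\<^sup>2)"
proof -
  obtain r where r: "0 < r" "summable_at r a" and f: "\<forall>\<^sub>F z in nhds 0. f z = meval a z"
    using assms(1) by (auto simp: has_mfps_expansion_iff)
  have "\<forall>\<^sub>F z :: complex ^ 'a in nhds 0. norm z < r"
    unfolding eventually_nhds_metric using r(1) by (intro exI[of _ r]) auto
  with f have "\<forall>\<^sub>F z in nhds 0. norm (f z) \<le> mnorm r a / r\<^sup>2 * (norm z)\<^sup>2"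
  proof eventually_elim
    case (elim z)
    define c where "c = norm z / r"
    have c: "0 \<le> c" "c \<le> 1" "c * r = norm z" using elim r(1) by (auto simp: c_def)
    have "summable_at (norm z) a" using elim by (intro summable_at_mono[OF r(2)]) auto
    hence "norm (f z) \<le> mnorm (norm z) a"
      using elim(1) summable_at_abs(3)[of "norm z" a z] Finite_Cartesian_Product.norm_nth_le[of z] by simp
    also have "\<dots> \<le> c\<^sup>2 * mnorm r a"
      unfolding c(3)[symmetric] by (rule mnorm_scale[OF r(2)]) (use c r assms(2) in auto)
    finally show ?case by (simp add: c_def power_divide mult.commute)
  qed
  thus ?thesis using mnorm_nonneg[of r a] r(1) by (intro exI[of _ "mnorm r a / r\<^sup>2"]) auto
qed

lemma expansion_at_0:
  assumes "f has_mfps_expansion a" shows "f 0 = mcoeff a 0"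
proof -
  have "((\<lambda>Q. mcoeff a Q * mpow 0 Q) has_sum f 0) UNIV"
    using assms eventually_nhds_x_imp_x unfolding has_mfps_expansion_def by blast
  moreover have "((\<lambda>Q. mcoeff a Q * mpow 0 Q) has_sum mcoeff a 0) UNIV"
  proof (rule has_sum_finite_neutralI[of "{0}"])
    fix Q :: "nat ^ 'a" assume "Q \<in> UNIV - {0}"
    hence "Q \<noteq> 0" by simp
    then obtain P k where "Q = P + axis k 1" by (rule nonzero_index_cases)
    thus "mcoeff a Q * mpow 0 Q = 0" by (simp add: mpow_add)
  qed auto
  ultimately show ?thesis by (rule has_sum_unique)
qed

lemma ord_pos_expansion: "map_has_expansion f a \<Longrightarrow> ord_pos a \<longleftrightarrow> f 0 = 0"
  using expansion_at_0 unfolding map_has_expansion_def ord_pos_def vec_eq_iff by fastforce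

text \<open>Connects derivatives at 0, in which DR(0) = 0 and the tangency of the convergent map to
  the identity are stated, with the linear coefficients of the series.\<close>

lemma expansion_has_derivative:
  fixes f :: "complex ^ 'n::finite \<Rightarrow> complex ^ 'n"
  assumes f: "map_has_expansion f a" and a: "ord_pos a"
  shows "(f has_derivative (\<lambda>h. (\<chi> k l. mcoeff (a $ k) (axis l 1)) *v h)) (at 0)"
proof -
  define A where "A = (\<chi> k l. mcoeff (a $ k) (axis l 1))"
  have "\<exists>C. 0 \<le> C \<and> (\<forall>\<^sub>F z in nhds 0. norm (f z $ k - (A *v z) $ k) \<le> C * (norm z)\<^sup>2)" for k
  proof (rule expansion_quadratic_bound)
    show "(\<lambda>z. f z $ k - (A *v z) $ k) has_mfps_expansion a $ k - fmap_linear A $ k"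
      by (rule has_expansion_diff)
        (use f has_expansion_linear[of A] in \<open>auto simp: map_has_expansion_def simp del: fmap_linear_nth\<close>)
    fix Q :: "nat ^ 'n" assume "mdeg Q < 2"
    thus "mcoeff (a $ k - fmap_linear A $ k) Q = 0"
      by (cases Q rule: low_degree_cases)
        (use a mcoeff_linear_0[of A k] mcoeff_linear_axis[of A k] in
          \<open>auto simp: ord_pos_def A_def simp del: fmap_linear_nth\<close>)
  qed
  hence "\<exists>C. \<forall>k. 0 \<le> C k \<and> (\<forall>\<^sub>F z in nhds 0. norm (f z $ k - (A *v z) $ k) \<le> C k * (norm z)\<^sup>2)"
    by (intro choice allI)
  then obtain C where C: "\<And>k. 0 \<le> C k"
    "\<And>k. \<forall>\<^sub>F z in nhds 0. norm (f z $ k - (A *v z) $ k) \<le> C k * (norm z)\<^sup>2" by blast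
  define M where "M = (\<Sum>k\<in>UNIV. C k)"
  have CM: "C k \<le> M" for k unfolding M_def by (rule member_le_sum) (use C(1) in auto)
  have "\<forall>\<^sub>F z in nhds 0. \<forall>k. norm (f z $ k - (A *v z) $ k) \<le> C k * (norm z)\<^sup>2"
    unfolding eventually_all_iff using C(2) by blast
  then obtain e where e: "0 < e" "\<And>z k. norm z < e \<Longrightarrow> norm (f z $ k - (A *v z) $ k) \<le> C k * (norm z)\<^sup>2"
    by (auto simp: eventually_nhds_metric)
  have f0: "f 0 = 0" using ord_pos_expansion[OF f] a by blast
  show ?thesis unfolding A_def[symmetric]
  proof (rule has_derivativeI_sandwich[OF e(1)])
    show "bounded_linear ((*v) A)" by (rule matrix_vector_mul_bounded_linear)
    show "((\<lambda>z. real CARD('n) * M * norm z) \<longlongrightarrow> 0) (at (0 :: complex ^ 'n))"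
      by (intro tendsto_mult_right_zero tendsto_norm_zero tendsto_ident_at)
    fix z :: "complex ^ 'n" assume z: "z \<noteq> 0" "dist z 0 < e"
    have "norm (f z - A *v z) \<le> real CARD('n) * (M * (norm z)\<^sup>2)"
    proof (rule norm_le_card_sup)
      fix k
      have "norm (f z $ k - (A *v z) $ k) \<le> C k * (norm z)\<^sup>2" using e(2) z by simp
      also have "\<dots> \<le> M * (norm z)\<^sup>2" by (intro mult_right_mono CM) auto
      finally show "norm ((f z - A *v z) $ k) \<le> M * (norm z)\<^sup>2" by simp
    qed
    thus "norm (f z - f 0 - A *v (z - 0)) / norm (z - 0) \<le> real CARD('n) * M * norm z"
      using z f0 by (simp add: field_simps power2_eq_square)
  qed
qed

section \<open>The arithmetic condition\<close>

definition max_divisor ::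
  "('m::finite \<Rightarrow> 'm \<Rightarrow> complex ^ 'n::finite) \<Rightarrow> 'n \<Rightarrow> nat ^ 'n \<Rightarrow> real" where
  "max_divisor \<mu> l Q = Max (range (\<lambda>(i, j). cmod (mpow (\<mu> i j) Q - \<mu> i j $ l)))"

lemma max_divisor_ge: "cmod (mpow (\<mu> i j) Q - \<mu> i j $ l) \<le> max_divisor \<mu> l Q"
  unfolding max_divisor_def by (rule Max_ge) (auto intro: range_eqI[of _ _ "(i, j)"])

lemma max_divisor_attained:
  obtains i j where "max_divisor \<mu> l Q = cmod (mpow (\<mu> i j) Q - \<mu> i j $ l)"
proof -
  have "max_divisor \<mu> l Q \<in> range (\<lambda>(i, j). cmod (mpow (\<mu> i j) Q - \<mu> i j $ l))"
    unfolding max_divisor_def by (rule Max_in) auto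
  thus thesis using that by auto
qed

lemma max_divisor_nonneg: "0 \<le> max_divisor \<mu> l Q"
  using max_divisor_attained[of \<mu> l Q] by (metis norm_ge_zero)

lemma small_divisors_eq:
  "small_divisors \<mu> A k = {\<delta>. \<delta> \<noteq> 0 \<and>
    (\<exists>Q\<in>A. \<exists>l. 2 \<le> mdeg Q \<and> mdeg Q \<le> 2 ^ k \<and> \<delta> = max_divisor \<mu> l Q)}"
  unfolding small_divisors_def max_divisor_def ..

lemma finite_small_divisors: "finite (small_divisors \<mu> A k)"
proof (rule finite_subset)
  show "small_divisors \<mu> A k \<subseteq> (\<lambda>(Q, l). max_divisor \<mu> l Q) ` ({Q. mdeg Q \<le> 2 ^ k} \<times> UNIV)"
    by (force simp: small_divisors_eq)
qed (simp add: finite_mdeg_le)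

lemma small_divisors_pos: "\<delta> \<in> small_divisors \<mu> A k \<Longrightarrow> 0 < \<delta>"
  using max_divisor_nonneg by (fastforce simp: small_divisors_eq less_le)

lemma small_divisors_mono: "k \<le> k' \<Longrightarrow> small_divisors \<mu> A k \<subseteq> small_divisors \<mu> A k'"
  unfolding small_divisors_eq
  using order_trans[OF _ power_increasing[of k k' "2::nat"]] by fastforce

lemma omega_Min:
  assumes "small_divisors \<mu> A k \<noteq> {}"
  shows "omega \<mu> A k \<in> small_divisors \<mu> A k" and "\<delta> \<in> small_divisors \<mu> A k \<Longrightarrow> omega \<mu> A k \<le> \<delta>"
proof -
  have "omega \<mu> A k = Min (small_divisors \<mu> A k)"
    unfolding omega_def by (rule cInf_eq_Min[OF finite_small_divisors assms])
  thus "omega \<mu> A k \<in> small_divisors \<mu> A k" "\<delta> \<in> small_divisors \<mu> A k \<Longrightarrow> omega \<mu> A k \<le> \<delta>"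
    using Min_in[OF finite_small_divisors assms] Min_le[OF finite_small_divisors] by auto
qed

lemma diophantine_bound:
  assumes dio: "diophantine \<mu> A" and "N \<subseteq> A"
    and pos: "\<And>Q l. Q \<in> N \<Longrightarrow> 2 \<le> mdeg Q \<Longrightarrow> 0 < max_divisor \<mu> l Q"
  obtains b :: "nat \<Rightarrow> real" where "\<And>m. 0 \<le> b m" "summable (\<lambda>m. b (Suc m) / 2 ^ m)"
    "\<And>m Q l. Q \<in> N \<Longrightarrow> 2 \<le> mdeg Q \<Longrightarrow> mdeg Q \<le> 2 ^ m \<Longrightarrow> exp (- b m) \<le> max_divisor \<mu> l Q"
proof
  let ?sd = "small_divisors \<mu> A" and ?\<omega> = "omega \<mu> A"
  \<comment> \<open>The positive part is taken because divisors above 1 give negative terms.\<close>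
  define b where "b m = (if ?sd m = {} then 0 else max 0 (- ln (?\<omega> m)))" for m
  show "0 \<le> b m" for m by (simp add: b_def)
  show "exp (- b m) \<le> max_divisor \<mu> l Q" if "Q \<in> N" "2 \<le> mdeg Q" "mdeg Q \<le> 2 ^ m" for m Q l
  proof -
    have sd: "max_divisor \<mu> l Q \<in> ?sd m"
      using that pos[OF that(1,2), of l] assms(2) unfolding small_divisors_eq by auto
    hence ne: "?sd m \<noteq> {}" by auto
    have \<omega>: "0 < ?\<omega> m" using small_divisors_pos omega_Min(1)[OF ne] by blast
    have "exp (- b m) \<le> exp (ln (?\<omega> m))" using ne by (simp add: b_def)
    also have "\<dots> = ?\<omega> m" using \<omega> by simp
    also have "\<dots> \<le> max_divisor \<mu> l Q" using omega_Min(2)[OF ne sd] .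
    finally show ?thesis .
  qed
  define a where "a k = (if ?sd (Suc k) = {} then 0 else - (ln (?\<omega> (Suc k)) / 2 ^ Suc k))" for k
  have a: "summable a" using dio unfolding diophantine_def a_def .
  text \<open>The terms of the series are bounded below by a multiple of \<open>2\<^sup>-\<^sup>k\<close>, so their positive parts
    are summable as well.\<close>
  obtain C where C: "0 \<le> C" "\<And>m. ?sd m \<noteq> {} \<Longrightarrow> - C \<le> - ln (?\<omega> m)"
  proof (cases "\<exists>m. ?sd m \<noteq> {}")
    case False
    thus thesis using that[of 0] by auto
  next
    case True
    \<comment> \<open>The sets of divisors grow with m. From the first nonempty one on,
      \<open>omega\<close> is therefore nonincreasing, and minus its logarithm is bounded
      below.\<close>
    define m0 where "m0 = (LEAST m. ?sd m \<noteq> {})"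
    have m0: "?sd m0 \<noteq> {}" unfolding m0_def using True by (rule LeastI_ex)
    have "- \<bar>ln (?\<omega> m0)\<bar> \<le> - ln (?\<omega> m)" if m: "?sd m \<noteq> {}" for m
    proof -
      have "m0 \<le> m" unfolding m0_def by (rule Least_le) (rule m)
      hence "?\<omega> m0 \<in> ?sd m" using small_divisors_mono omega_Min(1)[OF m0] by blast
      hence "?\<omega> m \<le> ?\<omega> m0" by (rule omega_Min(2)[OF m])
      moreover have "0 < ?\<omega> m" using small_divisors_pos omega_Min(1)[OF m] by blast
      ultimately have "ln (?\<omega> m) \<le> ln (?\<omega> m0)" by simp
      thus ?thesis by simp
    qed
    thus thesis using that[of "\<bar>ln (?\<omega> m0)\<bar>"] by auto
  qed
  \<comment> \<open>The factor 2 turns the denominator 2^(m + 1) of the hypothesis into the 2^m used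
    for b.\<close>
  have "summable (\<lambda>k. 2 * (a k + C * (1 / 2) ^ Suc k))"
    by (intro summable_mult summable_add a) (simp add: summable_mult summable_geometric)
  thus "summable (\<lambda>m. b (Suc m) / 2 ^ m)"
  proof (rule summable_comparison_test'[where N = 0])
    fix m :: nat
    have "b (Suc m) \<le> 2 ^ Suc m * a m + C"
      using C(1) C(2)[of "Suc m"] by (auto simp: b_def a_def)
    hence "b (Suc m) / 2 ^ m \<le> (2 ^ Suc m * a m + C) / 2 ^ m" by (intro divide_right_mono) auto
    also have "\<dots> = 2 * (a m + C * (1 / 2) ^ Suc m)" by (simp add: field_simps)
    finally show "norm (b (Suc m) / 2 ^ m) \<le> 2 * (a m + C * (1 / 2) ^ Suc m)"
      by (simp add: b_def)
  qed
qed

text \<open>Both powers are close to the same x_l, and x^P has modulus at least c / 2; so their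
  quotient x^R is close to 1.\<close>

lemma close_exponents:
  assumes 1: "cmod (mpow x P - x $ l) < \<theta>" and 2: "cmod (mpow x (P + R) - x $ l) < \<theta>"
    and c: "c \<le> cmod (x $ l)" "2 * \<theta> \<le> c" "0 < c"
  shows "cmod (mpow x R - 1) < 4 * \<theta> / c"
proof -
  have "cmod (x $ l) \<le> cmod (mpow x P - x $ l) + cmod (mpow x P)"
    using norm_triangle_ineq4[of "mpow x P" "mpow x P - x $ l"] by simp
  hence xP: "c / 2 \<le> cmod (mpow x P)" using 1 c by linarith
  have "(mpow x R - 1) * mpow x P = (mpow x (P + R) - x $ l) - (mpow x P - x $ l)"
    by (simp add: mpow_add algebra_simps)
  hence "cmod (mpow x R - 1) * cmod (mpow x P) < 2 * \<theta>"
    using norm_triangle_ineq4[of "mpow x (P + R) - x $ l" "mpow x P - x $ l"] 1 2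
    by (simp add: norm_mult[symmetric])
  moreover have "cmod (mpow x R - 1) * (c / 2) \<le> cmod (mpow x R - 1) * cmod (mpow x P)"
    by (rule mult_left_mono[OF xP]) auto
  ultimately show ?thesis using c(3) by (simp add: field_simps)
qed

lemma ex_small_divisor_bounds:
  fixes \<mu> :: "'m::finite \<Rightarrow> 'm \<Rightarrow> complex ^ 'n::finite"
  assumes "diophantine \<mu> A" and "N \<subseteq> A" and N: "hereditary N"
    and pos: "\<And>Q l. Q \<in> N \<Longrightarrow> 2 \<le> mdeg Q \<Longrightarrow> 0 < max_divisor \<mu> l Q"
    and \<mu>: "\<And>i j k. \<mu> i j $ k \<noteq> 0"
  obtains \<theta> where "small_divisor_bounds N (max_divisor \<mu>) \<theta>"
proof -
  obtain b :: "nat \<Rightarrow> real" where b: "\<And>m. 0 \<le> b m" "summable (\<lambda>m. b (Suc m) / 2 ^ m)"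
    "\<And>m Q l. Q \<in> N \<Longrightarrow> 2 \<le> mdeg Q \<Longrightarrow> mdeg Q \<le> 2 ^ m \<Longrightarrow> exp (- b m) \<le> max_divisor \<mu> l Q"
    using diophantine_bound[OF assms(1,2) pos] by blast
  define X where "X = range (\<lambda>(i, j, k). cmod (\<mu> i j $ k))"
  have X: "finite X" "cmod (\<mu> i j $ k) \<in> X" for i j k
    unfolding X_def by (auto intro: range_eqI[of _ _ "(i, j, k)"])
  define c where "c = Min X"
  define C where "C = Max X"
  have cC: "c \<le> cmod (\<mu> i j $ k)" "cmod (\<mu> i j $ k) \<le> C" for i j k
    using X by (auto simp: c_def C_def)
  have "c \<in> X" unfolding c_def using X by (intro Min_in) auto
  hence c: "0 < c" using \<mu> by (auto simp: X_def)
  hence C: "0 < C" using cC by (meson less_le_trans)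
  \<comment> \<open>The three entries provide \<theta> \<le> 1, the condition 2 \<theta> \<le> c of
    \<open>close_exponents\<close>, and 4 \<theta> C / c \<le> exp (- b m) for the final
    contradiction.\<close>
  define c0 where "c0 = min 1 (min (c / 2) (c / (4 * C)))"
  have c0: "0 < c0" "c0 \<le> 1" "2 * c0 \<le> c" "4 * c0 * C \<le> c"
  proof -
    show "0 < c0" "c0 \<le> 1" "2 * c0 \<le> c" using c C by (auto simp: c0_def)
    have "c0 * (4 * C) \<le> c / (4 * C) * (4 * C)"
      by (rule mult_right_mono) (use C in \<open>auto simp: c0_def\<close>)
    thus "4 * c0 * C \<le> c" using C by simp
  qed
  define \<theta> where "\<theta> m = c0 * exp (- b m)" for m
  have \<theta>_pos: "0 < \<theta> m" for m using c0 by (simp add: \<theta>_def)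
  have \<theta>_exp: "\<theta> m \<le> exp (- b m)" for m using c0 by (simp add: \<theta>_def)
  have \<theta>_c0: "\<theta> m \<le> c0" for m
    using c0 b(1)[of m] mult_left_mono[of "exp (- b m)" 1 c0] by (simp add: \<theta>_def)
  have "small_divisor_bounds N (max_divisor \<mu>) \<theta>"
  proof
    show "0 < \<theta> m" "\<theta> m \<le> 1" for m using \<theta>_pos \<theta>_c0[of m] c0(2) by auto
    show "2 ^ m < mdeg Q" if "Q \<in> N" "2 \<le> mdeg Q" "max_divisor \<mu> k Q < \<theta> m" for k Q m
      using b(3)[OF that(1,2), of m k] that(3) \<theta>_exp[of m] by (intro not_le_imp_less) auto
    show "2 ^ m \<le> mdeg R"
      if PR: "P + R \<in> N" "2 \<le> mdeg P" "R \<noteq> 0"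
        and bad: "max_divisor \<mu> l P < \<theta> m" "max_divisor \<mu> l (P + R) < \<theta> m" for l P R m
    proof (rule ccontr)
      assume less: "\<not> 2 ^ m \<le> mdeg R"
      have "P \<noteq> 0" using PR(2) by auto
      then obtain k P' where P: "P = P' + axis k 1" by (rule nonzero_index_cases)
      have "P' + (R + axis k 1) = P + R" by (simp add: P add_ac)
      hence RN: "R + axis k 1 \<in> N" using PR(1) hereditaryD(2)[OF N] by metis
      \<comment> \<open>|R| < 2^m leaves room for one more variable, so the bound at scale m still
        applies.\<close>
      have "2 \<le> mdeg (R + axis k 1)" "mdeg (R + axis k 1) \<le> 2 ^ m"
        using less mdeg_pos[OF PR(3)] by (auto simp: mdeg_add)
      from b(3)[OF RN this, of k] have e: "exp (- b m) \<le> max_divisor \<mu> k (R + axis k 1)" .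
      \<comment> \<open>The pair is chosen for R + e_k. The assumptions on P and P + R hold for
        every pair, being about maxima.\<close>
      obtain i j where ij: "max_divisor \<mu> k (R + axis k 1) = cmod (mpow (\<mu> i j) (R + axis k 1) - \<mu> i j $ k)"
        by (rule max_divisor_attained)
      have "cmod (mpow (\<mu> i j) R - 1) < 4 * \<theta> m / c"
      proof (rule close_exponents)
        show "cmod (mpow (\<mu> i j) P - \<mu> i j $ l) < \<theta> m" "cmod (mpow (\<mu> i j) (P + R) - \<mu> i j $ l) < \<theta> m"
          using bad max_divisor_ge by (meson le_less_trans)+
        show "2 * \<theta> m \<le> c" using \<theta>_c0[of m] c0(3) by linarith
      qed (use c cC in auto)
      hence "cmod (mpow (\<mu> i j) R - 1) * cmod (\<mu> i j $ k) < 4 * \<theta> m / c * C"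
        using cC(2)[of i j k] \<mu> \<theta>_pos[of m] c
        by (intro mult_less_le_imp_less) auto
      also have "4 * \<theta> m / c * C \<le> exp (- b m)"
        using mult_right_mono[OF c0(4), of "exp (- b m)"] c by (simp add: \<theta>_def field_simps)
      finally have "cmod ((mpow (\<mu> i j) R - 1) * \<mu> i j $ k) < exp (- b m)" by (simp add: norm_mult)
      moreover have "(mpow (\<mu> i j) R - 1) * \<mu> i j $ k = mpow (\<mu> i j) (R + axis k 1) - \<mu> i j $ k"
        by (simp add: mpow_add algebra_simps)
      ultimately show False using e unfolding ij by simp
    qed
    have "- ln (\<theta> (Suc m)) / 2 ^ m = - ln c0 * (1 / 2) ^ m + b (Suc m) / 2 ^ m" for m
      using c0(1) by (simp add: \<theta>_def ln_mult field_simps)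
    thus "summable (\<lambda>m. - ln (\<theta> (Suc m)) / 2 ^ m)"
      by (simp only:) (intro summable_add summable_mult summable_geometric b(2), simp)
  qed (use pos in auto)
  thus thesis by (rule that)
qed

section \<open>Convergence of the normalized linearization\<close>

lemma summable_on_sum_finite:
  fixes f :: "'i \<Rightarrow> 'a \<Rightarrow> real"
  assumes "finite A" "\<And>i. i \<in> A \<Longrightarrow> f i summable_on X"
  shows "(\<lambda>x. \<Sum>i\<in>A. f i x) summable_on X"
  using assms by (induction A rule: finite_induct) (auto intro: summable_on_add)

text \<open>Truncating a formal linearization to the exponents outside the ideal does not change it modulo
  the ideal, and there its coefficients solve \<open>(\<mu>\<^sup>Q - \<mu>\<^sub>k) \<phi>\<^sub>k\<^sub>,\<^sub>Q = [f\<^sub>k(x + \<phi>)]\<^sub>Q\<close>.\<close>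

lemma convergent_linearization:
  fixes f :: "'m::finite \<Rightarrow> 'm \<Rightarrow> 'n::finite mfps ^ 'n"
  assumes N: "hereditary N" and bounds: "small_divisor_bounds N (max_divisor \<mu>) \<theta>"
    and f: "\<And>i j k. f i j $ k \<in> convergent_mfps" "\<And>i j. ord_pos (f i j)"
      "\<And>i j k l. mcoeff (f i j $ k) (axis l 1) = (if k = l then \<mu> i j $ k else 0)"
    and \<Phi>': "tangent_id \<Phi>'" "\<And>i j k. mfps_compose (f i j $ k) \<Phi>'
      - mfps_compose (\<Phi>' $ k) (fmap_linear (diag_matrix (\<mu> i j))) \<in> vanishing N"
  obtains \<Phi> where "tangent_id \<Phi>" "\<And>k. \<Phi> $ k \<in> convergent_mfps"
    "\<And>i j k. mfps_compose (f i j $ k) \<Phi>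
      - mfps_compose (\<Phi> $ k) (fmap_linear (diag_matrix (\<mu> i j))) \<in> vanishing N"
proof -
  interpret B: small_divisor_bounds N "max_divisor \<mu>" \<theta> by (rule bounds)
  \<comment> \<open>The linear terms are kept even if their exponents lie in the ideal, so that
    \<Phi> remains tangent to the identity.\<close>
  define \<Phi> where "\<Phi> = (\<chi> k. Abs_mfps (\<lambda>Q. if Q \<in> N \<or> mdeg Q < 2 then mcoeff (\<Phi>' $ k) Q else 0))"
  have tan: "tangent_id \<Phi>"
    using \<Phi>'(1) by (simp add: tangent_id_def ord_pos_def \<Phi>_def)
  hence ord: "ord_pos \<Phi>" by (simp add: tangent_id_def)
  have \<Phi>\<Phi>': "\<Phi> $ k - \<Phi>' $ k \<in> vanishing N" for k
    by (simp add: vanishing_def \<Phi>_def)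
  have coeff: "mcoeff (mfps_compose (f i j $ k) \<Phi>) Q = mcoeff (\<Phi> $ k) Q * mpow (\<mu> i j) Q"
    if "Q \<in> N" for i j k Q
  proof -
    have "mcoeff (mfps_compose (f i j $ k) \<Phi>) Q = mcoeff (mfps_compose (f i j $ k) \<Phi>') Q"
      using compose_cong_vanishing[OF N \<Phi>\<Phi>', of "f i j $ k"] that by (simp add: vanishing_def)
    also have "\<dots> = mcoeff (\<Phi>' $ k) Q * mpow (\<mu> i j) Q"
      using \<Phi>'(2)[of i j k] that by (simp add: vanishing_def compose_diag)
    finally show ?thesis using that by (simp add: \<Phi>_def)
  qed
  hence lin: "mfps_compose (f i j $ k) \<Phi>
      - mfps_compose (\<Phi> $ k) (fmap_linear (diag_matrix (\<mu> i j))) \<in> vanishing N" for i j k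
    by (simp add: vanishing_def compose_diag)
  \<comment> \<open>Off N the truncated coefficients of degree at least two are 0, so V may be 0
    there, where the divisors have no lower bound.\<close>
  define V where "V k Q = (if Q \<in> N then B.node_weight (k, Q) else 0)" for k Q
  interpret weights B.max_weight V
  proof
    show "0 < B.max_weight Q" if "Q \<noteq> 0" for Q using B.max_weight_ge_1[OF that] by linarith
    show "1 \<le> B.max_weight (axis k 1)" for k by (rule B.max_weight_ge_1) simp
    show "0 \<le> V k Q" for k Q using B.node_weight_ge_1[of "(k, Q)"] by (simp add: V_def)
    show "B.max_weight P * B.max_weight Q \<le> B.max_weight (P + Q)" if "P \<noteq> 0" "Q \<noteq> 0" for P Q
      by (rule B.max_weight_add(1)[OF that])
    show "V k (P + Q) * (B.max_weight P * B.max_weight Q) \<le> B.max_weight (P + Q)"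
      if nz: "P \<noteq> 0" "Q \<noteq> 0" for k P Q
    proof (cases "P + Q \<in> N")
      case True
      thus ?thesis using B.max_weight_add(2)[OF nz True, of k] by (simp add: V_def)
    next
      case False
      have "P + Q \<noteq> 0" using nz by (simp add: add_eq_0_index)
      from B.max_weight_ge_1[OF this] show ?thesis using False by (simp add: V_def)
    qed
  qed
  \<comment> \<open>The pair (i, j) with the largest divisor depends on Q, so the majorant takes all
    pairs into account.\<close>
  define b where "b k P = (\<Sum>(i, j)\<in>UNIV. norm (mcoeff (f i j $ k) P))" for k P
  have b_ge: "norm (mcoeff (f i j $ k) P) \<le> b k P" for i j k P
    unfolding b_def using member_le_sum[of "(i, j)" UNIV "\<lambda>(i, j). norm (mcoeff (f i j $ k) P)"] by auto
  have b0: "0 \<le> b k P" for k P unfolding b_def by (rule sum_nonneg) auto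
  have rec: "norm (mcoeff (\<Phi> $ k) Q)
      \<le> V k Q * (\<Sum>P | 2 \<le> mdeg P \<and> mdeg P \<le> mdeg Q. b k P * norm (mcoeff (mpow \<Phi> P) Q))"
    if Q: "2 \<le> mdeg Q" for k Q
  proof (cases "Q \<in> N")
    case False
    thus ?thesis using Q by (simp add: \<Phi>_def V_def)
  next
    case True
    let ?C = "{P. 2 \<le> mdeg P \<and> mdeg P \<le> mdeg Q}"
    obtain i j where ij: "max_divisor \<mu> k Q = cmod (mpow (\<mu> i j) Q - \<mu> i j $ k)"
      by (rule max_divisor_attained)
    have pos: "0 < max_divisor \<mu> k Q" by (rule B.\<delta>_pos[OF True Q])
    have Q0: "Q \<noteq> 0" using Q by auto
    have "mcoeff (\<Phi> $ k) Q * mpow (\<mu> i j) Q = (\<Sum>l\<in>UNIV. mcoeff (f i j $ k) (axis l 1) * mcoeff (\<Phi> $ l) Q)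
        + (\<Sum>P\<in>?C. mcoeff (f i j $ k) P * mcoeff (mpow \<Phi> P) Q)"
      unfolding coeff[OF True, of i j k, symmetric]
      by (subst compose_split) (use f(2)[of i j] Q0 in \<open>auto simp: ord_pos_def\<close>)
    also have "(\<Sum>l\<in>UNIV. mcoeff (f i j $ k) (axis l 1) * mcoeff (\<Phi> $ l) Q)
        = (\<Sum>l\<in>UNIV. if k = l then \<mu> i j $ k * mcoeff (\<Phi> $ k) Q else 0)"
      unfolding f(3) by (rule sum.cong) auto
    also have "\<dots> = \<mu> i j $ k * mcoeff (\<Phi> $ k) Q" by simp
    finally have "mcoeff (\<Phi> $ k) Q * (mpow (\<mu> i j) Q - \<mu> i j $ k)
        = (\<Sum>P\<in>?C. mcoeff (f i j $ k) P * mcoeff (mpow \<Phi> P) Q)" by (simp add: algebra_simps)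
    hence "norm (mcoeff (\<Phi> $ k) Q) * max_divisor \<mu> k Q
        = norm (\<Sum>P\<in>?C. mcoeff (f i j $ k) P * mcoeff (mpow \<Phi> P) Q)"
      unfolding ij by (metis norm_mult)
    also have "\<dots> \<le> (\<Sum>P\<in>?C. b k P * norm (mcoeff (mpow \<Phi> P) Q))"
      by (rule order_trans[OF norm_sum sum_mono]) (auto simp: norm_mult intro: mult_right_mono b_ge)
    finally have "norm (mcoeff (\<Phi> $ k) Q)
        \<le> 1 / max_divisor \<mu> k Q * (\<Sum>P\<in>?C. b k P * norm (mcoeff (mpow \<Phi> P) Q))"
      using pos by (simp add: field_simps)
    also have "\<dots> \<le> V k Q * (\<Sum>P\<in>?C. b k P * norm (mcoeff (mpow \<Phi> P) Q))"
      using True b0 by (intro mult_right_mono sum_nonneg) (auto simp: V_def B.node_weight_def)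
    finally show ?thesis .
  qed
  obtain K where K: "0 < K" "\<And>Q. Q \<noteq> 0 \<Longrightarrow> B.max_weight Q \<le> K ^ mdeg Q"
    using B.max_weight_exponential by blast
  have bsum: "\<exists>r>0. (\<lambda>P. b k P * r ^ mdeg P) summable_on UNIV" for k
  proof -
    have "\<exists>r>0. \<forall>x. summable_at r ((\<lambda>(i, j). f i j $ k) x)"
    proof (rule exists_small_radius)
      fix x :: "'m \<times> 'm"
      obtain r where "0 < r" "summable_at r ((\<lambda>(i, j). f i j $ k) x)"
        using f(1)[of "fst x" "snd x" k] by (auto simp: convergent_mfps_iff case_prod_unfold)
      thus "\<exists>r>0. \<forall>s. 0 < s \<longrightarrow> s \<le> r \<longrightarrow> summable_at s ((\<lambda>(i, j). f i j $ k) x)"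
        using summable_at_mono by (meson less_imp_le)
    qed
    then obtain r where r: "0 < r" "\<And>i j. summable_at r (f i j $ k)" by auto
    have "(\<lambda>P. \<Sum>x\<in>UNIV. case x of (i, j) \<Rightarrow> norm (mcoeff (f i j $ k) P) * r ^ mdeg P) summable_on UNIV"
      by (rule summable_on_sum_finite) (use r(2) in \<open>auto simp: summable_at_def\<close>)
    thus ?thesis using r(1) by (auto simp: b_def sum_distrib_right case_prod_unfold)
  qed
  have "\<Phi> $ k \<in> convergent_mfps" for k
    by (rule convergent_majorant[OF ord _ rec b0 bsum K]) (use tan in \<open>auto simp: tangent_id_def\<close>)
  thus thesis using that tan lin by blast
qed


section \<open>Anti-holomorphic involutions\<close>

text \<open>The series of the conjugate of f at the conjugate variables. An antiholomorphic germ is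
  a holomorphic one after a conjugation, so this operation brings the involutions into the calculus
  of power series.\<close>

definition mfps_cnj :: "'n::finite mfps \<Rightarrow> 'n mfps" where
  "mfps_cnj a = Abs_mfps (\<lambda>Q. cnj (mcoeff a Q))"

definition fmap_cnj :: "'n::finite mfps ^ 'n \<Rightarrow> 'n mfps ^ 'n" where
  "fmap_cnj a = (\<chi> k. mfps_cnj (a $ k))"

lemma mcoeff_cnj [simp]: "mcoeff (mfps_cnj a) Q = cnj (mcoeff a Q)"
  by (simp add: mfps_cnj_def)

lemma fmap_cnj_nth [simp]: "fmap_cnj a $ k = mfps_cnj (a $ k)"
  by (simp add: fmap_cnj_def)

lemma mfps_cnj_mult: "mfps_cnj (a * b) = mfps_cnj a * mfps_cnj b"
  by (rule mfps_eqI) (simp add: mcoeff_mult)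

lemma mpow_fmap_cnj: "mpow (fmap_cnj G) P = mfps_cnj (mpow G P)"
proof (induction P rule: multi_index_induct)
  case zero
  show ?case by (rule mfps_eqI) (simp add: mcoeff_1)
qed (simp add: mpow_add mfps_cnj_mult)

lemma fmap_cnj_compose: "fmap_cnj (fmap_compose F G) = fmap_compose (fmap_cnj F) (fmap_cnj G)"
  by (simp add: vec_eq_iff) (auto intro!: mfps_eqI simp: mcoeff_compose mpow_fmap_cnj)

lemma fmap_cnj_cnj [simp]: "fmap_cnj (fmap_cnj G) = G"
  by (simp add: vec_eq_iff mfps_eqI)

lemma ord_pos_cnj [simp]: "ord_pos (fmap_cnj G) \<longleftrightarrow> ord_pos G"
  by (simp add: ord_pos_def)

lemma tangent_id_cnj: "tangent_id (fmap_cnj G) \<longleftrightarrow> tangent_id G"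
  by (auto simp: tangent_id_def split: if_splits)

lemma fmap_cnj_linear: "fmap_cnj (fmap_linear A) = fmap_linear (mcnj A)"
  unfolding vec_eq_iff
  by (auto intro!: mfps_eqI sum.cong simp: mcoeff_monom mcnj_def)

lemma vcnj_vcnj [simp]: "vcnj (vcnj z) = z"
  by (simp add: vcnj_def vec_eq_iff)

lemma vcnj_nth [simp]: "vcnj z $ k = cnj (z $ k)"
  by (simp add: vcnj_def)

lemma norm_vcnj [simp]: "norm (vcnj z) = norm z"
  by (simp add: norm_vec_def)

lemma mpow_vcnj: "mpow (vcnj z) Q = cnj (mpow z Q)"
  by (simp add: mpow_def)

lemma filterlim_vcnj: "filterlim vcnj (nhds 0) (nhds (0 :: complex ^ 'n::finite))"
  unfolding filterlim_iff eventually_nhds_metric by (auto simp: dist_norm)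

lemma has_expansion_vcnj:
  assumes "f has_mfps_expansion a"
  shows "(\<lambda>z. cnj (f (vcnj z))) has_mfps_expansion mfps_cnj a"
proof -
  have "\<forall>\<^sub>F z in nhds 0. ((\<lambda>Q. mcoeff a Q * mpow (vcnj z) Q) has_sum f (vcnj z)) UNIV"
    using assms filterlim_vcnj unfolding has_mfps_expansion_def filterlim_iff by blast
  thus ?thesis unfolding has_mfps_expansion_def
  proof (rule eventually_mono)
    fix z assume "((\<lambda>Q. mcoeff a Q * mpow (vcnj z) Q) has_sum f (vcnj z)) UNIV"
    hence "((\<lambda>Q. cnj (mcoeff a Q * mpow (vcnj z) Q)) has_sum cnj (f (vcnj z))) UNIV"
      by (simp only: has_sum_cnj_iff)
    thus "((\<lambda>Q. mcoeff (mfps_cnj a) Q * mpow z Q) has_sum cnj (f (vcnj z))) UNIV"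
      by (simp add: mpow_vcnj)
  qed
qed

lemma map_expansion_vcnj:
  "map_has_expansion f a \<Longrightarrow> map_has_expansion (\<lambda>z. vcnj (f (vcnj z))) (fmap_cnj a)"
  using has_expansion_vcnj unfolding map_has_expansion_def by fastforce

text \<open>The lowest-order term of \<open>s - B\<close> outside the ideal commutes with the linear parts, so it
  vanishes by nonresonance. The terms of \<open>G j\<close> inside the ideal do not interfere: since
  they have degree at least two, \<open>s\<close> may be replaced by \<open>B\<close> in them, and \<open>B\<close> preserves the ideal.\<close>

lemma linear_modulo_ideal:
  fixes s :: "'n::finite mfps ^ 'n" and G H :: "'j \<Rightarrow> 'n mfps ^ 'n"
  assumes N: "hereditary N" and s: "ord_pos s" "\<And>k l. mcoeff (s $ k) (axis l 1) = B $ k $ l"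
    and G: "\<And>j. ord_pos (G j)" "\<And>j k l. mcoeff (G j $ k) (axis l 1) = (if k = l then \<mu> j $ k else 0)"
      "\<And>j k. G j $ k - fmap_linear (diag_matrix (\<mu> j)) $ k \<in> vanishing N"
    and H: "\<And>j k. H j $ k - fmap_linear (diag_matrix (\<nu> j)) $ k \<in> vanishing N"
    and comm: "\<And>j. fmap_compose (G j) s = fmap_compose s (H j)"
    and inv: "\<And>Q. Q \<notin> N \<Longrightarrow> mpow (fmap_linear B) Q \<in> vanishing N"
    and nonres: "\<And>Q k. Q \<in> N \<Longrightarrow> 2 \<le> mdeg Q \<Longrightarrow> \<exists>j. \<mu> j $ k \<noteq> mpow (\<nu> j) Q"
  shows "s $ k - fmap_linear B $ k \<in> vanishing N"
proof -
  let ?L = "fmap_linear B"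
  have "\<forall>k. s $ k - ?L $ k \<in> vanishing {Q \<in> N. mdeg Q < d}" for d
  proof (induction d)
    case 0
    show ?case by (simp add: vanishing_def)
  next
    case (Suc d)
    have "mcoeff (s $ k - ?L $ k) Q = 0" if Q: "Q \<in> N" "mdeg Q < Suc d" for Q k
    proof (cases Q rule: low_degree_cases)
      case 1
      thus ?thesis using s(1) mcoeff_linear_0[of B k] by (simp add: ord_pos_def del: fmap_linear_nth)
    next
      case (2 l)
      thus ?thesis using s(2) mcoeff_linear_axis[of B k l] by (simp del: fmap_linear_nth)
    next
      case 3
      hence Q0: "Q \<noteq> 0" by auto
      obtain j where j: "\<mu> j $ k \<noteq> mpow (\<nu> j) Q" using nonres[OF Q(1) 3] by blast
      have "mcoeff (G j $ k) P * mcoeff (mpow s P) Q = 0" if P: "2 \<le> mdeg P" for P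
      proof (cases "P \<in> N")
        case True
        thus ?thesis using G(3)[of j k] mcoeff_linear_high[OF P, of "diag_matrix (\<mu> j)" k]
          by (simp add: vanishing_def del: fmap_linear_nth)
      next
        case False
        have "mpow s P - mpow ?L P \<in> vanishing {Q \<in> N. mdeg Q < Suc d}"
        proof (rule mpow_cong_shift[where N = "{Q \<in> N. mdeg Q < d}"])
          show "hereditary {Q \<in> N. mdeg Q < d}"
            using N by (auto simp: hereditary_def mdeg_add)
          show "Q \<in> {Q \<in> N. mdeg Q < d}" if "P \<noteq> 0" "P + Q \<in> {Q \<in> N. mdeg Q < Suc d}" for P Q
            using that mdeg_pos[OF that(1)] hereditaryD(2)[OF N] by (auto simp: mdeg_add)
        qed (use Suc s(1) P in auto)
        thus ?thesis using inv[OF False] Q by (auto simp: vanishing_def)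
      qed
      hence "mcoeff (mfps_compose (G j $ k) s) Q = (\<Sum>l\<in>UNIV. mcoeff (G j $ k) (axis l 1) * mcoeff (s $ l) Q)"
        by (subst compose_split) (use G(1)[of j] Q0 in \<open>auto simp: ord_pos_def intro!: sum.neutral\<close>)
      also have "\<dots> = (\<Sum>l\<in>UNIV. if k = l then \<mu> j $ k * mcoeff (s $ k) Q else 0)"
        unfolding G(2) by (rule sum.cong) auto
      also have "\<dots> = \<mu> j $ k * mcoeff (s $ k) Q" by simp
      finally have "\<mu> j $ k * mcoeff (s $ k) Q = mcoeff (mfps_compose (s $ k) (H j)) Q"
        using comm[of j] by (metis fmap_compose_nth)
      also have "\<dots> = mcoeff (s $ k) Q * mpow (\<nu> j) Q"
        using compose_cong_vanishing[OF N H, of "s $ k" j] Q(1)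
        by (simp add: vanishing_def compose_diag del: fmap_linear_nth)
      finally have "mcoeff (s $ k) Q = 0" using j by (simp add: mult.commute)
      thus ?thesis using mcoeff_linear_high[OF 3, of B k] by (simp del: fmap_linear_nth)
    qed
    thus ?case by (auto simp: vanishing_def)
  qed
  hence "\<And>Q. Q \<in> N \<Longrightarrow> mcoeff (s $ k - ?L $ k) Q = 0"
    unfolding vanishing_def by blast
  thus ?thesis by (auto simp: vanishing_def)
qed

section \<open>Eigenvalues of the compositions\<close>

lemma mcnj_mult: "mcnj (A ** B) = mcnj A ** mcnj B"
  by (simp add: mcnj_def matrix_matrix_mult_def vec_eq_iff)

lemma mcnj_mcnj [simp]: "mcnj (mcnj A) = A"
  by (simp add: mcnj_def vec_eq_iff)

lemma mcnj_mat_1 [simp]: "mcnj (mat 1) = mat 1"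
  by (auto simp: mcnj_def mat_def vec_eq_iff)

lemma diag_matrix_nth: "diag_matrix v $ k $ l = (if k = l then v $ k else 0)"
  by (simp add: diag_matrix_def)

lemma diag_mult_nth: "(diag_matrix v ** A) $ k $ l = v $ k * A $ k $ l"
proof -
  have "(diag_matrix v ** A) $ k $ l = (\<Sum>i\<in>UNIV. if k = i then v $ k * A $ k $ l else 0)"
    unfolding matrix_matrix_mult_def vec_lambda_beta by (rule sum.cong) (auto simp: diag_matrix_nth)
  thus ?thesis by simp
qed

lemma mult_diag_nth: "(A ** diag_matrix v) $ k $ l = A $ k $ l * v $ l"
proof -
  have "(A ** diag_matrix v) $ k $ l = (\<Sum>i\<in>UNIV. if i = l then A $ k $ l * v $ l else 0)"
    unfolding matrix_matrix_mult_def vec_lambda_beta by (rule sum.cong) (auto simp: diag_matrix_nth)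
  thus ?thesis by simp
qed

lemma mcnj_diag: "mcnj (diag_matrix v) = diag_matrix (vcnj v)"
  by (auto simp: mcnj_def diag_matrix_def vec_eq_iff)

locale diagonal_involutions =
  fixes B :: "'m::finite \<Rightarrow> complex ^ 'n ^ 'n::finite" and \<mu> :: "'m \<Rightarrow> 'm \<Rightarrow> complex ^ 'n"
  assumes B: "\<And>i. B i ** mcnj (B i) = mat 1"
    and D: "\<And>i j. B i ** mcnj (B j) = diag_matrix (\<mu> i j)"
begin

lemma B': "mcnj (B i) ** B i = mat 1"
  using arg_cong[OF B[of i], of mcnj] by (simp add: mcnj_mult)

lemma \<mu>_inverse: "\<mu> i j $ k * \<mu> j i $ k = 1"
proof -
  have "diag_matrix (\<mu> i j) ** diag_matrix (\<mu> j i) = B i ** (mcnj (B j) ** B j) ** mcnj (B i)"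
    by (simp add: D[symmetric] matrix_mul_assoc)
  also have "\<dots> = mat 1" by (simp add: B' B)
  finally show ?thesis using diag_mult_nth[of "\<mu> i j" "diag_matrix (\<mu> j i)" k k]
    by (simp add: diag_matrix_nth mat_def)
qed

lemma \<mu>_nonzero: "\<mu> i j $ k \<noteq> 0"
  using \<mu>_inverse[of i j k] by auto

lemma \<mu>_intertwine: "\<mu> i j $ k * B i $ k $ l = B i $ k $ l * cnj (\<mu> j i $ l)"
proof -
  have "diag_matrix (\<mu> i j) ** B i = B i ** mcnj (diag_matrix (\<mu> j i))"
    by (simp add: D[symmetric] mcnj_mult matrix_mul_assoc)
  from arg_cong[OF this, of "\<lambda>A. A $ k $ l"] show ?thesis
    by (simp add: mcnj_diag diag_mult_nth mult_diag_nth)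
qed

lemma mpow_\<mu>_inverse: "mpow (\<mu> i j) Q * mpow (\<mu> j i) Q = 1"
  by (simp add: mpow_def prod.distrib[symmetric] power_mult_distrib[symmetric] \<mu>_inverse)

text \<open>\<open>\<mu> i j\<close> and \<open>\<mu> j i\<close> are inverse to each other. The
  condition thus compares \<open>D i j\<close> with the conjugate of \<open>D j i\<close>, the two
  linear maps that \<open>B i\<close> intertwines.\<close>

lemma nonresonant_iff:
  "cnj (mpow (\<mu> i j) Q) \<noteq> inverse (\<mu> i j $ k) \<longleftrightarrow> \<mu> i j $ k \<noteq> mpow (vcnj (\<mu> j i)) Q"
proof -
  have "cnj (mpow (\<mu> i j) Q) * mpow (vcnj (\<mu> j i)) Q = 1"
    using arg_cong[OF mpow_\<mu>_inverse[of i j Q], of cnj] by (simp add: mpow_vcnj)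
  hence "mpow (vcnj (\<mu> j i)) Q = inverse (cnj (mpow (\<mu> i j) Q))"
    by (metis inverse_unique mult.commute)
  thus ?thesis by (metis inverse_inverse_eq)
qed

text \<open>If \<open>x\<^sup>Q e\<^sub>l\<close> commutes with all \<open>D i j\<close>, then \<open>B i\<close> applied to its conjugate is a resonance of the
  involutions: some component \<open>k\<close> with \<open>B i $ k $ l \<noteq> 0\<close> violates nonresonance.\<close>

lemma max_divisor_pos:
  assumes "\<And>i k. \<exists>j. cnj (mpow (\<mu> i j) Q) \<noteq> inverse (\<mu> i j $ k)"
  shows "0 < max_divisor \<mu> l Q"
proof (rule ccontr)
  assume "\<not> 0 < max_divisor \<mu> l Q"
  hence zero: "mpow (\<mu> i j) Q = \<mu> i j $ l" for i j
    using max_divisor_ge[of \<mu> i j Q l] by (smt (verit) norm_le_zero_iff eq_iff_diff_eq_0)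
  \<comment> \<open>Any index works, since nonresonance is assumed for every i and k.\<close>
  define i where "i = (SOME i :: 'm. True)"
  have "\<exists>k. B i $ k $ l \<noteq> 0"
  proof (rule ccontr)
    assume "\<not> ?thesis"
    hence "(mcnj (B i) ** B i) $ l $ l = 0" by (simp add: matrix_matrix_mult_def)
    thus False by (simp add: B' mat_def)
  qed
  then obtain k where k: "B i $ k $ l \<noteq> 0" by blast
  hence "\<mu> i j $ k = mpow (vcnj (\<mu> j i)) Q" for j
    using \<mu>_intertwine[of i j k l] by (simp add: mpow_vcnj zero)
  thus False using assms[of i k] nonresonant_iff by blast
qed

end


section \<open>Linearization of the family\<close>

lemma expansion_eventually_eq:
  assumes "map_has_expansion f a" "map_has_expansion g a"
  shows "\<forall>\<^sub>F z in nhds 0. f z = g z"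
proof -
  have "\<forall>\<^sub>F z in nhds 0. f z = (\<chi> k. meval (a $ k) z)" "\<forall>\<^sub>F z in nhds 0. g z = (\<chi> k. meval (a $ k) z)"
    using assms by (auto simp: map_has_expansion_iff)
  thus ?thesis by eventually_elim simp
qed

lemma map_meval_expansion:
  "(\<And>k. a $ k \<in> convergent_mfps) \<Longrightarrow> map_has_expansion (\<lambda>z. \<chi> k. meval (a $ k) z) a"
  by (simp add: map_has_expansion_iff)

lemma axis_coeff_compose:
  assumes "ord_pos F"
  shows "mcoeff (fmap_compose F G $ k) (axis l 1)
    = (\<Sum>i\<in>UNIV. mcoeff (F $ k) (axis i 1) * mcoeff (G $ i) (axis l 1))"
  using assms mcoeff_compose_axis[of "F $ k" G l] by (simp add: ord_pos_def)

lemma axis_coeff_tangent_left: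
  "tangent_id F \<Longrightarrow> mcoeff (fmap_compose F G $ k) (axis l 1) = mcoeff (G $ k) (axis l 1)"
proof -
  assume F: "tangent_id F"
  have "mcoeff (fmap_compose F G $ k) (axis l 1)
      = (\<Sum>i\<in>UNIV. if k = i then mcoeff (G $ k) (axis l 1) else 0)"
    using F unfolding tangent_id_def by (subst axis_coeff_compose, blast, intro sum.cong) auto
  thus ?thesis by simp
qed

lemma axis_coeff_tangent_right:
  "tangent_id G \<Longrightarrow> ord_pos F \<Longrightarrow> mcoeff (fmap_compose F G $ k) (axis l 1) = mcoeff (F $ k) (axis l 1)"
proof -
  assume G: "tangent_id G" and F: "ord_pos F"
  have "mcoeff (fmap_compose F G $ k) (axis l 1)
      = (\<Sum>i\<in>UNIV. if i = l then mcoeff (F $ k) (axis l 1) else 0)"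
    using G unfolding tangent_id_def axis_coeff_compose[OF F] by (intro sum.cong) auto
  thus ?thesis by simp
qed

lemma holo_diffeo_of_series:
  assumes \<Phi>: "map_has_expansion \<phi> \<Phi>" "ord_pos \<Phi>" and \<Psi>: "map_has_expansion \<psi> \<Psi>" "ord_pos \<Psi>"
    and inv: "fmap_compose \<Phi> \<Psi> = fmap_linear (mat 1)" "fmap_compose \<Psi> \<Phi> = fmap_linear (mat 1)"
  shows "holo_diffeo \<phi> \<psi>"
proof -
  have id: "map_has_expansion (\<lambda>z. z) (fmap_linear (mat 1 :: complex ^ 'a ^ 'a))"
    using has_expansion_linear[of "mat 1"] by simp
  have "\<forall>\<^sub>F z in nhds 0. \<psi> (\<phi> z) = z" "\<forall>\<^sub>F z in nhds 0. \<phi> (\<psi> z) = z"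
    using expansion_eventually_eq[OF map_expansion_compose[OF \<Psi>(1) \<Phi>] id[folded inv(2)]]
      expansion_eventually_eq[OF map_expansion_compose[OF \<Phi>(1) \<Psi>] id[folded inv(1)]] by simp_all
  moreover have "\<phi> 0 = 0" "\<psi> 0 = 0" using ord_pos_expansion \<Phi> \<Psi> by blast+
  ultimately show ?thesis using \<Phi>(1) \<Psi>(1) unfolding holo_diffeo_def holo_map_def by blast
qed

lemma cong_mod_of_series:
  assumes "finite S" "map_has_expansion f a" "map_has_expansion g b"
    and "\<And>k. a $ k - b $ k \<in> vanishing (outside S)"
  shows "cong_mod (monomial_ideal convergent_mfps S) f g"
  unfolding cong_mod_def
proof
  fix k
  have "(\<lambda>z. f z $ k - g z $ k) has_mfps_expansion a $ k - b $ k"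
    using assms(2,3) by (auto simp: map_has_expansion_def intro: has_expansion_diff)
  thus "\<exists>c\<in>monomial_ideal convergent_mfps S. (\<lambda>z. f z $ k - g z $ k) has_mfps_expansion c"
    using assms(4) has_expansion_convergent monomial_ideal_iff[OF assms(1)] by blast
qed

lemma cong_mod_cnj_of_series:
  assumes "cong_mod I f g" "\<forall>\<^sub>F z in nhds 0. f' z = f (vcnj z)" "\<forall>\<^sub>F z in nhds 0. g' z = g (vcnj z)"
  shows "cong_mod_cnj I f' g'"
  unfolding cong_mod_cnj_def
proof
  fix k
  obtain a where a: "a \<in> I" "(\<lambda>z. f z $ k - g z $ k) has_mfps_expansion a"
    using assms(1) unfolding cong_mod_def by blast
  from a(2) have "\<forall>\<^sub>F z in nhds 0. ((\<lambda>Q. mcoeff a Q * mpow (vcnj z) Q)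
      has_sum (f (vcnj z) $ k - g (vcnj z) $ k)) UNIV"
    using filterlim_vcnj unfolding has_mfps_expansion_def filterlim_iff by blast
  with assms(2,3) have "\<forall>\<^sub>F z in nhds 0. ((\<lambda>Q. mcoeff a Q * mpow (vcnj z) Q)
      has_sum (f' z $ k - g' z $ k)) UNIV"
    by eventually_elim simp
  thus "\<exists>a\<in>I. \<forall>\<^sub>F z in nhds 0. ((\<lambda>Q. mcoeff a Q * mpow (vcnj z) Q) has_sum (f' z $ k - g' z $ k)) UNIV"
    using a(1) by blast
qed

lemma involution_expansion:
  assumes "antiholo_involution \<rho> B R"
  obtains r where "map_has_expansion (\<lambda>w. B *v w + R w) r" "ord_pos r"
    "\<And>k l. mcoeff (r $ k) (axis l 1) = B $ k $ l"
proof -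
  obtain c where c: "map_has_expansion R c" and R0: "R 0 = 0"
    and R': "(R has_derivative (\<lambda>h. 0)) (at 0)"
    using assms unfolding antiholo_involution_def holo_map_def by blast
  have ord: "ord_pos c" using ord_pos_expansion[OF c] R0 by simp
  have "(\<lambda>h. (\<chi> k l. mcoeff (c $ k) (axis l 1)) *v h) = (\<lambda>h. 0)"
    by (rule has_derivative_unique[OF expansion_has_derivative[OF c ord] R'])
  hence "(\<chi> k l. mcoeff (c $ k) (axis l 1)) = 0" by (metis matrix_eq matrix_vector_mult_0)
  hence c1: "mcoeff (c $ k) (axis l 1) = 0" for k l by (simp add: vec_eq_iff)
  define r where "r = fmap_linear B + c"
  have "map_has_expansion (\<lambda>w. B *v w + R w) r"
    unfolding map_has_expansion_def r_def vector_add_component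
    using has_expansion_linear[of B] c
    by (intro allI has_expansion_add) (auto simp: map_has_expansion_def)
  moreover have "ord_pos r"
    using ord ord_pos_linear[of B] by (simp add: ord_pos_def r_def del: fmap_linear_nth)
  moreover have "mcoeff (r $ k) (axis l 1) = B $ k $ l" for k l
    using mcoeff_linear_axis[of B k l] c1 by (simp add: r_def del: fmap_linear_nth)
  ultimately show thesis by (rule that)
qed

theorem theorem3p2:
  fixes M :: "'m::finite \<Rightarrow> (complex ^ 'n::finite) set"
    and \<rho> R :: "'m \<Rightarrow> complex ^ 'n \<Rightarrow> complex ^ 'n"
    and B :: "'m \<Rightarrow> complex ^ 'n ^ 'n"
    and F :: "'m \<Rightarrow> 'm \<Rightarrow> complex ^ 'n \<Rightarrow> complex ^ 'n"
    and D :: "'m \<Rightarrow> 'm \<Rightarrow> complex ^ 'n ^ 'n"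
    and \<mu> :: "'m \<Rightarrow> 'm \<Rightarrow> complex ^ 'n"
    and S :: "(nat ^ 'n) set"
    and I :: "'n mfps set"
  assumes "\<And>i. totally_real_germ (M i)"
    and "\<And>i. antiholo_involution (\<rho> i) (B i) (R i)"
    and "\<And>i. \<forall>\<^sub>F z in nhds 0. z \<in> M i \<longleftrightarrow> \<rho> i z = z"
    and "\<And>i j. i \<noteq> j \<Longrightarrow> {z. z = B i *v vcnj z} \<noteq> {z. z = B j *v vcnj z}"
    and "\<And>i j. F i j = \<rho> i \<circ> \<rho> j"
    and "\<And>i j. D i j = B i ** mcnj (B j)"
    and "abelian_germs (germ_group {F i j | i j. True})"
    and "\<And>i j. D i j = diag_matrix (\<mu> i j)"
    and "finite S" and "I = monomial_ideal convergent_mfps S"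
    and "\<And>i j. left_invariant I (D i j)"
    and "\<And>i. left_invariant I (B i)"
    and "diophantine \<mu> UNIV \<or> properly_embedded I \<and> diophantine \<mu> (exponents_outside I)"
    and "nonresonant_on \<mu> I"
    and "formally_linearizable_on (monomial_ideal UNIV S) F D"
  shows "\<exists>\<Phi> \<Psi>. holo_linearization I F D \<Phi> \<Psi> \<and>
           (\<forall>i. cong_mod_cnj I (\<Psi> \<circ> \<rho> i \<circ> \<Phi>) (\<lambda>z. B i *v vcnj z))"
proof -
  note involution = assms(2) and F = assms(5) and D_eq = assms(6) and diag = assms(8)
    and S = assms(9) and I = assms(10)
  define N where "N = outside S"
  have N: "hereditary N" unfolding N_def by (rule hereditary_outside)
  have out: "exponents_outside I = N"
    unfolding I N_def by (rule exponents_outside_monomial_ideal[OF S])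
  have I_iff: "a \<in> I \<longleftrightarrow> a \<in> convergent_mfps \<and> a \<in> vanishing N" for a
    unfolding I N_def by (rule monomial_ideal_iff[OF S])
  interpret diagonal_involutions B \<mu>
    by unfold_locales (use involution D_eq[symmetric] diag in \<open>auto simp: antiholo_involution_def\<close>)
  have nonres: "\<exists>j. cnj (mpow (\<mu> i j) Q) \<noteq> inverse (\<mu> i j $ k)" if "Q \<in> N" "2 \<le> mdeg Q" for Q i k
    using assms(14) that unfolding nonresonant_on_def out by blast
  have pos: "0 < max_divisor \<mu> l Q" if "Q \<in> N" "2 \<le> mdeg Q" for Q l
    by (rule max_divisor_pos) (rule nonres[OF that])
  \<comment> \<open>Either alternative bounds the divisors on a set of exponents that contains
    N.\<close>
  obtain A where A: "diophantine \<mu> A" "N \<subseteq> A" using assms(13) unfolding out by blast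
  obtain \<theta> where \<theta>: "small_divisor_bounds N (max_divisor \<mu>) \<theta>"
    using ex_small_divisor_bounds[OF A N pos \<mu>_nonzero] by blast

  \<comment> \<open>Power series of the involutions and of their compositions\<close>
  have "\<forall>i. \<exists>r. map_has_expansion (\<lambda>w. B i *v w + R i w) r \<and> ord_pos r
      \<and> (\<forall>k l. mcoeff (r $ k) (axis l 1) = B i $ k $ l)"
    using involution_expansion[OF involution] by metis
  then obtain r where r: "\<And>i. map_has_expansion (\<lambda>w. B i *v w + R i w) (r i)" "\<And>i. ord_pos (r i)"
    "\<And>i k l. mcoeff (r i $ k) (axis l 1) = B i $ k $ l"
    unfolding choice_iff by blast
  let ?r = "\<lambda>i w. B i *v w + R i w"
  have \<rho>: "\<forall>\<^sub>F z in nhds 0. \<rho> i z = ?r i (vcnj z)" for i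
    using involution[of i] by (simp add: antiholo_involution_def)
  note rc = map_expansion_vcnj[OF r(1)]
  \<comment> \<open>In \<rho> i \<circ> \<rho> j the two conjugations combine: it is the map of
    \<open>r i\<close> after the map of the conjugate series of \<open>r j\<close>.\<close>
  have F_expansion: "map_has_expansion (F i j) (fmap_compose (r i) (fmap_cnj (r j)))" for i j
  proof (rule map_expansion_cong[OF _ map_expansion_compose[OF r(1) rc]])
    have "filterlim (\<lambda>z. vcnj (vcnj (?r j (vcnj z)))) (nhds 0) (nhds 0)"
      by (rule filterlim_compose[OF filterlim_vcnj map_expansion_tendsto_0[OF rc]]) (simp add: r(2))
    hence "filterlim (\<lambda>z. ?r j (vcnj z)) (nhds 0) (nhds 0)" by simp
    hence "\<forall>\<^sub>F z in nhds 0. \<rho> i (?r j (vcnj z)) = ?r i (vcnj (?r j (vcnj z)))"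
      by (rule eventually_compose_filterlim[OF \<rho>])
    with \<rho>[of j] show "\<forall>\<^sub>F z in nhds 0. (?r i \<circ> (\<lambda>z. vcnj (?r j (vcnj z)))) z = F i j z"
      by eventually_elim (simp add: F)
  qed (simp add: r(2))
  define f where "f i j = fmap_compose (r i) (fmap_cnj (r j))" for i j
  have f: "map_has_expansion (F i j) (f i j)" "ord_pos (f i j)"
    "mcoeff (f i j $ k) (axis l 1) = (if k = l then \<mu> i j $ k else 0)" for i j k l
  proof -
    show "map_has_expansion (F i j) (f i j)" unfolding f_def by (rule F_expansion)
    show "ord_pos (f i j)" unfolding f_def by (rule ord_pos_compose[OF r(2)])
    have "mcoeff (f i j $ k) (axis l 1) = (B i ** mcnj (B j)) $ k $ l"
      unfolding f_def axis_coeff_compose[OF r(2)]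
      using r(3) by (simp add: matrix_matrix_mult_def mcnj_def del: One_nat_def)
    also have "\<dots> = (if k = l then \<mu> i j $ k else 0)"
      by (simp add: D diag_matrix_nth)
    finally show "mcoeff (f i j $ k) (axis l 1) = (if k = l then \<mu> i j $ k else 0)" .
  qed
  have f_conv: "f i j $ k \<in> convergent_mfps" for i j k
    using f(1) by (simp add: map_has_expansion_iff)

  \<comment> \<open>From the formal to a convergent linearization\<close>
  obtain \<Phi>' \<Psi>' where formal: "formal_linearization (monomial_ideal UNIV S) F D \<Phi>' \<Psi>'"
    using assms(15) unfolding formally_linearizable_on_def by blast
  have \<Phi>': "tangent_id \<Phi>'" and \<Psi>': "ord_pos \<Psi>'" and \<Phi>\<Psi>': "fmap_compose \<Phi>' \<Psi>' = fmap_linear (mat 1)"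
    using formal by (auto simp: formal_linearization_def tangent_to_id_def tangent_id_def ord_pos_def)
  have ord\<Phi>': "ord_pos \<Phi>'" using \<Phi>' by (simp add: tangent_id_def)
  have formal_conj: "mfps_compose (f i j $ k) \<Phi>'
      - mfps_compose (\<Phi>' $ k) (fmap_linear (diag_matrix (\<mu> i j))) \<in> vanishing N" for i j k
  proof -
    obtain g where g: "map_has_expansion (F i j) g"
      "\<And>k. fmap_compose \<Psi>' (fmap_compose g \<Phi>') $ k - fmap_linear (D i j) $ k \<in> monomial_ideal UNIV S"
      using formal unfolding formal_linearization_def by blast
    have "g = f i j" by (rule map_expansion_unique[OF g(1) f(1)])
    hence "fmap_compose \<Psi>' (fmap_compose (f i j) \<Phi>') $ k - fmap_linear (diag_matrix (\<mu> i j)) $ k \<in> vanishing N" for k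
      using g(2)[of k] formal_monomial_ideal_iff[OF S] by (simp add: N_def diag del: fmap_linear_nth)
    \<comment> \<open>Composing with \<Phi>' clears the inverse; the resulting equation f \<Phi>' =
      \<Phi>' D modulo the ideal can be truncated.\<close>
    from compose_cong_vanishing[OF N this, of "\<Phi>' $ k"]
    have "fmap_compose \<Phi>' (fmap_compose \<Psi>' (fmap_compose (f i j) \<Phi>')) $ k
        - fmap_compose \<Phi>' (fmap_linear (diag_matrix (\<mu> i j))) $ k \<in> vanishing N" by simp
    moreover have "fmap_compose \<Phi>' (fmap_compose \<Psi>' (fmap_compose (f i j) \<Phi>')) = fmap_compose (f i j) \<Phi>'"
      using ord_pos_compose[OF f(2)]
      by (simp add: fmap_compose_assoc[OF \<Psi>', symmetric] \<Phi>\<Psi>' fmap_id_compose)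
    ultimately show ?thesis by simp
  qed
  obtain \<Phi> where \<Phi>: "tangent_id \<Phi>" "\<And>k. \<Phi> $ k \<in> convergent_mfps" and
    conj: "\<And>i j k. mfps_compose (f i j $ k) \<Phi>
      - mfps_compose (\<Phi> $ k) (fmap_linear (diag_matrix (\<mu> i j))) \<in> vanishing N"
    using convergent_linearization[OF N \<theta> f_conv f(2,3) \<Phi>' formal_conj] by blast
  obtain \<Psi> where \<Psi>: "tangent_id \<Psi>" "\<And>k. \<Psi> $ k \<in> convergent_mfps"
    and inv: "fmap_compose \<Phi> \<Psi> = fmap_linear (mat 1)" "fmap_compose \<Psi> \<Phi> = fmap_linear (mat 1)"
    using convergent_inverse[OF \<Phi>] by blast
  have ord: "ord_pos \<Phi>" "ord_pos \<Psi>" using \<Phi>(1) \<Psi>(1) by (simp_all add: tangent_id_def)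
  define \<phi> where "\<phi> z = (\<chi> k. meval (\<Phi> $ k) z)" for z
  define \<psi> where "\<psi> z = (\<chi> k. meval (\<Psi> $ k) z)" for z
  have \<phi>: "map_has_expansion \<phi> \<Phi>" and \<psi>: "map_has_expansion \<psi> \<Psi>"
    using map_meval_expansion \<Phi>(2) \<Psi>(2) unfolding \<phi>_def \<psi>_def by blast+
  have diffeo: "holo_diffeo \<phi> \<psi>" by (rule holo_diffeo_of_series[OF \<phi> ord(1) \<psi> ord(2) inv])

  \<comment> \<open>The family in the new coordinates\<close>
  define G where "G i j = fmap_compose \<Psi> (fmap_compose (f i j) \<Phi>)" for i j
  have ord_f\<Phi>: "ord_pos (fmap_compose (f i j) \<Phi>)" for i j by (rule ord_pos_compose[OF f(2)])
  have G_expansion: "map_has_expansion (\<psi> \<circ> F i j \<circ> \<phi>) (G i j)" for i j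
    unfolding G_def comp_assoc
    by (intro map_expansion_compose \<psi> \<phi> f(1) ord ord_f\<Phi>)
  have G_ord: "ord_pos (G i j)" for i j unfolding G_def by (rule ord_pos_compose[OF ord(2)])
  have G_lin: "mcoeff (G i j $ k) (axis l 1) = (if k = l then \<mu> i j $ k else 0)" for i j k l
    unfolding G_def axis_coeff_tangent_left[OF \<Psi>(1)] axis_coeff_tangent_right[OF \<Phi>(1) f(2)] by (rule f(3))
  have G_mod: "G i j $ k - fmap_linear (diag_matrix (\<mu> i j)) $ k \<in> vanishing N" for i j k
  proof -
    let ?L = "fmap_linear (diag_matrix (\<mu> i j))"
    have "mfps_compose (\<Psi> $ k) (fmap_compose (f i j) \<Phi>) - mfps_compose (\<Psi> $ k) (fmap_compose \<Phi> ?L) \<in> vanishing N"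
      by (rule compose_cong_vanishing[OF N]) (use conj in simp)
    moreover have "fmap_compose \<Psi> (fmap_compose \<Phi> ?L) = ?L"
      by (simp add: fmap_compose_assoc[OF ord(1), symmetric] inv(2) fmap_id_compose)
    ultimately show ?thesis by (metis G_def fmap_compose_nth)
  qed
  have lin: "holo_linearization I F D \<phi> \<psi>"
    unfolding holo_linearization_def
  proof (intro conjI allI)
    show "holo_diffeo \<phi> \<psi>" by (rule diffeo)
    have "(\<chi> k l. mcoeff (\<Phi> $ k) (axis l 1)) = (mat 1 :: complex ^ 'n ^ 'n)"
      using \<Phi>(1) by (simp add: tangent_id_def mat_def vec_eq_iff)
    thus "(\<phi> has_derivative id) (at 0)"
      using expansion_has_derivative[OF \<phi> ord(1)] by (simp add: id_def)
    show "cong_mod I (\<psi> \<circ> F i j \<circ> \<phi>) (\<lambda>z. D i j *v z)" for i j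
      unfolding I
      by (rule cong_mod_of_series[OF S G_expansion has_expansion_linear])
        (use G_mod in \<open>simp add: N_def diag del: fmap_linear_nth\<close>)
  qed

  \<comment> \<open>The involutions in the new coordinates\<close>
  define \<Phi>c where "\<Phi>c = fmap_cnj \<Phi>"
  have \<Phi>c: "map_has_expansion (\<lambda>z. vcnj (\<phi> (vcnj z))) \<Phi>c" "tangent_id \<Phi>c" "ord_pos \<Phi>c"
    unfolding \<Phi>c_def using map_expansion_vcnj[OF \<phi>] \<Phi>(1) ord(1) by (simp_all add: tangent_id_cnj)
  \<comment> \<open>The series of \<psi> \<circ> \<rho> i \<circ> \<phi> in the conjugate
    variables.\<close>
  define s where "s i = fmap_compose \<Psi> (fmap_compose (r i) \<Phi>c)" for i
  have ord_r\<Phi>c: "ord_pos (fmap_compose (r i) \<Phi>c)" for i by (rule ord_pos_compose[OF r(2)])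
  have s_expansion: "map_has_expansion (\<psi> \<circ> (?r i \<circ> (\<lambda>z. vcnj (\<phi> (vcnj z))))) (s i)" for i
    unfolding s_def by (intro map_expansion_compose \<psi> \<Phi>c r(1) ord_r\<Phi>c)
  have s_mod: "s i $ k - fmap_linear (B i) $ k \<in> vanishing N" for i k
  proof (rule linear_modulo_ideal[where G = "\<lambda>j. G i j" and H = "\<lambda>j. fmap_cnj (G j i)"
        and \<mu> = "\<lambda>j. \<mu> i j" and \<nu> = "\<lambda>j. vcnj (\<mu> j i)"])
    show "hereditary N" by (rule N)
    show "ord_pos (s i)" unfolding s_def by (rule ord_pos_compose[OF ord(2)])
    show "mcoeff (s i $ k) (axis l 1) = B i $ k $ l" for k l
      unfolding s_def axis_coeff_tangent_left[OF \<Psi>(1)] axis_coeff_tangent_right[OF \<Phi>c(2) r(2)] by (rule r(3))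
    show "ord_pos (G i j)" for j by (rule G_ord)
    show "mcoeff (G i j $ k) (axis l 1) = (if k = l then \<mu> i j $ k else 0)" for j k l by (rule G_lin)
    show "G i j $ k - fmap_linear (diag_matrix (\<mu> i j)) $ k \<in> vanishing N" for j k by (rule G_mod)
    show "fmap_cnj (G j i) $ k - fmap_linear (diag_matrix (vcnj (\<mu> j i))) $ k \<in> vanishing N" for j k
    proof -
      have "fmap_linear (diag_matrix (vcnj (\<mu> j i))) = fmap_cnj (fmap_linear (diag_matrix (\<mu> j i)))"
        by (simp add: fmap_cnj_linear mcnj_diag)
      hence "mcoeff (fmap_cnj (G j i) $ k - fmap_linear (diag_matrix (vcnj (\<mu> j i))) $ k) Q
          = cnj (mcoeff (G j i $ k - fmap_linear (diag_matrix (\<mu> j i)) $ k) Q)" for Q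
        by (simp del: fmap_linear_nth)
      thus ?thesis using G_mod[of j i k] by (simp add: vanishing_def del: fmap_linear_nth)
    qed
    \<comment> \<open>Up to the change of coordinates, this is F i j \<circ> \<rho> i = \<rho> i
      \<circ> \<rho> j \<circ> \<rho> i = \<rho> i \<circ> F j i; moving the conjugation past F j i
      conjugates its series.\<close>
    show "fmap_compose (G i j) (s i) = fmap_compose (s i) (fmap_cnj (G j i))" for j
    proof -
      have "fmap_compose (G i j) (s i) = fmap_compose \<Psi> (fmap_compose (r i)
          (fmap_compose (fmap_cnj (r j)) (fmap_compose (r i) \<Phi>c)))"
      proof -
        have "fmap_compose \<Phi> (s i) = fmap_compose (r i) \<Phi>c"
          unfolding s_def using ord_r\<Phi>c
          by (simp add: fmap_compose_assoc[OF ord(2), symmetric] inv(1) fmap_id_compose)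
        moreover have "ord_pos (s i)" unfolding s_def by (rule ord_pos_compose[OF ord(2)])
        ultimately have "fmap_compose (G i j) (s i)
            = fmap_compose \<Psi> (fmap_compose (f i j) (fmap_compose (r i) \<Phi>c))"
          unfolding G_def by (simp add: fmap_compose_assoc ord_f\<Phi> ord)
        thus ?thesis unfolding f_def using ord_r\<Phi>c by (simp add: fmap_compose_assoc r(2))
      qed
      moreover have "fmap_compose (s i) (fmap_cnj (G j i)) = fmap_compose \<Psi> (fmap_compose (r i)
          (fmap_compose (fmap_cnj (r j)) (fmap_compose (r i) \<Phi>c)))"
      proof -
        have "fmap_compose \<Phi> (G j i) = fmap_compose (f j i) \<Phi>"
          unfolding G_def using ord_f\<Phi>
          by (simp add: fmap_compose_assoc[OF ord(2), symmetric] inv(1) fmap_id_compose)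
        hence "fmap_compose \<Phi>c (fmap_cnj (G j i)) = fmap_cnj (fmap_compose (f j i) \<Phi>)"
          unfolding \<Phi>c_def by (metis fmap_cnj_compose)
        also have "\<dots> = fmap_compose (fmap_cnj (r j)) (fmap_compose (r i) \<Phi>c)"
          unfolding f_def fmap_cnj_compose \<Phi>c_def
          using ord(1) r(2) by (simp add: fmap_compose_assoc)
        finally show ?thesis
          unfolding s_def using G_ord \<Phi>c(3) ord_r\<Phi>c by (simp add: fmap_compose_assoc)
      qed
      ultimately show ?thesis by simp
    qed
    show "mpow (fmap_linear (B i)) Q \<in> vanishing N" if "Q \<notin> N" for Q
    proof -
      have "mfps_monom Q 1 \<in> I" using that out by (auto simp: exponents_outside_def)
      hence "mfps_compose (mfps_monom Q 1) (fmap_linear (B i)) \<in> vanishing N"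
        using assms(12) I_iff unfolding left_invariant_def by blast
      thus ?thesis by (simp add: vanishing_def compose_monom)
    qed
    show "\<exists>j. \<mu> i j $ k \<noteq> mpow (vcnj (\<mu> j i)) Q" if "Q \<in> N" "2 \<le> mdeg Q" for Q k
      using nonres[OF that, of i k] by (simp add: nonresonant_iff)
  qed
  have "cong_mod_cnj I (\<psi> \<circ> \<rho> i \<circ> \<phi>) (\<lambda>z. B i *v vcnj z)" for i
  proof (rule cong_mod_cnj_of_series)
    show "cong_mod I (\<psi> \<circ> (?r i \<circ> (\<lambda>z. vcnj (\<phi> (vcnj z))))) ((*v) (B i))"
      unfolding I
      by (rule cong_mod_of_series[OF S s_expansion has_expansion_linear])
        (use s_mod in \<open>simp add: N_def del: fmap_linear_nth\<close>)
    have "\<forall>\<^sub>F z in nhds 0. \<rho> i (\<phi> z) = ?r i (vcnj (\<phi> z))"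
      by (rule eventually_compose_filterlim[OF \<rho> map_expansion_tendsto_0[OF \<phi> ord(1)]])
    thus "\<forall>\<^sub>F z in nhds 0. (\<psi> \<circ> \<rho> i \<circ> \<phi>) z = (\<psi> \<circ> (?r i \<circ> (\<lambda>z. vcnj (\<phi> (vcnj z))))) (vcnj z)"
      by (rule eventually_mono) simp
  qed simp
  thus ?thesis using lin by blast
qed

end
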